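(* Let $(A_S,S)$ and $(A_{S'},S')$ be two Artin-Tits systems of type FC and let $\varphi_p: A_S\to A_{S'}$ be an LCM-homomorphism. Then $\varphi_p$ is injective.
   Context: Artin-Tits systems. Let $S$ be a finite set and $M=(m_{s,t})_{s,t\in S}$ a symmetric matrix with entries in $(\mathbb{N}\setminus\{0\})\cup\{\infty\}$, with $m_{s,s}=1$ and $m_{s,t}\neq 1$ for $s\ne t$. For elements $u,v$ and $m\in\mathbb{N}$ put $[u,v\rangle^m=\underbrace{uvu\cdots}_{m\text{ terms}}$. The Artin-Tits group is $A_S=\langle S\mid [s,t\rangle^{m_{s,t}}=[t,s\rangle^{m_{s,t}},\ s\neq t\in S,\ m_{s,t}\neq\infty\rangle$; the pair $(A_S,S)$ is called an Artin-Tits system. $A_S^+$ is the submonoid of $A_S$ generated by $S$ (it has the same presentation, as a monoid). The Coxeter group $W_S$ is obtained from the presentation of $A_S$ by adding the relations $s^2=1$, $s\in S$. For $T\subset S$, $A_T$ is the subgroup generated by $T$; $(A_T,T)$ is the Artin-Tits system of the matrix $(m_{s,t})_{s,t\in T}$. $T$ (or $A_T$) is of spherical type if $W_T$ is finite. For $u,v\in A_S^+$, $u\prec v$ means that $u$ divides $v$ on the left in $A_S^+$; $u\vee_\prec v$ denotes the least common multiple of $u,v$ for $\prec$ (it is $\infty$ if it does not exist). If $T\subset S$ is of spherical type, $\Delta_T\in A_S^+$ denotes the least common multiple of $T$ for $\prec$. Type FC. $(A_S,S)$ is of type FC if every subset $T\subset S$ such that $m_{s,t}\neq\infty$ for all $s,t\in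 T$ is of spherical type. LCM-homomorphism. Let $p$ be a map from $S$ to the set of nonempty subsets of $S'$ such that: (L0) if $s\neq t\in S$, then $p(s)\cap p(t)=\emptyset$; (L1) for $s\in S$, $p(s)$ is of spherical type; (L2) if $s\neq t\in S$ and $m_{s,t}\neq\infty$, then $[\Delta_{p(s)},\Delta_{p(t)}\rangle^{m_{s,t}}=[\Delta_{p(t)},\Delta_{p(s)}\rangle^{m_{s,t}}=\Delta_{p(s)}\vee_\prec\Delta_{p(t)}$ in $A_{S'}^+$; (L3) if $s\neq t\in S$ and $m_{s,t}=\infty$, then for every $u\in p(s)$ the set $\{u\}\cup p(t)$ is not of spherical type, and for every $u\in p(t)$ the set $\{u\}\cup p(s)$ is not of spherical type. Then $\varphi_p(s)=\Delta_{p(s)}$ ($s\in S$) defines a homomorphism $\varphi_p:A_S\to A_{S'}$; a homomorphism obtained in this way is called an LCM-homomorphism. *)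

theory Defs
  imports "HOL-Library.Extended_Nat" "HOL-Algebra.Divisibility" "HOL-Algebra.Elementary_Groups"
begin

section \<open>Groups given by generators and relations\<close>

text \<open>
  A letter \<open>(s, True)\<close> stands for the generator \<open>s\<close>, a letter \<open>(s, False)\<close> for its formal inverse.
  A relator is a pair of words, to be read as an equation.
\<close>

type_synonym 'a letters = "('a \<times> bool) list"

abbreviation words :: "'a set \<Rightarrow> 'a letters set"
  where "words S \<equiv> lists (S \<times> UNIV)"

inductive_set word_cong :: "'a set \<Rightarrow> ('a letters \<times> 'a letters) set \<Rightarrow> ('a letters \<times> 'a letters) set"
  for S R where
  refl: "w \<in> words S \<Longrightarrow> (w, w) \<in> word_cong S R"
| sym: "(v, w) \<in> word_cong S R \<Longrightarrow> (w, v) \<in> word_cong S R"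
| trans: "(u, v) \<in> word_cong S R \<Longrightarrow> (v, w) \<in> word_cong S R \<Longrightarrow> (u, w) \<in> word_cong S R"
| cancel: "u \<in> words S \<Longrightarrow> v \<in> words S \<Longrightarrow> s \<in> S \<Longrightarrow>
    (u @ [(s, b), (s, \<not> b)] @ v, u @ v) \<in> word_cong S R"
| rel: "u \<in> words S \<Longrightarrow> v \<in> words S \<Longrightarrow> l \<in> words S \<Longrightarrow> r \<in> words S \<Longrightarrow> (l, r) \<in> R \<Longrightarrow>
    (u @ l @ v, u @ r @ v) \<in> word_cong S R"

definition presented_group ::
    "'a set \<Rightarrow> ('a letters \<times> 'a letters) set \<Rightarrow> 'a letters set monoid" where
  "presented_group S R =
    \<lparr>carrier = words S // word_cong S R,
     monoid.mult = (\<lambda>U V. \<Union>x\<in>U. \<Union>y\<in>V. word_cong S R `` {x @ y}),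
     one = word_cong S R `` {[]}\<rparr>"

section \<open>Artin-Tits systems\<close>

definition coxeter_matrix :: "'a set \<Rightarrow> ('a \<Rightarrow> 'a \<Rightarrow> enat) \<Rightarrow> bool" where
  "coxeter_matrix S m \<longleftrightarrow> finite S \<and>
    (\<forall>s\<in>S. m s s = 1) \<and>
    (\<forall>s\<in>S. \<forall>t\<in>S. m s t = m t s \<and> m s t \<noteq> 0 \<and> (s \<noteq> t \<longrightarrow> m s t \<noteq> 1))"

fun alternating :: "nat \<Rightarrow> 'b \<Rightarrow> 'b \<Rightarrow> 'b list" where
  "alternating 0 u v = []"
| "alternating (Suc n) u v = u # alternating n v u"

definition alt_prod :: "('b, 'c) monoid_scheme \<Rightarrow> nat \<Rightarrow> 'b \<Rightarrow> 'b \<Rightarrow> 'b" where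
  "alt_prod G n u v = foldr (\<otimes>\<^bsub>G\<^esub>) (alternating n u v) \<one>\<^bsub>G\<^esub>"

definition artin_relators :: "'a set \<Rightarrow> ('a \<Rightarrow> 'a \<Rightarrow> enat) \<Rightarrow> ('a letters \<times> 'a letters) set" where
  "artin_relators S m =
    {(alternating n (s, True) (t, True), alternating n (t, True) (s, True)) | s t n.
      s \<in> S \<and> t \<in> S \<and> s \<noteq> t \<and> m s t = enat n}"

definition coxeter_relators :: "'a set \<Rightarrow> ('a \<Rightarrow> 'a \<Rightarrow> enat) \<Rightarrow> ('a letters \<times> 'a letters) set" where
  "coxeter_relators S m = artin_relators S m \<union> {([(s, True), (s, True)], []) | s. s \<in> S}"

definition artin_group :: "'a set \<Rightarrow> ('a \<Rightarrow> 'a \<Rightarrow> enat) \<Rightarrow> 'a letters set monoid" where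
  "artin_group S m = presented_group S (artin_relators S m)"

definition coxeter_group :: "'a set \<Rightarrow> ('a \<Rightarrow> 'a \<Rightarrow> enat) \<Rightarrow> 'a letters set monoid" where
  "coxeter_group S m = presented_group S (coxeter_relators S m)"

definition artin_gen :: "'a set \<Rightarrow> ('a \<Rightarrow> 'a \<Rightarrow> enat) \<Rightarrow> 'a \<Rightarrow> 'a letters set" where
  "artin_gen S m s = word_cong S (artin_relators S m) `` {[(s, True)]}"

text \<open>The submonoid \<open>A\<^sub>S\<^sup>+\<close> of \<open>A\<^sub>S\<close> generated by the standard generators.\<close>

definition artin_monoid :: "'a set \<Rightarrow> ('a \<Rightarrow> 'a \<Rightarrow> enat) \<Rightarrow> 'a letters set monoid" where
  "artin_monoid S m = (artin_group S m)
    \<lparr>carrier := (\<lambda>H. submonoid H (artin_group S m)) hull (artin_gen S m ` S)\<rparr>"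

text \<open>Spherical type depends only on the restriction of the matrix to \<open>T\<close>.\<close>

definition spherical :: "'a set \<Rightarrow> ('a \<Rightarrow> 'a \<Rightarrow> enat) \<Rightarrow> bool" where
  "spherical T m \<longleftrightarrow> finite (carrier (coxeter_group T m))"

definition type_FC :: "'a set \<Rightarrow> ('a \<Rightarrow> 'a \<Rightarrow> enat) \<Rightarrow> bool" where
  "type_FC S m \<longleftrightarrow> (\<forall>T\<subseteq>S. (\<forall>s\<in>T. \<forall>t\<in>T. m s t \<noteq> \<infinity>) \<longrightarrow> spherical T m)"

text \<open>
  In a noncommutative monoid the library's \<open>a divides b\<close> is divisibility on the left,
  \<open>b = a \<otimes> c\<close> for some \<open>c\<close>, so the following is the least common multiple for \<open>\<prec>\<close>.
\<close>

definition is_lcm :: "('b, 'c) monoid_scheme \<Rightarrow> 'b set \<Rightarrow> 'b \<Rightarrow> bool" where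
  "is_lcm M U x \<longleftrightarrow> x \<in> carrier M \<and> (\<forall>a\<in>U. a divides\<^bsub>M\<^esub> x) \<and>
    (\<forall>y\<in>carrier M. (\<forall>a\<in>U. a divides\<^bsub>M\<^esub> y) \<longrightarrow> x divides\<^bsub>M\<^esub> y)"

text \<open>
  Meaningful for \<open>T \<subseteq> S\<close> of spherical type, when the least common multiple exists;
  least common multiples in \<open>A\<^sub>S\<^sup>+\<close> are unique, see \<open>Delta_eq\<close> below.
\<close>

definition Delta :: "'a set \<Rightarrow> ('a \<Rightarrow> 'a \<Rightarrow> enat) \<Rightarrow> 'a set \<Rightarrow> 'a letters set" where
  "Delta S m T = (THE x. is_lcm (artin_monoid S m) (artin_gen S m ` T) x)"

section \<open>LCM-homomorphisms\<close>

definition lcm_datum :: "'a set \<Rightarrow> ('a \<Rightarrow> 'a \<Rightarrow> enat) \<Rightarrow> 'b set \<Rightarrow> ('b \<Rightarrow> 'b \<Rightarrow> enat) \<Rightarrow>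
    ('a \<Rightarrow> 'b set) \<Rightarrow> bool" where
  "lcm_datum S m S' m' p \<longleftrightarrow>
    (\<forall>s\<in>S. p s \<subseteq> S' \<and> p s \<noteq> {}) \<and>
    (\<forall>s\<in>S. \<forall>t\<in>S. s \<noteq> t \<longrightarrow> p s \<inter> p t = {}) \<and>
    (\<forall>s\<in>S. spherical (p s) m') \<and>
    (\<forall>s\<in>S. \<forall>t\<in>S. \<forall>n. s \<noteq> t \<and> m s t = enat n \<longrightarrow>
      (let M = artin_monoid S' m'; ds = Delta S' m' (p s); dt = Delta S' m' (p t) in
        alt_prod M n ds dt = alt_prod M n dt ds \<and> is_lcm M {ds, dt} (alt_prod M n dt ds))) \<and>
    (\<forall>s\<in>S. \<forall>t\<in>S. s \<noteq> t \<and> m s t = \<infinity> \<longrightarrow>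
      (\<forall>u\<in>p s. \<not> spherical ({u} \<union> p t) m') \<and> (\<forall>u\<in>p t. \<not> spherical ({u} \<union> p s) m'))"

text \<open>
  A homomorphism on \<open>artin_group S m\<close> is determined by its values on the standard generators;
  the universal property \<open>presented_group_hom\<close> below supplies its existence.
\<close>

definition lcm_homomorphism :: "'a set \<Rightarrow> ('a \<Rightarrow> 'a \<Rightarrow> enat) \<Rightarrow> 'b set \<Rightarrow> ('b \<Rightarrow> 'b \<Rightarrow> enat) \<Rightarrow>
    ('a \<Rightarrow> 'b set) \<Rightarrow> ('a letters set \<Rightarrow> 'b letters set) \<Rightarrow> bool" where
  "lcm_homomorphism S m S' m' p \<phi> \<longleftrightarrow> lcm_datum S m S' m' p \<and>
    \<phi> \<in> hom (artin_group S m) (artin_group S' m') \<and>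
    (\<forall>s\<in>S. \<phi> (artin_gen S m s) = Delta S' m' (p s))"

section \<open>Basic facts\<close>

lemma word_cong_words: "(v, w) \<in> word_cong S R \<Longrightarrow> v \<in> words S \<and> w \<in> words S"
  by (induction rule: word_cong.induct) auto

lemma equiv_word_cong: "equiv (words S) (word_cong S R)"
proof (rule equivI)
  show "word_cong S R \<subseteq> words S \<times> words S"
    using word_cong_words by fast
  show "refl_on (words S) (word_cong S R)"
    by (rule refl_onI) (rule word_cong.refl)
  show "sym (word_cong S R)"
    by (rule symI) (rule word_cong.sym)
  show "trans (word_cong S R)"
    by (rule transI) (rule word_cong.trans)
qed

lemma word_cong_append_left:
  assumes "(v, w) \<in> word_cong S R" "u \<in> words S"
  shows "(u @ v, u @ w) \<in> word_cong S R"
  using assms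
proof (induction rule: word_cong.induct)
  case (cancel u' v' s b)
  then show ?case using word_cong.cancel[of "u @ u'" S v' s b R] by auto
next
  case (rel u' v' l r)
  then show ?case using word_cong.rel[of "u @ u'" S v' l r R] by auto
next
  case (trans v1 v2 v3)
  then show ?case by (metis word_cong.trans)
next
  case (refl w)
  then show ?case by (intro word_cong.refl) simp
next
  case (sym v w)
  then show ?case by (metis word_cong.sym)
qed

lemma word_cong_append_right:
  assumes "(v, w) \<in> word_cong S R" "u \<in> words S"
  shows "(v @ u, w @ u) \<in> word_cong S R"
  using assms
proof (induction rule: word_cong.induct)
  case (cancel u' v' s b)
  then show ?case using word_cong.cancel[of u' S "v' @ u" s b R] by auto
next
  case (rel u' v' l r)
  then show ?case using word_cong.rel[of u' S "v' @ u" l r R] by auto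
next
  case (trans v1 v2 v3)
  then show ?case by (metis word_cong.trans)
next
  case (refl w)
  then show ?case by (intro word_cong.refl) simp
next
  case (sym v w)
  then show ?case by (metis word_cong.sym)
qed

lemma word_cong_append:
  "(v, w) \<in> word_cong S R \<Longrightarrow> (v', w') \<in> word_cong S R \<Longrightarrow> (v @ v', w @ w') \<in> word_cong S R"
  by (meson word_cong.trans word_cong_append_left word_cong_append_right word_cong_words)

lemma mult_presented_group:
  assumes "v \<in> words S" "w \<in> words S"
  shows "word_cong S R `` {v} \<otimes>\<^bsub>presented_group S R\<^esub> word_cong S R `` {w} = word_cong S R `` {v @ w}"
proof -
  have "word_cong S R `` {x @ y} = word_cong S R `` {v @ w}"
    if "(v, x) \<in> word_cong S R" "(w, y) \<in> word_cong S R" for x y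
    using equiv_class_eq[OF equiv_word_cong word_cong_append[OF that]] by simp
  then have "(\<Union>x\<in>word_cong S R `` {v}. \<Union>y\<in>word_cong S R `` {w}. word_cong S R `` {x @ y})
      = (\<Union>x\<in>word_cong S R `` {v}. \<Union>y\<in>word_cong S R `` {w}. word_cong S R `` {v @ w})"
    by (intro arg_cong[where f = Union] image_cong) simp_all
  also have "\<dots> = word_cong S R `` {v @ w}"
    using assms word_cong.refl[of v S R] word_cong.refl[of w S R] by blast
  finally show ?thesis
    by (simp add: presented_group_def)
qed

lemma presented_group_cases:
  assumes "U \<in> carrier (presented_group S R)"
  obtains w where "w \<in> words S" "U = word_cong S R `` {w}"
  using assms by (auto simp: presented_group_def quotient_def del: in_listsD)

lemma class_in_presented_group:
  "w \<in> words S \<Longrightarrow> word_cong S R `` {w} \<in> carrier (presented_group S R)"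
  by (simp add: presented_group_def quotientI)

lemma one_presented_group: "\<one>\<^bsub>presented_group S R\<^esub> = word_cong S R `` {[]}"
  by (simp add: presented_group_def)

lemma inverse_word_in_words: "w \<in> words S \<Longrightarrow> rev (map (apsnd Not) w) \<in> words S"
  by (induction w) auto

lemma word_cong_inverse:
  "w \<in> words S \<Longrightarrow> (rev (map (apsnd Not) w) @ w, []) \<in> word_cong S R"
proof (induction w)
  case (Cons x w)
  obtain s b where x: "x = (s, b)" by force
  have "(rev (map (apsnd Not) w) @ [(s, \<not> b), (s, \<not> \<not> b)] @ w, rev (map (apsnd Not) w) @ w)
      \<in> word_cong S R"
    using Cons.prems x inverse_word_in_words[of w S] by (intro word_cong.cancel) auto
  moreover have "(rev (map (apsnd Not) w) @ w, []) \<in> word_cong S R"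
    using Cons by simp
  ultimately show ?case using x word_cong.trans by force
qed (auto intro: word_cong.refl)

lemma group_presented_group: "group (presented_group S R)"
proof (rule groupI)
  fix U assume "U \<in> carrier (presented_group S R)"
  then obtain w where w: "w \<in> words S" "U = word_cong S R `` {w}"
    by (rule presented_group_cases)
  let ?v = "rev (map (apsnd Not) w)"
  have v: "?v \<in> words S" using w by (intro inverse_word_in_words)
  then have "word_cong S R `` {?v} \<otimes>\<^bsub>presented_group S R\<^esub> U = \<one>\<^bsub>presented_group S R\<^esub>"
    using w equiv_class_eq[OF equiv_word_cong word_cong_inverse]
    by (simp add: mult_presented_group one_presented_group)
  then show "\<exists>V\<in>carrier (presented_group S R). V \<otimes>\<^bsub>presented_group S R\<^esub> U = \<one>\<^bsub>presented_group S R\<^esub>"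
    using class_in_presented_group v by metis
next
  fix U V assume "U \<in> carrier (presented_group S R)" "V \<in> carrier (presented_group S R)"
  then show "U \<otimes>\<^bsub>presented_group S R\<^esub> V \<in> carrier (presented_group S R)"
    by (elim presented_group_cases) (simp add: mult_presented_group class_in_presented_group)
next
  fix U V W
  assume "U \<in> carrier (presented_group S R)" "V \<in> carrier (presented_group S R)"
    "W \<in> carrier (presented_group S R)"
  then show "U \<otimes>\<^bsub>presented_group S R\<^esub> V \<otimes>\<^bsub>presented_group S R\<^esub> W =
      U \<otimes>\<^bsub>presented_group S R\<^esub> (V \<otimes>\<^bsub>presented_group S R\<^esub> W)"
    by (elim presented_group_cases) (simp add: mult_presented_group)
next
  fix U assume "U \<in> carrier (presented_group S R)"
  then show "\<one>\<^bsub>presented_group S R\<^esub> \<otimes>\<^bsub>presented_group S R\<^esub> U = U"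
    by (elim presented_group_cases) (simp add: mult_presented_group one_presented_group)
next
  show "\<one>\<^bsub>presented_group S R\<^esub> \<in> carrier (presented_group S R)"
    unfolding one_presented_group by (rule class_in_presented_group) simp
qed

definition eval_word :: "('b, 'c) monoid_scheme \<Rightarrow> ('a \<Rightarrow> 'b) \<Rightarrow> 'a letters \<Rightarrow> 'b" where
  "eval_word G f w =
    foldr (\<lambda>(s, b) x. (if b then f s else inv\<^bsub>G\<^esub> f s) \<otimes>\<^bsub>G\<^esub> x) w \<one>\<^bsub>G\<^esub>"

lemma (in group) eval_word_closed:
  "f ` S \<subseteq> carrier G \<Longrightarrow> w \<in> words S \<Longrightarrow> eval_word G f w \<in> carrier G"
  by (induction w) (auto simp: eval_word_def image_subset_iff)

lemma (in group) eval_word_append: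
  "f ` S \<subseteq> carrier G \<Longrightarrow> v \<in> words S \<Longrightarrow> w \<in> words S \<Longrightarrow>
    eval_word G f (v @ w) = eval_word G f v \<otimes> eval_word G f w"
proof (induction v)
  case Nil
  then show ?case using eval_word_closed[of f S w] by (simp add: eval_word_def)
next
  case (Cons x v)
  then show ?case using eval_word_closed[of f S v] eval_word_closed[of f S w]
    by (auto simp: eval_word_def image_subset_iff m_assoc)
qed

lemma (in group) presented_group_hom:
  assumes f: "f ` S \<subseteq> carrier G"
    and R: "\<And>l r. (l, r) \<in> R \<Longrightarrow> l \<in> words S \<Longrightarrow> r \<in> words S \<Longrightarrow> eval_word G f l = eval_word G f r"
  shows "\<exists>\<phi>\<in>hom (presented_group S R) G. \<forall>w\<in>words S. \<phi> (word_cong S R `` {w}) = eval_word G f w"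
proof -
  have cong: "eval_word G f v = eval_word G f w" if "(v, w) \<in> word_cong S R" for v w
    using that
  proof (induction rule: word_cong.induct)
    case (cancel u v s b)
    have "eval_word G f [(s, b), (s, \<not> b)] = \<one>"
      using cancel f by (auto simp: eval_word_def)
    moreover have "[(s, b), (s, \<not> b)] \<in> words S" using cancel by simp
    ultimately show ?case
      using cancel eval_word_closed[OF f]
      by (simp add: eval_word_append[OF f] del: append.simps in_lists_conv_set)
  next
    case (rel u v l r)
    then show ?case using R[of l r] by (simp add: eval_word_append[OF f])
  qed auto
  define \<phi> where "\<phi> = (\<lambda>U. eval_word G f (SOME w. w \<in> U))"
  have \<phi>: "\<phi> (word_cong S R `` {w}) = eval_word G f w" if "w \<in> words S" for w
  proof -
    have "(w, SOME v. v \<in> word_cong S R `` {w}) \<in> word_cong S R"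
      using someI[of "\<lambda>v. v \<in> word_cong S R `` {w}" w] that by (auto intro: word_cong.refl)
    then show ?thesis using cong by (auto simp: \<phi>_def)
  qed
  have "\<phi> \<in> hom (presented_group S R) G"
  proof (rule homI)
    fix U assume "U \<in> carrier (presented_group S R)"
    then show "\<phi> U \<in> carrier G"
      by (elim presented_group_cases) (simp add: \<phi> eval_word_closed[OF f])
  next
    fix U V assume "U \<in> carrier (presented_group S R)" "V \<in> carrier (presented_group S R)"
    then show "\<phi> (U \<otimes>\<^bsub>presented_group S R\<^esub> V) = \<phi> U \<otimes> \<phi> V"
      by (elim presented_group_cases) (simp add: \<phi> mult_presented_group eval_word_append[OF f])
  qed
  then show ?thesis using \<phi> by blast
qed

lemma group_artin_group: "group (artin_group S m)"
  by (simp add: artin_group_def group_presented_group)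

lemma artin_gen_closed: "s \<in> S \<Longrightarrow> artin_gen S m s \<in> carrier (artin_group S m)"
  by (simp add: artin_gen_def artin_group_def class_in_presented_group)

lemma artin_monoid_least:
  "submonoid H (artin_group S m) \<Longrightarrow> artin_gen S m ` S \<subseteq> H \<Longrightarrow> carrier (artin_monoid S m) \<subseteq> H"
  by (auto simp: artin_monoid_def hull_def)

lemma submonoid_artin_monoid: "submonoid (carrier (artin_monoid S m)) (artin_group S m)"
proof -
  interpret group "artin_group S m" by (rule group_artin_group)
  have "submonoid (carrier (artin_group S m)) (artin_group S m)"
    by unfold_locales auto
  then have "carrier (artin_monoid S m) \<subseteq> carrier (artin_group S m)"
    by (rule artin_monoid_least) (auto intro: artin_gen_closed)
  then show ?thesis
    by unfold_locales
      (auto simp: artin_monoid_def hull_def intro: submonoid.m_closed submonoid.one_closed)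
qed

lemma artin_degree:
  obtains d where "d \<in> hom (artin_group S m) integer_group" "\<And>s. s \<in> S \<Longrightarrow> d (artin_gen S m s) = 1"
proof -
  interpret Z: group integer_group by (rule group_integer_group)
  have alt: "eval_word integer_group (\<lambda>_. 1) (alternating n (s, True) (t, True)) = int n"
    for n and s t :: 'a
    by (induction n arbitrary: s t) (auto simp: eval_word_def)
  have "\<exists>d\<in>hom (artin_group S m) integer_group. \<forall>w\<in>words S.
      d (word_cong S (artin_relators S m) `` {w}) = eval_word integer_group (\<lambda>_. 1) w"
    unfolding artin_group_def
    by (rule Z.presented_group_hom) (auto simp: artin_relators_def alt simp del: in_lists_conv_set)
  then show ?thesis
    using that by (force simp: artin_gen_def eval_word_def)
qed

lemma artin_monoid_divides_antisym:
  assumes "x divides\<^bsub>artin_monoid S m\<^esub> y" "y divides\<^bsub>artin_monoid S m\<^esub> x"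
    "x \<in> carrier (artin_monoid S m)"
  shows "x = y"
proof -
  let ?A = "artin_group S m" and ?P = "carrier (artin_monoid S m)"
  interpret group ?A by (rule group_artin_group)
  interpret P: submonoid ?P ?A by (rule submonoid_artin_monoid)
  obtain d where d: "d \<in> hom ?A integer_group" "\<And>s. s \<in> S \<Longrightarrow> d (artin_gen S m s) = 1"
    by (rule artin_degree) blast
  have dm: "d (u \<otimes>\<^bsub>?A\<^esub> v) = d u + d v" if "u \<in> carrier ?A" "v \<in> carrier ?A" for u v
    using hom_mult[OF d(1) that] by simp
  have "d \<one>\<^bsub>?A\<^esub> = 0"
    using dm[of "\<one>\<^bsub>?A\<^esub>" "\<one>\<^bsub>?A\<^esub>"] by simp
  then have "submonoid {u \<in> carrier ?A. 0 \<le> d u \<and> (d u = 0 \<longrightarrow> u = \<one>\<^bsub>?A\<^esub>)} ?A"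
    by unfold_locales (auto simp: dm)
  then have pos: "?P \<subseteq> {u \<in> carrier ?A. 0 \<le> d u \<and> (d u = 0 \<longrightarrow> u = \<one>\<^bsub>?A\<^esub>)}"
    by (rule artin_monoid_least) (auto simp: d(2) artin_gen_closed)
  have mult: "u \<otimes>\<^bsub>artin_monoid S m\<^esub> v = u \<otimes>\<^bsub>?A\<^esub> v" for u v
    by (simp add: artin_monoid_def)
  obtain a b where a: "a \<in> ?P" "y = x \<otimes>\<^bsub>?A\<^esub> a" and b: "b \<in> ?P" "x = y \<otimes>\<^bsub>?A\<^esub> b"
    using assms(1,2) by (auto simp: factor_def mult)
  have carr: "x \<in> carrier ?A" "y \<in> carrier ?A" "a \<in> carrier ?A" "b \<in> carrier ?A"
    using P.mem_carrier[OF assms(3)] P.mem_carrier[OF a(1)] P.mem_carrier[OF b(1)]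
      P.mem_carrier[OF P.m_closed[OF assms(3) a(1)]] a(2) by metis+
  have "d y = d x + d a"
    unfolding a(2) using carr by (intro dm)
  moreover have "d x = d y + d b"
    using dm[OF carr(2,4)] b(2) by metis
  moreover have "0 \<le> d a" "0 \<le> d b" using a(1) b(1) pos by auto
  ultimately have "d a = 0" by linarith
  then have "a = \<one>\<^bsub>?A\<^esub>" using a(1) pos by auto
  then show ?thesis using a(2) r_one[OF carr(1)] by metis
qed

lemma Delta_eq:
  assumes "is_lcm (artin_monoid S m) (artin_gen S m ` T) x"
  shows "Delta S m T = x"
  unfolding Delta_def
proof (rule the_equality)
  fix y assume "is_lcm (artin_monoid S m) (artin_gen S m ` T) y"
  then have "y divides\<^bsub>artin_monoid S m\<^esub> x" "x divides\<^bsub>artin_monoid S m\<^esub> y"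
    "y \<in> carrier (artin_monoid S m)"
    using assms by (simp_all add: is_lcm_def)
  then show "y = x"
    by (rule artin_monoid_divides_antisym)
qed (rule assms)

end

theory Submission
  imports Complex_Main Defs
begin

text \<open>
  Dehornoy showed that, in type FC, the elements of the Artin group have unique normal forms by
  irreducible multifractions \<open>a\<^sub>0 a\<^sub>1\<inverse> a\<^sub>2 a\<^sub>3\<inverse> \<dots>\<close> over the Artin monoid: any three elements of the
  monoid that have pairwise common multiples have a common multiple, and this makes the natural
  reduction of multifractions confluent. Irreducibility means that no letter \<open>s\<close> divides an entry
  \<open>a\<^sub>i\<^sub>+\<^sub>1\<close> and has a common multiple with \<open>a\<^sub>i\<close>. An LCM-homomorphism \<open>\<phi>\<close> reflects both properties: if
  \<open>u \<in> p s\<close> divides \<open>\<phi> a\<close>, then \<open>s\<close> divides \<open>a\<close>, and if \<open>u \<in> p s\<close> and \<open>\<phi> a\<close> have a common multiple,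
  then so have \<open>s\<close> and \<open>a\<close>. Hence \<open>\<phi>\<close> maps irreducible multifractions to irreducible ones and has
  trivial kernel. The properties of the Artin monoid (cancellation, least common multiples, Garside
  elements of spherical subsets) are derived from its simple elements, the lifts of the elements of
  the Coxeter group, which in turn are controlled by the geometric representation.
\<close>


section \<open>Words and the numbers game\<close>

text \<open>The group is in general not a group of fractions of its monoid, since letters joined by
  \<infinity> have no common multiple; so injectivity on the monoid does not by itself give
  injectivity on the group, and longer alternating fractions are needed. Uniqueness of normal forms
  is obtained through an action: a letter or its inverse is appended to an irreducible multifraction
  and the result is reduced, confluence making this compatible with the defining relations. The
  value of an irreducible \<open>c\<close> sends the trivial multifraction to \<open>c\<close>, so
  only the trivial one has value 1. The same action embeds the monoid of positive words into the
  group, which allows the submonoid generated by \<open>S\<close>, and the least common multiples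
  taken in it, to be replaced by words modulo braid relations. Reflection along
  \<open>\<phi>\<close> works letter by letter, and there type FC is decisive on the target side: an
  infinite label between \<open>s\<close> and \<open>t\<close> produces, for every letter of
  \<open>p s\<close>, an infinite label to some letter of \<open>p t\<close>.\<close>

class coxeter =
  fixes cm :: "'a \<Rightarrow> 'a \<Rightarrow> enat"
  assumes cm_self [simp]: "cm s s = 1"
    and cm_sym: "cm s t = cm t s"
    and cm_ge2: "s \<noteq> t \<Longrightarrow> 2 \<le> cm s t"

lemma cm_enat_ge2: "s \<noteq> t \<Longrightarrow> cm s t = enat n \<Longrightarrow> 2 \<le> n"
  using cm_ge2[of s t] by (simp add: numeral_eq_enat)

inductive braid :: "'s::coxeter list \<Rightarrow> 's list \<Rightarrow> bool" where
  braid_refl [intro!, simp]: "braid u u"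
| braid_sym: "braid u v \<Longrightarrow> braid v u"
| braid_trans [trans]: "braid u v \<Longrightarrow> braid v w \<Longrightarrow> braid u w"
| braid_swap: "s \<noteq> t \<Longrightarrow> cm s t = enat n \<Longrightarrow>
    braid (u @ alternating n s t @ v) (u @ alternating n t s @ v)"

lemma braid_context: "braid u v \<Longrightarrow> braid (a @ u @ b) (a @ v @ b)"
proof (induction rule: braid.induct)
  case (braid_swap s t n u v)
  then show ?case using braid.braid_swap[of s t n "a @ u" "v @ b"] by simp
qed (blast intro: braid_sym braid_trans)+

lemma braid_append: "braid u v \<Longrightarrow> braid u' v' \<Longrightarrow> braid (u @ u') (v @ v')"
  using braid_context[of u v "[]" u'] braid_context[of u' v' v "[]"] braid_trans by fastforce

lemma braid_length: "braid u v \<Longrightarrow> length u = length v"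
proof (induction rule: braid.induct)
  case (braid_swap s t n u v)
  have "length (alternating n a b) = n" for a b :: 'a
    by (induction n arbitrary: a b) auto
  then show ?case by simp
qed auto

text \<open>Words will be played from right to left, hence alternating words with a given last letter; the
  letter \<open>nxt k s t\<close> prolongs the one of length \<open>k\<close> that ends in \<open>s\<close>.\<close>

definition nxt :: "nat \<Rightarrow> 'b \<Rightarrow> 'b \<Rightarrow> 'b" where
  "nxt k s t = (if even k then s else t)"

fun altend :: "nat \<Rightarrow> 'b \<Rightarrow> 'b \<Rightarrow> 'b list" where
  "altend 0 s t = []"
| "altend (Suc k) s t = nxt k s t # altend k s t"

lemma nxt_Suc: "nxt (Suc k) s t = nxt k t s"
  by (simp add: nxt_def)

lemma altend_alternating: "altend k s t = alternating k (nxt k t s) (nxt k s t)"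
  by (induction k) (auto simp: nxt_def)

lemma alternating_altend: "alternating k s t = altend k (nxt k t s) (nxt k s t)"
  by (auto simp: altend_alternating nxt_def)

lemma altend_snoc: "altend (Suc k) s t = altend k t s @ [s]"
  by (induction k) (auto simp: nxt_def)

lemma set_altend: "set (altend k s t) \<subseteq> {s, t}"
  by (induction k) (auto simp: nxt_def)

lemma length_altend [simp]: "length (altend k s t) = k"
  by (induction k) auto

lemma rev_alternating: "rev (alternating k s t) = altend k s t"
proof (induction k arbitrary: s t)
  case (Suc k)
  then show ?case by (simp add: altend_snoc del: altend.simps)
qed simp

lemma length_alternating [simp]: "length (alternating k s t) = k"
  by (simp add: alternating_altend)

lemma set_alternating: "set (alternating k s t) \<subseteq> {s, t}"
  by (induction k arbitrary: s t) auto

lemma braid_rev: "braid u v \<Longrightarrow> braid (rev u) (rev v)"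
proof (induction rule: braid.induct)
  case (braid_swap s t n u v)
  have "braid (rev v @ alternating n (nxt n s t) (nxt n t s) @ rev u)
      (rev v @ alternating n (nxt n t s) (nxt n s t) @ rev u)"
    using braid_swap by (intro braid.braid_swap) (auto simp: nxt_def cm_sym)
  then show ?case
    by (simp add: rev_alternating altend_alternating braid_sym)
qed (blast intro: braid_sym braid_trans)+

lemma braid_set: "braid u v \<Longrightarrow> set u = set v"
proof (induction rule: braid.induct)
  case (braid_swap s t n u v)
  obtain k where n: "n = Suc (Suc k)"
    using cm_enat_ge2[OF braid_swap] by (metis add_2_eq_Suc le_Suc_ex)
  have "set (alternating n a b) = {a, b}" for a b :: 'a
    using set_alternating[of k a b] by (auto simp: n)
  then show ?case by auto
qed auto

text \<open>
  Mozes' numbers game: a position is a real function on the letters and firing \<open>s\<close> applies the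
  contragredient of the geometric representation.
\<close>

definition coef :: "'s::coxeter \<Rightarrow> 's \<Rightarrow> real" where
  "coef s t = (if s = t then -2 else case cm s t of enat n \<Rightarrow> 2 * cos (pi / n) | \<infinity> \<Rightarrow> 2)"

definition fire :: "'s::coxeter \<Rightarrow> ('s \<Rightarrow> real) \<Rightarrow> 's \<Rightarrow> real" where
  "fire s f = (\<lambda>u. f u + coef s u * f s)"

fun play :: "'s::coxeter list \<Rightarrow> ('s \<Rightarrow> real) \<Rightarrow> 's \<Rightarrow> real" where
  "play [] f = f"
| "play (s # w) f = fire s (play w f)"

lemma play_append [simp]: "play (u @ v) f = play u (play v f)"
  by (induction u) auto

text \<open>The constant 1 is a functional that is positive on all simple roots, so the sign of
  \<open>pos w s\<close> tells whether multiplying by \<open>s\<close> on the left lengthens the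
  group element of \<open>w\<close>.\<close>

abbreviation pos :: "'s::coxeter list \<Rightarrow> 's \<Rightarrow> real" where
  "pos w \<equiv> play w (\<lambda>_. 1)"

lemma coef_sym: "coef s t = coef t s"
  by (simp add: coef_def cm_sym)

lemma fire_apply: "fire s f u = f u + coef s u * f s"
  by (simp add: fire_def)

lemma fire_self: "fire s f s = - f s"
  by (simp add: fire_def coef_def)

lemma fire_fire: "fire s (fire s f) = f"
  by (rule ext) (simp add: fire_def coef_def)

lemma play_cancel: "play w f = play w g \<Longrightarrow> f = g"
  by (induction w arbitrary: f g) (auto, metis fire_fire)

lemma play_rev: "play (rev w) (play w f) = f"
  by (induction w arbitrary: f) (auto simp: fire_fire)

section \<open>Dihedral games and the sine formula\<close>

fun chain :: "real \<Rightarrow> real \<Rightarrow> real \<Rightarrow> nat \<Rightarrow> real" where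
  "chain c x y 0 = - y"
| "chain c x y (Suc 0) = x"
| "chain c x y (Suc (Suc k)) = c * chain c x y (Suc k) - chain c x y k"

text \<open>Firing changes the sign of the fired letter, so the two letters always carry consecutive
  terms of one sequence up to sign; the seeds \<open>- y\<close> and \<open>x\<close> make this
  pattern valid before the first move. For c = 2 cos \<theta> the recurrence is that of the
  Chebyshev polynomials, whence the sines in \<open>chain_sin\<close>.\<close>

lemma play_altend:
  assumes "s \<noteq> t"
  shows "play (altend k s t) f (nxt k s t) = chain (coef s t) (f s) (f t) (Suc k)
    \<and> play (altend k s t) f (nxt (Suc k) s t) = - chain (coef s t) (f s) (f t) k"
proof (induction k)
  case (Suc k)
  have ne: "nxt k s t \<noteq> nxt (Suc k) s t" and c: "coef (nxt k s t) (nxt (Suc k) s t) = coef s t"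
    using assms by (auto simp: nxt_def coef_sym)
  have "nxt (Suc (Suc k)) s t = nxt k s t" by (simp add: nxt_def)
  then show ?case using Suc c by (simp add: fire_self fire_apply)
qed (simp add: nxt_def)

lemma chain_sin:
  assumes "sin \<theta> \<noteq> 0"
  shows "chain (2 * cos \<theta>) x y k = (x * sin (k * \<theta>) + y * sin ((real k - 1) * \<theta>)) / sin \<theta>"
proof (induction "2 * cos \<theta>" x y k rule: chain.induct)
  case (3 x y k)
  have "sin (a + \<theta>) = 2 * cos \<theta> * sin a - sin (a - \<theta>)" for a
    by (simp add: sin_add sin_diff)
  from this[of "(real k + 1) * \<theta>"] this[of "real k * \<theta>"]
  have e: "sin ((real k + 2) * \<theta>) = 2 * cos \<theta> * sin ((real k + 1) * \<theta>) - sin (real k * \<theta>)"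
    "sin ((real k + 1) * \<theta>) = 2 * cos \<theta> * sin (real k * \<theta>) - sin ((real k - 1) * \<theta>)"
    by (simp_all add: algebra_simps)
  have "sin \<theta> * chain (2 * cos \<theta>) x y (Suc (Suc k))
      = 2 * cos \<theta> * (sin \<theta> * chain (2 * cos \<theta>) x y (Suc k)) - sin \<theta> * chain (2 * cos \<theta>) x y k"
    by (simp add: algebra_simps)
  also have "\<dots> = 2 * cos \<theta> * (x * sin ((real k + 1) * \<theta>) + y * sin (real k * \<theta>))
        - (x * sin (real k * \<theta>) + y * sin ((real k - 1) * \<theta>))"
    using 3 assms by (simp add: add.commute)
  also have "\<dots> = x * (2 * cos \<theta> * sin ((real k + 1) * \<theta>) - sin (real k * \<theta>))
      + y * (2 * cos \<theta> * sin (real k * \<theta>) - sin ((real k - 1) * \<theta>))"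
    by (simp add: algebra_simps)
  also have "\<dots> = x * sin ((real k + 2) * \<theta>) + y * sin ((real k + 1) * \<theta>)"
    using e by simp
  finally show ?case
    using assms by (simp add: field_simps add.commute)
qed (use assms in \<open>simp_all add: sin_minus\<close>)

lemma chain_two: "chain 2 x y k = real k * x + (real k - 1) * y"
  by (induction "2 :: real" x y k rule: chain.induct) (auto simp: algebra_simps)

lemma chain_finite:
  assumes "s \<noteq> t" "cm s t = enat n"
  shows "chain (coef s t) x y n = y" "chain (coef s t) x y (Suc n) = - x"
    and "\<lbrakk>0 < x; 0 < y; 0 < k; k \<le> n\<rbrakk> \<Longrightarrow> 0 < chain (coef s t) x y k"
    and "(coef s t)\<^sup>2 < 4"
proof -
  define \<theta> where "\<theta> = pi / n"
  have n: "2 \<le> n" by (rule cm_enat_ge2[OF assms])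
  have \<theta>: "0 < \<theta>" "\<theta> < pi" "n * \<theta> = pi" "\<theta> \<le> pi / 2"
    using n by (auto simp: \<theta>_def field_simps)
  have c: "coef s t = 2 * cos \<theta>" using assms by (simp add: coef_def \<theta>_def)
  have sin: "0 < sin \<theta>" using \<theta> by (intro sin_gt_zero)
  have e: "(real n - 1) * \<theta> = pi - \<theta>" "(1 + real n) * \<theta> = pi + \<theta>"
    using \<theta> by (auto simp: algebra_simps)
  show "chain (coef s t) x y n = y" "chain (coef s t) x y (Suc n) = - x"
    using sin by (simp_all add: c chain_sin \<theta> e sin_add)
  show "0 < chain (coef s t) x y k" if "0 < x" "0 < y" "0 < k" "k \<le> n"
  proof -
    have le: "real j * \<theta> \<le> pi" if "j \<le> n" for j
      using that \<theta>(1) unfolding \<theta>(3)[symmetric] by (intro mult_right_mono) auto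
    have lt: "real j * \<theta> < pi" if "j < n" for j
      using that \<theta>(1) unfolding \<theta>(3)[symmetric] by (intro mult_strict_right_mono) auto
    have k1: "(real k - 1) * \<theta> = real (k - 1) * \<theta>" using that by simp
    have a: "0 \<le> sin (real k * \<theta>)" "0 \<le> sin ((real k - 1) * \<theta>)"
      unfolding k1 using \<theta> le[of k] le[of "k - 1"] that by (auto intro!: sin_ge_zero)
    have "0 < x * sin (real k * \<theta>) + y * sin ((real k - 1) * \<theta>)"
    proof (cases "k = n")
      case True
      then have "sin ((real k - 1) * \<theta>) = sin \<theta>" unfolding True e(1) by simp
      then show ?thesis using a sin that by (simp add: add_nonneg_pos)
    next
      case False
      then have "0 < sin (real k * \<theta>)" using that \<theta> lt[of k] by (intro sin_gt_zero) auto
      then show ?thesis using a that by (intro add_pos_nonneg) auto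
    qed
    then show ?thesis using sin by (simp add: c chain_sin)
  qed
  have "0 \<le> cos \<theta>" using \<theta> by (intro cos_ge_zero) auto
  moreover have "cos \<theta> < 1" using cos_monotone_0_pi[of 0 \<theta>] \<theta> by simp
  ultimately have "(cos \<theta>)\<^sup>2 < 1" by (simp add: power_less_one_iff)
  then show "(coef s t)\<^sup>2 < 4" by (simp add: c power_mult_distrib)
qed

lemma chain_pos:
  assumes "s \<noteq> t" "0 < x" "0 < y" "0 < k" "enat k \<le> cm s t"
  shows "0 < chain (coef s t) x y k"
proof (cases "cm s t")
  case (enat n)
  then show ?thesis using assms chain_finite(3)[OF assms(1) enat] by simp
next
  case infinity
  have "0 < real k * x" "0 \<le> (real k - 1) * y" using assms by auto
  then have "0 < real k * x + (real k - 1) * y" by linarith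
  then show ?thesis using infinity assms by (simp add: coef_def chain_two)
qed

lemma play_two_letters:
  assumes "set w \<subseteq> {s, t}"
  shows "\<exists>A B. \<forall>u. play w f u = f u + coef s u * A + coef t u * B"
  using assms
proof (induction w)
  case (Cons a w)
  then obtain A B where AB: "\<forall>u. play w f u = f u + coef s u * A + coef t u * B" by auto
  let ?x = "play w f a"
  show ?case
  proof (cases "a = s")
    case True
    then show ?thesis using AB
      by (intro exI[of _ "A + ?x"] exI[of _ B]) (auto simp: fire_def algebra_simps)
  next
    case False
    then have "a = t" using Cons by auto
    then show ?thesis using AB
      by (intro exI[of _ A] exI[of _ "B + ?x"]) (auto simp: fire_def algebra_simps)
  qed
qed (auto intro: exI[of _ 0])

text \<open>Either play adds to \<open>f\<close> a combination of the rows \<open>coef s\<close> and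
  \<open>coef t\<close>. The results agree at \<open>s\<close> and \<open>t\<close>, and as the form
  is nondegenerate on the plane of \<open>s\<close> and \<open>t\<close>, this determines both
  coefficients and hence all values.\<close>

lemma play_altend_swap:
  assumes "s \<noteq> t" "cm s t = enat n"
  shows "play (altend n s t) f = play (altend n t s) f"
proof -
  let ?P = "play (altend n s t) f" and ?Q = "play (altend n t s) f"
  have t: "t \<noteq> s" "cm t s = enat n" using assms by (auto simp: cm_sym)
  have "?P (nxt n s t) = ?Q (nxt n s t)" "?P (nxt n t s) = ?Q (nxt n t s)"
    using play_altend[OF assms(1), of n f] play_altend[OF t(1), of n f]
      chain_finite(1,2)[OF assms] chain_finite(1,2)[OF t]
    by (simp_all add: nxt_Suc)
  then have st: "?P s = ?Q s" "?P t = ?Q t"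
    by (auto simp: nxt_def split: if_splits)
  obtain A B where AB: "\<And>u. ?P u = f u + coef s u * A + coef t u * B"
    using play_two_letters[OF set_altend] by meson
  obtain A' B' where AB': "\<And>u. ?Q u = f u + coef s u * A' + coef t u * B'"
    using play_two_letters[of "altend n t s" s t f] set_altend[of n t s] by blast
  let ?c = "coef s t" and ?a = "A - A'" and ?b = "B - B'"
  have e: "?c * ?b = 2 * ?a" "?c * ?a = 2 * ?b"
    using st AB[of s] AB[of t] AB'[of s] AB'[of t] coef_sym[of s t]
    by (auto simp: coef_def[of s s] coef_def[of t t] algebra_simps)
  \<comment> \<open>The 2 by 2 system for the differences of the coefficients has determinant 4 -
    c*c, nonzero for a finite label.\<close>
  have "?c\<^sup>2 * ?a = 4 * ?a" "?c\<^sup>2 * ?b = 4 * ?b"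
    using e by (simp_all only: power2_eq_square mult.assoc)
  then have "?a = 0" "?b = 0"
    using chain_finite(4)[OF assms] by (metis less_irrefl mult_cancel_right)+
  then show ?thesis using AB AB' by auto
qed

lemma play_braid: "braid u v \<Longrightarrow> play u f = play v f"
proof (induction rule: braid.induct)
  case (braid_swap s t n u v)
  have "play (alternating n s t) f = play (alternating n t s) f" for f
    using play_altend_swap[of "nxt n t s" "nxt n s t" n f] braid_swap
    unfolding alternating_altend[of n s t] alternating_altend[of n t s]
    by (auto simp: nxt_def cm_sym)
  then show ?case by simp
qed auto

text \<open>The reduced words of the Coxeter group, recognized by signs: firing a positive letter
  lengthens the element.\<close>

fun legal :: "'s::coxeter list \<Rightarrow> bool" where
  "legal [] = True"
| "legal (s # w) = (legal w \<and> 0 < pos w s)"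

lemma legal_appendD: "legal (u @ v) \<Longrightarrow> legal v"
  by (induction u) auto

lemma legal_replace: "legal (u @ a @ h) \<Longrightarrow> legal (b @ h) \<Longrightarrow> play a (pos h) = play b (pos h)
    \<Longrightarrow> legal (u @ b @ h)"
  by (induction u) auto

lemma legal_altend:
  assumes "s \<noteq> t" "legal h" "0 < pos h s" "0 < pos h t" "enat k \<le> cm s t"
  shows "legal (altend k s t @ h)"
  using assms(5)
proof (induction k)
  case (Suc k)
  then have "enat k \<le> cm s t" by (metis enat_ord_simps(1) le_SucI le_refl order_trans)
  then show ?case
    using Suc play_altend[OF assms(1), of k "pos h"] chain_pos[OF assms(1,3,4), of "Suc k"] by simp
qed (use assms in simp)

lemma legal_altend_fst: "legal (altend k s t @ h) \<Longrightarrow> 0 < k \<Longrightarrow> 0 < pos h s"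
  using legal_appendD[of "altend (k - 1) t s" "s # h"] altend_snoc[of "k - 1" s t] by fastforce

lemma legal_altend_le:
  assumes "s \<noteq> t" "legal (altend k s t @ h)"
  shows "enat k \<le> cm s t"
proof (cases "cm s t")
  case (enat n)
  have "k \<le> n"
  proof (rule ccontr)
    assume "\<not> k \<le> n"
    then have "legal (altend (Suc n) s t @ h)"
      using assms(2) by (induction k) (auto simp: le_Suc_eq not_le less_Suc_eq)
    then have "0 < pos (altend n s t @ h) (nxt n s t)" "0 < pos h s"
      using legal_altend_fst[of "Suc n" s t h] by auto
    then show False
      using play_altend[OF assms(1), of n "pos h"] chain_finite(2)[OF assms(1) enat] by simp
  qed
  then show ?thesis by (simp add: enat)
qed simp

text \<open>By \<open>chain_finite\<close> the sequence takes the value \<open>y\<close> at index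
  \<open>n\<close>, so the last move of one word is allowed exactly when the letter with which the
  other word starts its play is positive.\<close>

lemma legal_altend_swap:
  assumes "s \<noteq> t" "cm s t = enat n" "legal (altend n s t @ h)"
  shows "legal (altend n t s @ h)"
proof (rule legal_altend)
  obtain k where k: "n = Suc k" using cm_enat_ge2[OF assms(1,2)] by (cases n) auto
  show "0 < pos h t"
    using assms(3) play_altend[OF assms(1), of k "pos h"] chain_finite(1)[OF assms(1,2)] by (simp add: k)
  show "0 < pos h s" using legal_altend_fst[OF assms(3)] k by simp
qed (use assms legal_appendD in \<open>auto simp: cm_sym\<close>)

lemma legal_braid: "braid u v \<Longrightarrow> legal u = legal v"
proof (induction rule: braid.induct)
  case (braid_swap s t n u v)
  have *: "legal (u @ alternating n b a @ v)"
    if "legal (u @ alternating n a b @ v)" "a \<noteq> b" "cm a b = enat n" for a b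
  proof (rule legal_replace[OF that(1)])
    have "legal (alternating n a b @ v)" using legal_appendD that(1) by blast
    then have "legal (altend n (nxt n b a) (nxt n a b) @ v)" by (simp add: alternating_altend)
    then have "legal (altend n (nxt n a b) (nxt n b a) @ v)"
      using that by (intro legal_altend_swap[of "nxt n b a" "nxt n a b"]) (auto simp: nxt_def cm_sym)
    then show "legal (alternating n b a @ v)" by (simp add: alternating_altend)
    show "play (alternating n a b) (pos v) = play (alternating n b a) (pos v)"
      using play_braid[OF braid.braid_swap[OF that(2,3), of "[]" "[]"]] by simp
  qed
  show ?case using *[of s t] *[of t s] braid_swap by (auto simp: cm_sym)
qed auto

text \<open>
  A letter that is negative after a legal play can be moved to the front. Prolonging the dihedral
  head \<open>\<dots> t s t\<close> of the word as far as possible leads to a position where \<open>s\<close> and \<open>t\<close> are both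
  positive, and from there on the game is the explicit one for a dihedral group.
\<close>

lemma legal_descent:
  assumes "legal e"
  shows "pos e s \<noteq> 0 \<and> (pos e s < 0 \<longrightarrow> (\<exists>e'. braid e (s # e'))
    \<and> (\<forall>t e1. e = t # e1 \<and> s \<noteq> t \<longrightarrow>
      (\<exists>n h. cm s t = enat n \<and> braid e (alternating n s t @ h))))"
  using assms
proof (induction "length e" arbitrary: e s rule: less_induct)
  case less
  show ?case
  proof (cases e)
    case (Cons t e1)
    show ?thesis
    proof (cases "s = t")
      case True
      then show ?thesis using Cons less.prems by (auto simp: fire_self)
    next
      case False
      \<comment> \<open>\<open>Q k\<close> says that, up to braid relations, \<open>e\<close> begins
        with an alternating word of length \<open>k\<close> in \<open>s\<close> and \<open>t\<close>
        whose prolongation to the left would be \<open>s\<close>. For k = 1 this is the first letter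
        \<open>t\<close>.\<close>
      define Q where "Q k \<longleftrightarrow> (\<exists>a b h. {a, b} = {s, t} \<and> nxt k a b = s \<and> 1 \<le> k
          \<and> braid e (altend k a b @ h))" for k
      have "Q 1" unfolding Q_def
        by (intro exI[of _ t] exI[of _ s] exI[of _ e1]) (auto simp: nxt_def Cons)
      moreover have "k \<le> length e" if "Q k" for k
        using that braid_length[of e] unfolding Q_def by fastforce
      ultimately obtain k where k: "Q k" and max: "\<And>k'. Q k' \<Longrightarrow> k' \<le> k"
        by (metis Nat.ex_has_greatest_nat)
      then obtain a b h where abh: "{a, b} = {s, t}" "nxt k a b = s" "1 \<le> k"
        "braid e (altend k a b @ h)"
        unfolding Q_def by blast
      have ab: "a \<noteq> b" using abh(1) False by (auto simp: doubleton_eq_iff)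
      have leg: "legal (altend k a b @ h)" using legal_braid[OF abh(4)] less.prems by simp
      then have h: "legal h" "0 < pos h a"
        using legal_appendD[OF leg] legal_altend_fst[OF leg] abh(3) by auto
      have len: "length h < length e" using braid_length[OF abh(4)] abh(3) by simp
      have "\<not> pos h b < 0"
      proof
        assume "pos h b < 0"
        then obtain h' where "braid h (b # h')" using less.hyps[OF len h(1)] by blast
        then have "braid (altend k a b @ h) (altend k a b @ b # h')"
          using braid_context[of h "b # h'" "altend k a b" "[]"] by simp
        moreover have "altend k a b @ b # h' = altend (Suc k) b a @ h'"
          by (simp add: altend_snoc del: altend.simps)
        ultimately have "Q (Suc k)" unfolding Q_def using abh
          by (intro exI[of _ b] exI[of _ a] exI[of _ h'])
            (auto simp: nxt_Suc del: altend.simps intro: braid_trans)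
        then show False using max by fastforce
      qed
      then have hb: "0 < pos h b" using less.hyps[OF len h(1), of b] by linarith
      have e: "pos e s = chain (coef a b) (pos h a) (pos h b) (Suc k)"
        using play_braid[OF abh(4)] play_altend[OF ab, of k "pos h"] abh(2) by simp
      \<comment> \<open>Either one more letter fits into the dihedral group, and \<open>s\<close> is
        positive, or the head has the full length of the braid relation and can be rewritten to
        begin with \<open>s\<close>.\<close>
      show ?thesis
      proof (cases "enat (Suc k) \<le> cm a b")
        case True
        then show ?thesis using chain_pos[OF ab h(2) hb] e by fastforce
      next
        case False
        then have n: "cm a b = enat k" using legal_altend_le[OF ab leg]
          by (cases "cm a b") auto
        have "braid e (altend k b a @ h)"
        proof -
          have "braid (altend k a b @ h) (altend k b a @ h)"
            using braid_swap[of "nxt k b a" "nxt k a b" k "[]" h] ab n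
            by (auto simp: altend_alternating nxt_def cm_sym)
          then show ?thesis using abh(4) braid_trans by blast
        qed
        moreover obtain j where "k = Suc j" using abh(3) by (cases k) auto
        ultimately have "\<exists>e'. braid e (s # e')"
          using abh(2) by (auto simp: nxt_Suc)
        moreover have "\<exists>n h. cm s t = enat n \<and> braid e (alternating n s t @ h)"
        proof -
          have "cm s t = enat k" "nxt k b a = t"
            using abh(1,2) n False by (auto simp: nxt_def cm_sym doubleton_eq_iff)
          then have "altend k b a = alternating k s t" using abh(2) by (simp add: altend_alternating)
          then show ?thesis using \<open>braid e (altend k b a @ h)\<close> \<open>cm s t = enat k\<close> by auto
        qed
        moreover have "pos e s < 0"
          using e chain_finite(2)[OF ab n] h(2) by simp
        ultimately show ?thesis using Cons by simp
      qed
    qed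
  qed simp
qed

text \<open>Matsumoto's theorem and the faithfulness of the geometric representation in one
  statement. The letter fired last in \<open>e\<close> is negative at the common position, so
  \<open>legal_descent\<close> brings it to the front of \<open>e'\<close>, and both words
  shorten.\<close>

lemma legal_pos_braid:
  assumes "legal e" "legal e'" "pos e = pos e'"
  shows "braid e e'"
  using assms
proof (induction e arbitrary: e')
  case Nil
  show ?case
  proof (cases e')
    case (Cons s e1)
    then have "pos e' s < 0" using Nil(2) by (simp only: play.simps legal.simps fire_self neg_less_0_iff_less)
    then show ?thesis unfolding Nil(3)[symmetric] by simp
  qed simp
next
  case (Cons s e1)
  then have "pos e' s < 0" by (metis fire_self play.simps(2) legal.simps(2) neg_less_0_iff_less)
  then obtain e2 where e2: "braid e' (s # e2)" using legal_descent[OF Cons(3)] by blast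
  then have "legal (s # e2)" using legal_braid Cons(3) by blast
  moreover have "pos (s # e2) = pos (s # e1)" using play_braid[OF e2] Cons(4) by simp
  moreover have "pos e1 = pos e2" using calculation(2) by (metis play.simps(2) fire_fire)
  ultimately have "braid e1 e2" using Cons by auto
  then have "braid (s # e1) (s # e2)" using braid_context[of e1 e2 "[s]" "[]"] by simp
  then show ?case using e2 braid_sym braid_trans by blast
qed

text \<open>The exchange argument: a negative letter \<open>s\<close> put before a legal word
  cancels against the \<open>s\<close> that \<open>legal_descent\<close> brings to the front. The
  plays agree for every \<open>f\<close>, as braid relations and squares act trivially on all
  positions.\<close>

lemma legal_cases:
  obtains "legal w" | e where "legal e" "\<And>f. play e f = play w f" "length e < length w"
proof -
  have "legal w \<or> (\<exists>e. legal e \<and> (\<forall>f. play e f = play w f) \<and> length e < length w)"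
  proof (induction w)
    case (Cons s w)
    have *: "legal (s # e) \<or> (\<exists>e'. legal e' \<and> (\<forall>f. play e' f = play (s # e) f) \<and> length e' < length (s # e))"
      if e: "legal e" for e
    proof (cases "pos e s < 0")
      case True
      then obtain e' where e': "braid e (s # e')" using legal_descent[OF e] by blast
      then have "legal e'" using legal_braid e by (metis legal.simps(2))
      moreover have "play e' f = play (s # e) f" for f
        using play_braid[OF e', of f] by (simp add: fire_fire)
      ultimately show ?thesis using braid_length[OF e'] by fastforce
    next
      case False
      then have "0 < pos e s" using legal_descent[OF e, of s] by linarith
      then show ?thesis using e by simp
    qed
    show ?case
    proof (cases "legal w")
      case True
      then show ?thesis by (rule *)
    next
      case False
      then obtain e where e: "legal e" "\<And>f. play e f = play w f" "length e < length w"
        using Cons by blast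
      from *[OF e(1)] show ?thesis
      proof
        assume "legal (s # e)"
        then show ?thesis using e by (intro disjI2 exI[of _ "s # e"]) auto
      next
        assume "\<exists>e'. legal e' \<and> (\<forall>f. play e' f = play (s # e) f) \<and> length e' < length (s # e)"
        then obtain e' where "legal e'" "\<forall>f. play e' f = play (s # e) f" "length e' < length (s # e)"
          by blast
        then show ?thesis using e by (intro disjI2 exI[of _ e']) auto
      qed
    qed
  qed simp
  then show thesis using that by blast
qed

text \<open>A shorter word playing like \<open>rev e\<close> would, reversed once more, yield a
  legal word with the position of \<open>e\<close> and smaller length, while legal words with the
  same position have equal length.\<close>

lemma legal_rev:
  assumes "legal e"
  shows "legal (rev e)"
proof (cases rule: legal_cases[of "rev e"])
  case (2 e')
  have "play (rev e') f = play e f" for f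
  proof -
    have "play (rev e') (play e' (play e f)) = play e f" by (rule play_rev)
    then show ?thesis unfolding 2(2) play_rev .
  qed
  then obtain e'' where e'': "legal e''" "pos e'' = pos e" "length e'' < length e"
  proof (cases rule: legal_cases[of "rev e'"])
    case 1
    then show ?thesis using that[of "rev e'"] \<open>\<And>f. play (rev e') f = play e f\<close> 2(3) by simp
  next
    case (2 e2)
    then show ?thesis using that[of e2] \<open>\<And>f. play (rev e') f = play e f\<close> \<open>length e' < length (rev e)\<close>
      by simp
  qed
  then show ?thesis using braid_length[OF legal_pos_braid[OF e''(1) assms e''(2)]] by simp
qed

section \<open>The Artin monoid\<close>

quotient_type (overloaded) 's artin = "'s::coxeter list" / braid
  by (rule equivpI) (auto intro!: reflpI sympI transpI intro: braid_sym braid_trans)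

instantiation artin :: (coxeter) monoid_mult
begin

lift_definition one_artin :: "'a artin" is "[]" .

lift_definition times_artin :: "'a artin \<Rightarrow> 'a artin \<Rightarrow> 'a artin" is "(@)"
  by (rule braid_append)

instance by standard (transfer, simp)+

end

text \<open>The library's \<open>a dvd b\<close> is divisibility on the left.\<close>

instance artin :: (coxeter) Rings.dvd ..

lift_definition atom :: "'s::coxeter \<Rightarrow> 's artin" is "\<lambda>s. [s]" .

lift_definition len :: "'s::coxeter artin \<Rightarrow> nat" is length
  by (rule braid_length)

lift_definition supp :: "'s::coxeter artin \<Rightarrow> 's set" is set
  by (rule braid_set)

lift_definition flip :: "'s::coxeter artin \<Rightarrow> 's artin" is rev
  by (rule braid_rev)

lift_definition simple :: "'s::coxeter artin \<Rightarrow> bool" is legal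
  by (rule legal_braid)

definition el :: "'s::coxeter list \<Rightarrow> 's artin" where
  "el = abs_artin"

lemma el_simps [simp]: "el [] = 1" "el (s # w) = atom s * el w" "el (u @ v) = el u * el v"
  unfolding el_def by (transfer, simp)+

lemma el_surj: "\<exists>w. x = el w"
  unfolding el_def by (metis Quotient3_abs_rep Quotient3_artin)

lemma el_eq_iff: "el u = el v \<longleftrightarrow> braid u v"
  unfolding el_def by (rule artin.abs_eq_iff)

lemma len_simps [simp]: "len 1 = 0" "len (x * y) = len x + len y" "len (atom s) = 1" "len (el w) = length w"
  unfolding el_def by (transfer, simp)+

lemma supp_simps [simp]: "supp 1 = {}" "supp (x * y) = supp x \<union> supp y" "supp (atom s) = {s}"
  "supp (el w) = set w"
  unfolding el_def by (transfer, simp)+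

lemma finite_supp [simp]: "finite (supp x)"
  by transfer simp

lemma flip_simps [simp]: "flip 1 = 1" "flip (x * y) = flip y * flip x" "flip (atom s) = atom s"
  "flip (flip x) = x" "flip (el w) = el (rev w)" "len (flip x) = len x" "supp (flip x) = supp x"
  unfolding el_def by (transfer, simp)+

lemma simple_el: "simple (el w) = legal w"
  unfolding el_def by transfer simp

lemma simple_flip [simp]: "simple (flip x) = simple x"
  by transfer (metis legal_rev rev_rev_ident)

lemma atom_cases:
  obtains "x = 1" | s y where "x = atom s * y"
  by (metis el_surj el_simps(1,2) neq_Nil_conv)

lemma atom_induct [case_names one atom]:
  assumes "P 1" "\<And>s x. P x \<Longrightarrow> P (atom s * x)"
  shows "P x"
proof -
  have "P (el w)" for w by (induction w) (auto intro: assms)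
  then show ?thesis using el_surj by metis
qed

lemma atom_mult_neq_one [simp]: "atom s * x \<noteq> 1"
  by (metis len_simps(1-3) add_is_0 one_neq_zero)

lemma len_0_iff [simp]: "len x = 0 \<longleftrightarrow> x = 1"
  by (cases x rule: atom_cases) auto

lemma atom_neq_one [simp]: "atom s \<noteq> 1"
  by (metis len_simps(1,3) zero_neq_one)

lemma mult_eq_one [simp]: "x * y = 1 \<longleftrightarrow> x = 1 \<and> y = (1 :: 's::coxeter artin)"
  by (metis len_0_iff len_simps(2) add_is_0 mult_1)

lemma len_1_atom: "len x = 1 \<Longrightarrow> \<exists>s. x = atom s"
  by (cases x rule: atom_cases) auto

lemma atom_eq_iff [simp]: "atom s = atom t \<longleftrightarrow> s = t"
  by (metis supp_simps(3) singleton_inject)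

lemma dvd_left_refl [simp]: "(x :: 's::coxeter artin) dvd x"
  by (rule dvdI[of _ _ 1]) simp

lemma one_dvd_left [simp]: "(1 :: 's::coxeter artin) dvd x"
  by (rule dvdI[of _ _ x]) simp

lemma dvd_left_trans [trans]: "x dvd y \<Longrightarrow> y dvd z \<Longrightarrow> x dvd (z :: 's::coxeter artin)"
  by (auto simp: dvd_def mult.assoc)

lemma dvd_left_mult [simp]: "x dvd x * (y :: 's::coxeter artin)"
  by (rule dvdI) simp

lemma dvd_left_mult2: "x dvd y \<Longrightarrow> x dvd y * (z :: 's::coxeter artin)"
  by (auto simp: dvd_def mult.assoc)

lemma dvd_left_mono: "x dvd y \<Longrightarrow> z * x dvd z * (y :: 's::coxeter artin)"
  by (auto simp: dvd_def mult.assoc)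

lemma dvd_left_multD: "x * y dvd z \<Longrightarrow> x dvd (z :: 's::coxeter artin)"
  by (auto simp: dvd_def mult.assoc)

lemma dvd_left_antisym: "x dvd y \<Longrightarrow> y dvd x \<Longrightarrow> x = (y :: 's::coxeter artin)"
proof -
  assume "x dvd y" "y dvd x"
  then obtain a b where a: "y = x * a" and b: "x = y * b" by (auto simp: dvd_def)
  have "len y = len x + len a" "len x = len y + len b"
    using arg_cong[OF a, of len] arg_cong[OF b, of len] by simp_all
  then have "len a = 0" by linarith
  then show "x = y" using a by simp
qed

lemma dvd_len: "x dvd y \<Longrightarrow> len x \<le> len (y :: 's::coxeter artin)"
  by (auto simp: dvd_def)

lemma dvd_supp: "x dvd y \<Longrightarrow> supp x \<subseteq> supp (y :: 's::coxeter artin)"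
  by (auto simp: dvd_def)

lemma atom_dvd_supp: "atom s dvd y \<Longrightarrow> s \<in> supp y"
  using dvd_supp by fastforce

fun altp :: "nat \<Rightarrow> 'm::monoid_mult \<Rightarrow> 'm \<Rightarrow> 'm" where
  "altp 0 x y = 1"
| "altp (Suc n) x y = x * altp n y x"

lemma el_alternating: "el (alternating n s t) = altp n (atom s) (atom t)"
  by (induction n arbitrary: s t) auto

lemma altp_add: "altp (k + l) x y = altp k x y * altp l (nxt k x y) (nxt k y x)"
  by (induction k arbitrary: x y) (auto simp: nxt_def mult.assoc)

lemma braid_relation:
  "s \<noteq> t \<Longrightarrow> cm s t = enat n \<Longrightarrow> altp n (atom s) (atom t) = altp n (atom t) (atom s)"
  using braid_swap[of s t n "[]" "[]"] unfolding el_eq_iff[symmetric] by (simp add: el_alternating)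

lemma len_altp [simp]: "len (altp n (atom s) (atom t)) = n"
  by (metis el_alternating len_simps(4) length_alternating)

lemma supp_altp: "supp (altp n x y) \<subseteq> supp x \<union> supp y"
  by (induction n arbitrary: x y) auto

subsection \<open>Simple elements\<close>

lemma simple_one [simp]: "simple 1"
  using simple_el[of "[]"] by simp

lemma simple_multD2: "simple (x * y) \<Longrightarrow> simple y"
  by transfer (rule legal_appendD)

lemma simple_multD1: "simple (x * y) \<Longrightarrow> simple x"
  by (metis flip_simps(2) simple_flip simple_multD2)

lemma simple_dvd: "x dvd y \<Longrightarrow> simple y \<Longrightarrow> simple x"
  by (auto simp: dvd_def dest: simple_multD1)

lemma not_simple_square: "\<not> simple (atom s * (atom s * y))"
proof -
  obtain w where "y = el w" using el_surj by blast
  then have "atom s * (atom s * y) = el (s # s # w)" by simp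
  then show ?thesis unfolding \<open>_ = el (s # s # w)\<close> simple_el by (auto simp: fire_self)
qed

lemma simple_altp_mult:
  assumes "simple (atom s * y)" "simple (atom t * y)" "s \<noteq> t" "enat k \<le> cm s t"
  shows "simple (altp k (atom s) (atom t) * y)"
proof -
  obtain w where w: "y = el w" using el_surj by blast
  have "legal (s # w)" "legal (t # w)"
    using assms(1,2) simple_el[of "s # w"] simple_el[of "t # w"] by (simp_all add: w)
  then have "legal (altend k (nxt k t s) (nxt k s t) @ w)"
    using assms(3,4) by (intro legal_altend) (auto simp: nxt_def cm_sym)
  then have "simple (el (alternating k s t @ w))" unfolding simple_el alternating_altend .
  then show ?thesis by (simp add: w el_alternating)
qed

lemma simple_mult_altp:
  assumes "simple (y * atom s)" "simple (y * atom t)" "s \<noteq> t" "enat k \<le> cm s t"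
  shows "simple (y * altp k (atom s) (atom t))"
proof -
  have fl: "simple (atom s * flip y)" "simple (atom t * flip y)"
    using assms(1,2) simple_flip[of "y * atom s"] simple_flip[of "y * atom t"] by simp_all
  have "simple (altp k (atom (nxt k t s)) (atom (nxt k s t)) * flip y)"
    using fl assms by (intro simple_altp_mult) (auto simp: nxt_def cm_sym)
  moreover have "flip (altp k (atom s) (atom t)) = altp k (atom (nxt k t s)) (atom (nxt k s t))"
    by (simp add: rev_alternating altend_alternating flip: el_alternating)
  ultimately show ?thesis
    using simple_flip[of "y * altp k (atom s) (atom t)"] by simp
qed

lemma simple_two_descents:
  assumes "simple (atom s * y)" "atom s * y = atom t * z" "s \<noteq> t"
  shows "\<exists>n w. cm s t = enat n \<and> atom s * y = altp n (atom s) (atom t) * w"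
proof -
  obtain u v where u: "y = el u" and v: "z = el v" using el_surj by metis
  have br: "braid (t # v) (s # u)" unfolding el_eq_iff[symmetric] using assms(2) by (simp add: u v)
  have leg: "legal (s # u)" unfolding simple_el[symmetric] using assms(1) by (simp add: u)
  then have tv: "legal (t # v)" using legal_braid[OF br] by blast
  have "pos (t # v) s < 0" using play_braid[OF br, of "\<lambda>_. 1"] leg by (simp add: fire_self)
  then obtain n h where "cm s t = enat n" "braid (t # v) (alternating n s t @ h)"
    using legal_descent[OF tv, of s] assms(3) by blast
  then show ?thesis
    using assms(2) unfolding el_eq_iff[symmetric] by (auto simp: v el_alternating)
qed

lemma simple_cancel_atom:
  assumes "simple (atom s * y)" "atom s * y = atom s * z"
  shows "y = z"
proof -
  obtain u v where u: "y = el u" and v: "z = el v" using el_surj by metis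
  have br: "braid (s # u) (s # v)" unfolding el_eq_iff[symmetric] using assms(2) by (simp add: u v)
  have leg: "legal (s # u)" unfolding simple_el[symmetric] using assms(1) by (simp add: u)
  then have "legal u" "legal v" using legal_braid[OF br] by auto
  moreover have "pos u = pos v"
    using play_braid[OF br, of "\<lambda>_. 1"] play_cancel[of "[s]" "pos u" "pos v"] by simp
  ultimately show ?thesis using legal_pos_braid by (simp add: u v el_eq_iff)
qed

lemma simple_cancel: "simple (x * y) \<Longrightarrow> x * y = x * z \<Longrightarrow> y = z"
proof (induction x rule: atom_induct)
  case (atom s x)
  then show ?case
    using simple_cancel_atom[of s "x * y" "x * z"] simple_multD2[of "atom s" "x * y"]
    by (simp add: mult.assoc)
qed simp

subsection \<open>Cancellation\<close>

text \<open>
  Following Michel, every element has a largest simple left divisor. It is computed letter by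
  letter: if \<open>w\<close> is the largest simple divisor of \<open>b\<close>, that of \<open>x b\<close> is \<open>x g\<close> where \<open>g\<close> is the
  largest divisor of \<open>w\<close> for which \<open>x g\<close> is simple. As this computation recovers \<open>b\<close> from \<open>x b\<close>,
  the monoid is cancellative.
\<close>

definition ext_divs :: "'s::coxeter artin \<Rightarrow> 's artin \<Rightarrow> 's artin set" where
  "ext_divs x w = {v. v dvd w \<and> simple (x * v)}"

lemma ext_divs_dvd: "v \<in> ext_divs x w \<Longrightarrow> u dvd v \<Longrightarrow> u \<in> ext_divs x w"
  unfolding ext_divs_def using dvd_left_trans[of u v w] simple_dvd[OF dvd_left_mono[of u v x]] by auto

text \<open>The candidates are closed under left divisors, and two candidates \<open>z s\<close> and
  \<open>z t\<close> have an upper bound \<open>q\<close> among them, the dihedral element placed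
  behind \<open>z\<close>. By induction on the remaining length, \<open>q\<close> links the maximum
  above \<open>z t\<close> to the one above \<open>z s\<close>.\<close>

lemma ext_divs_greatest_above:
  assumes "simple w" "z \<in> ext_divs x w"
  shows "\<exists>g\<in>ext_divs x w. z dvd g \<and> (\<forall>v\<in>ext_divs x w. z dvd v \<longrightarrow> v dvd g)"
  using assms(2)
proof (induction "len w - len z" arbitrary: z rule: less_induct)
  case less
  let ?B = "ext_divs x w"
  have IH: "\<exists>g\<in>?B. z * atom s dvd g \<and> (\<forall>v\<in>?B. z * atom s dvd v \<longrightarrow> v dvd g)"
    if "z * atom s \<in> ?B" for s
    using that dvd_len[of "z * atom s" w] by (intro less.hyps) (auto simp: ext_divs_def)
  show ?case
  proof (cases "\<exists>s. z * atom s \<in> ?B")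
    case False
    have "v = z" if "v \<in> ?B" "z dvd v" for v
    proof -
      from that obtain u where u: "v = z * u" by (auto simp: dvd_def)
      show ?thesis
      proof (cases u rule: atom_cases)
        case (2 s y)
        then have "z * atom s dvd v" using u by (simp flip: mult.assoc)
        then show ?thesis using False ext_divs_dvd[OF that(1)] by blast
      qed (use u in simp)
    qed
    then show ?thesis using less.prems by (intro bexI[of _ z]) auto
  next
    case True
    then obtain s where s: "z * atom s \<in> ?B" by blast
    obtain g where g: "g \<in> ?B" "z * atom s dvd g" "\<And>v. v \<in> ?B \<Longrightarrow> z * atom s dvd v \<Longrightarrow> v dvd g"
      using IH[OF s] by blast
    have "v dvd g" if v: "v \<in> ?B" "z dvd v" for v
    proof -
      obtain u where u: "v = z * u" using v by (auto simp: dvd_def)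
      show ?thesis
      proof (cases u rule: atom_cases)
        case 1
        then show ?thesis using u g(2) dvd_left_multD by auto
      next
        case (2 t y)
        then have tv: "z * atom t dvd v" using u by (simp flip: mult.assoc)
        show ?thesis
        proof (cases "s = t")
          case True
          then show ?thesis using g(3)[OF v(1)] tv by simp
        next
          case False
          have t: "z * atom t \<in> ?B" using ext_divs_dvd[OF v(1) tv] .
          obtain g' where g': "g' \<in> ?B" "z * atom t dvd g'"
            "\<And>v. v \<in> ?B \<Longrightarrow> z * atom t dvd v \<Longrightarrow> v dvd g'"
            using IH[OF t] by blast
          from s obtain w1 where w1: "w = z * (atom s * w1)" by (auto simp: ext_divs_def dvd_def mult.assoc)
          from t obtain w2 where w2: "w = z * (atom t * w2)" by (auto simp: ext_divs_def dvd_def mult.assoc)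
          have e: "atom s * w1 = atom t * w2" using simple_cancel[of z] w1 w2 assms(1) by metis
          have "simple (atom s * w1)" using simple_multD2 assms(1) w1 by metis
          then obtain n w3 where n: "cm s t = enat n" "atom s * w1 = altp n (atom s) (atom t) * w3"
            using simple_two_descents[OF _ e False] by blast
          define q where "q = z * altp n (atom s) (atom t)"
          have "simple (x * z * altp n (atom s) (atom t))"
            using s t n(1) False by (intro simple_mult_altp) (auto simp: ext_divs_def mult.assoc)
          then have q: "q \<in> ?B"
            unfolding ext_divs_def q_def using w1 n(2) by (auto simp: mult.assoc intro: dvdI)
          obtain j where j: "n = Suc j" using cm_enat_ge2[OF False n(1)] by (cases n) auto
          have "z * atom s dvd q" by (simp add: q_def j flip: mult.assoc)
          moreover have "z * atom t dvd q"
            unfolding q_def braid_relation[OF False n(1)] by (simp add: j flip: mult.assoc)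
          ultimately have "z * atom t dvd g" "z * atom s dvd g'"
            using g(3)[OF q] g'(3)[OF q] dvd_left_trans by blast+
          then have "g' dvd g" using g(3)[OF g'(1)] by simp
          then show ?thesis using g'(3)[OF v(1) tv] dvd_left_trans by blast
        qed
      qed
    qed
    then show ?thesis using g(1) dvd_left_multD[OF g(2)] by blast
  qed
qed

definition ext_max :: "'s::coxeter artin \<Rightarrow> 's artin \<Rightarrow> 's artin" where
  "ext_max x w = (SOME g. g \<in> ext_divs x w \<and> (\<forall>v\<in>ext_divs x w. v dvd g))"

lemma ext_max:
  assumes "simple w" "simple x"
  shows "ext_max x w dvd w" "simple (x * ext_max x w)"
    and "\<And>v. v dvd w \<Longrightarrow> simple (x * v) \<Longrightarrow> v dvd ext_max x w"
proof -
  have "\<exists>g. g \<in> ext_divs x w \<and> (\<forall>v\<in>ext_divs x w. v dvd g)"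
    using ext_divs_greatest_above[OF assms(1), of 1 x] assms(2) by (auto simp: ext_divs_def)
  from someI_ex[OF this] show "ext_max x w dvd w" "simple (x * ext_max x w)"
    "\<And>v. v dvd w \<Longrightarrow> simple (x * v) \<Longrightarrow> v dvd ext_max x w"
    by (auto simp: ext_divs_def ext_max_def)
qed

definition lquot :: "'s::coxeter artin \<Rightarrow> 's artin \<Rightarrow> 's artin" where
  "lquot g w = (SOME r. w = g * r)"

lemma mult_lquot: "g dvd w \<Longrightarrow> g * lquot g w = w"
  unfolding lquot_def dvd_def by (metis (mono_tags, lifting) someI_ex)

definition absorb :: "'s::coxeter artin \<Rightarrow> 's artin \<times> 's artin \<Rightarrow> 's artin \<times> 's artin" where
  "absorb x p = (x * ext_max x (fst p), lquot (ext_max x (fst p)) (fst p) * snd p)"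

text \<open>This makes \<open>head_split\<close> independent of the word: the two sides of a braid
  relation are the same simple element and may be absorbed at once. The argument cancels only inside
  simple elements, as general cancellation is derived from it.\<close>

lemma absorb_mult:
  assumes "simple (fst p)" "simple (x * y)"
  shows "absorb (x * y) p = absorb x (absorb y p)"
proof -
  obtain w b where p: "p = (w, b)" by force
  have w: "simple w" using assms p by simp
  have x: "simple x" and y: "simple y" using assms simple_multD1 simple_multD2 by auto
  define g where "g = ext_max y w"
  define h where "h = ext_max (x * y) w"
  have g: "g dvd w" "simple (y * g)" "\<And>v. v dvd w \<Longrightarrow> simple (y * v) \<Longrightarrow> v dvd g"
    unfolding g_def using ext_max[OF w y] by auto
  have h: "h dvd w" "simple (x * y * h)" "\<And>v. v dvd w \<Longrightarrow> simple (x * y * v) \<Longrightarrow> v dvd h"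
    unfolding h_def using ext_max[OF w assms(2)] by auto
  define v where "v = ext_max x (y * g)"
  have v: "v dvd y * g" "simple (x * v)" "\<And>u. u dvd y * g \<Longrightarrow> simple (x * u) \<Longrightarrow> u dvd v"
    unfolding v_def using ext_max[OF g(2) x] by auto
  have "h dvd g" using g(3)[OF h(1)] h(2) simple_multD2[of x "y * h"] by (simp add: mult.assoc)
  then have "y * h dvd v" using h(2) by (intro v(3) dvd_left_mono) (simp_all add: mult.assoc)
  then obtain k where k: "v = y * h * k" by (auto simp: dvd_def)
  obtain r3 where r3: "y * g = v * r3" using v(1) by (auto simp: dvd_def)
  have g': "g = h * k * r3" using simple_cancel[of y g "h * k * r3"] g(2) r3 k by (simp add: mult.assoc)
  have "h * k dvd h"
  proof (rule h(3))
    show "h * k dvd w" using g' g(1) dvd_left_multD by blast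
    show "simple (x * y * (h * k))" using v(2) k by (simp add: mult.assoc)
  qed
  then have "k = 1" using dvd_len[of "h * k" h] by simp
  then have vh: "v = y * h" and gh: "g = h * r3" using k g' by auto
  have "y * h * lquot v (y * g) = y * h * r3" using mult_lquot[OF v(1)] r3 by (simp add: vh)
  then have r3': "lquot v (y * g) = r3"
    using simple_cancel[of v "lquot v (y * g)" r3] mult_lquot[OF v(1)] g(2) r3 by simp
  have "h * lquot h w = h * (r3 * lquot g w)"
    using mult_lquot[OF h(1)] mult_lquot[OF g(1)] gh by (simp add: mult.assoc)
  then have "lquot h w = r3 * lquot g w" using simple_cancel[of h] mult_lquot[OF h(1)] w by metis
  then show ?thesis
    using r3' by (simp add: absorb_def p mult.assoc vh flip: g_def h_def v_def)
qed

lemma absorb_one: "simple (fst p) \<Longrightarrow> absorb 1 p = p"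
proof -
  assume p: "simple (fst p)"
  then have "ext_max 1 (fst p) = fst p"
    using ext_max[OF p simple_one] by (intro dvd_left_antisym) auto
  moreover have "lquot (fst p) (fst p) = 1"
    using mult_lquot[of "fst p" "fst p"] by (metis dvd_left_refl len_0_iff len_simps(2) add_cancel_right_right)
  ultimately show ?thesis by (simp add: absorb_def)
qed

lemma simple_atom [simp]: "simple (atom s)"
  using simple_el[of "[s]"] by simp

fun head_split :: "'s::coxeter list \<Rightarrow> 's artin \<times> 's artin" where
  "head_split [] = (1, 1)"
| "head_split (s # w) = absorb (atom s) (head_split w)"

lemma simple_head_split: "simple (fst (head_split w))"
  by (induction w) (auto simp: absorb_def intro: ext_max)

lemma head_split_mult: "fst (head_split w) * snd (head_split w) = el w"
proof (induction w)
  case (Cons s w)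
  have "ext_max (atom s) (fst (head_split w)) dvd fst (head_split w)"
    by (rule ext_max[OF simple_head_split]) simp
  then show ?case using Cons
    by (simp add: absorb_def mult.assoc) (metis mult.assoc mult_lquot)
qed simp

lemma head_split_append:
  "simple (el u) \<Longrightarrow> head_split (u @ v) = absorb (el u) (head_split v)"
proof (induction u)
  case (Cons s u)
  then show ?case using simple_multD2[of "atom s" "el u"] absorb_mult[OF simple_head_split, of "atom s" "el u" v]
    by simp
qed (simp add: absorb_one simple_head_split)

lemma simple_altp: "s \<noteq> t \<Longrightarrow> enat k \<le> cm s t \<Longrightarrow> simple (altp k (atom s) (atom t))"
  using simple_altp_mult[of s 1 t k] by simp

lemma head_split_braid: "braid u v \<Longrightarrow> head_split u = head_split v"
proof (induction rule: braid.induct)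
  case (braid_swap s t n u v)
  have "head_split (alternating n s t @ v) = head_split (alternating n t s @ v)"
    using braid_swap simple_altp[of s t n] simple_altp[of t s n]
    by (simp add: head_split_append el_alternating braid_relation cm_sym)
  then show ?case by (induction u) auto
qed auto

text \<open>Words for both sides have the same \<open>head_split\<close>, so their simple heads
  coincide and the remainders are equal. This moves the question to simple elements, where
  \<open>simple_cancel\<close> and \<open>simple_two_descents\<close> answer it.\<close>

lemma artin_reduction:
  assumes "atom s * x = atom t * y"
  shows "s = t \<and> x = y \<or> s \<noteq> t \<and> (\<exists>n z. cm s t = enat n \<and> atom s * x = altp n (atom s) (atom t) * z)"
proof -
  obtain u v where u: "x = el u" and v: "y = el v" using el_surj by metis
  let ?g = "ext_max (atom s) (fst (head_split u))" and ?h = "ext_max (atom t) (fst (head_split v))"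
  have "head_split (s # u) = head_split (t # v)"
    using assms by (intro head_split_braid) (simp only: el_eq_iff[symmetric] el_simps u v)
  then have e: "atom s * ?g = atom t * ?h"
    "lquot ?g (fst (head_split u)) * snd (head_split u) = lquot ?h (fst (head_split v)) * snd (head_split v)"
    by (auto simp: absorb_def)
  have g: "?g dvd fst (head_split u)" "simple (atom s * ?g)" "?h dvd fst (head_split v)"
    by (auto intro: ext_max simple_head_split)
  have x: "x = ?g * (lquot ?g (fst (head_split u)) * snd (head_split u))"
    using mult_lquot[OF g(1)] head_split_mult[of u] by (simp add: u flip: mult.assoc)
  have y: "y = ?h * (lquot ?h (fst (head_split v)) * snd (head_split v))"
    using mult_lquot[OF g(3)] head_split_mult[of v] by (simp add: v flip: mult.assoc)
  show ?thesis
  proof (cases "s = t")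
    case True
    then have "?g = ?h" using simple_cancel[of "atom s" ?g ?h] e(1) g(2) by simp
    then show ?thesis using x y e(2) True by simp
  next
    case False
    then obtain n z where n: "cm s t = enat n" "atom s * ?g = altp n (atom s) (atom t) * z"
      using simple_two_descents[OF g(2) e(1)] by blast
    have "atom s * x = altp n (atom s) (atom t) * z * (lquot ?g (fst (head_split u)) * snd (head_split u))"
      by (subst x) (simp add: n(2) flip: mult.assoc)
    then show ?thesis using n False by (auto simp: mult.assoc)
  qed
qed

lemma artin_left_cancel [simp]: "x * y = x * z \<longleftrightarrow> y = (z :: 's::coxeter artin)"
proof
  show "x * y = x * z \<Longrightarrow> y = z"
    by (induction x rule: atom_induct) (use artin_reduction in \<open>auto simp: mult.assoc\<close>)
qed simp

lemma artin_right_cancel [simp]: "y * x = z * x \<longleftrightarrow> y = (z :: 's::coxeter artin)"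
  by (metis artin_left_cancel flip_simps(2,4))

lemma dvd_left_cancel [simp]: "x * y dvd x * z \<longleftrightarrow> y dvd (z :: 's::coxeter artin)"
  by (auto simp: dvd_def mult.assoc)

lemma atoms_dvd:
  assumes "atom s dvd z" "atom t dvd z" "s \<noteq> t"
  obtains n where "cm s t = enat n" "altp n (atom s) (atom t) dvd z"
proof -
  obtain x y where x: "z = atom s * x" and y: "z = atom t * y"
    using assms(1,2) unfolding dvd_def by blast
  then show thesis using artin_reduction[of s x t y] assms(3) that by auto
qed

text \<open>The head computed by \<open>head_split\<close> is such a divisor: a letter dividing
  \<open>z\<close> can be put first in a word for \<open>z\<close> and is then part of the head.
  This is what makes Garside elements simple.\<close>

lemma simple_bound:
  "\<exists>d. simple d \<and> d dvd z \<and> (\<forall>s. atom s dvd z \<longrightarrow> atom s dvd d)"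
proof -
  obtain w where w: "z = el w" using el_surj by blast
  let ?d = "fst (head_split w)"
  have "atom s dvd ?d" if s: "atom s dvd z" for s
  proof -
    obtain y where "z = atom s * y" using s by (auto simp: dvd_def)
    then obtain v where "z = el (s # v)" using el_surj[of y] by auto
    then have "head_split w = head_split (s # v)" using w by (intro head_split_braid) (simp only: el_eq_iff)
    then show ?thesis by (simp add: absorb_def)
  qed
  then show ?thesis using simple_head_split head_split_mult w by (metis dvdI)
qed

subsection \<open>Least common multiples\<close>

definition is_join :: "'s::coxeter artin \<Rightarrow> 's artin \<Rightarrow> 's artin \<Rightarrow> bool" where
  "is_join x y l \<longleftrightarrow> x dvd l \<and> y dvd l \<and> (\<forall>z. x dvd z \<longrightarrow> y dvd z \<longrightarrow> l dvd z)"

definition compat :: "'s::coxeter artin \<Rightarrow> 's artin \<Rightarrow> bool" where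
  "compat x y \<longleftrightarrow> (\<exists>z. x dvd z \<and> y dvd z)"

lemma compatI: "x dvd z \<Longrightarrow> y dvd z \<Longrightarrow> compat x y"
  by (auto simp: compat_def)

lemma compat_sym: "compat x y \<Longrightarrow> compat y x"
  by (auto simp: compat_def)

lemma is_joinD: "is_join x y l \<Longrightarrow> x dvd l" "is_join x y l \<Longrightarrow> y dvd l"
  "is_join x y l \<Longrightarrow> x dvd z \<Longrightarrow> y dvd z \<Longrightarrow> l dvd z"
  by (auto simp: is_join_def)

lemma is_join_mult: "is_join x y l \<Longrightarrow> is_join (z * x) (z * y) (z * l)"
proof -
  assume l: "is_join x y l"
  have "z * l dvd u" if u: "z * x dvd u" "z * y dvd u" for u
  proof -
    obtain v where v: "u = z * v" using dvd_left_multD[OF u(1)] by (auto simp: dvd_def)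
    show ?thesis using u l by (auto simp: v is_join_def)
  qed
  then show ?thesis using l by (auto simp: is_join_def)
qed

lemma is_join_atoms:
  assumes "s \<noteq> t" "cm s t = enat n"
  shows "is_join (atom s) (atom t) (altp n (atom s) (atom t))"
proof -
  obtain j where j: "n = Suc j" using cm_enat_ge2[OF assms] by (cases n) auto
  have "atom s dvd altp n (atom s) (atom t)" by (simp add: j)
  moreover have "atom t dvd altp n (atom s) (atom t)"
    unfolding braid_relation[OF assms] by (simp add: j)
  moreover have "altp n (atom s) (atom t) dvd z" if "atom s dvd z" "atom t dvd z" for z
    using atoms_dvd[OF that assms(1)] assms(2) by auto
  ultimately show ?thesis by (auto simp: is_join_def)
qed

text \<open>Induction on the length of the common multiple: with x = s x1 and y = t y1, join
  \<open>x\<close> and \<open>y\<close> separately with the dihedral element \<open>D\<close> of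
  \<open>s\<close> and \<open>t\<close>, then join the two results behind \<open>D\<close>. The
  support bound keeps later constructions inside a given set of letters.\<close>

lemma join_exists:
  assumes "x dvd z" "y dvd z"
  shows "\<exists>l. is_join x y l \<and> supp l \<subseteq> supp x \<union> supp y"
  using assms
proof (induction "len z" arbitrary: x y z rule: less_induct)
  case less
  show ?case
  proof (cases x rule: atom_cases)
    case 1
    then show ?thesis by (intro exI[of _ y]) (auto simp: is_join_def)
  next
    case x: (2 s x1)
    show ?thesis
    proof (cases y rule: atom_cases)
      case 1
      then show ?thesis by (intro exI[of _ x]) (auto simp: is_join_def)
    next
      case y: (2 t y1)
      obtain z1 where z1: "z = atom s * z1" "x1 dvd z1"
        using less.prems(1) x by (auto simp: dvd_def mult.assoc)
      obtain z2 where z2: "z = atom t * z2" "y1 dvd z2"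
        using less.prems(2) y by (auto simp: dvd_def mult.assoc)
      have len: "len z1 < len z" "len z2 < len z"
        using arg_cong[OF z1(1), of len] arg_cong[OF z2(1), of len] by auto
      show ?thesis
      proof (cases "s = t")
        case True
        then have "y1 dvd z1" using z1 z2 by auto
        then obtain l where "is_join x1 y1 l" "supp l \<subseteq> supp x1 \<union> supp y1"
          using less.hyps[OF len(1) z1(2)] by blast
        then show ?thesis using is_join_mult[of x1 y1 l "atom s"] x y True
          by (intro exI[of _ "atom s * l"]) auto
      next
        case False
        have "atom s dvd z" unfolding z1(1) by simp
        moreover have "atom t dvd z" unfolding z2(1) by simp
        ultimately obtain n where n: "cm s t = enat n" "altp n (atom s) (atom t) dvd z"
          using atoms_dvd[OF _ _ False] by blast
        define D where "D = altp n (atom s) (atom t)"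
        have D: "is_join (atom s) (atom t) D" unfolding D_def by (rule is_join_atoms[OF False n(1)])
        have suppD: "supp D \<subseteq> {s, t}" unfolding D_def using supp_altp[of n "atom s" "atom t"] by auto
        obtain a b d where a: "D = atom s * a" and b: "D = atom t * b" and d: "z = D * d"
          using is_joinD(1,2)[OF D] n(2) unfolding dvd_def D_def by blast
        have "z1 = a * d" using z1(1) d unfolding a mult.assoc by simp
        then have "a dvd z1" by simp
        have "z2 = b * d" using z2(1) d unfolding b mult.assoc by simp
        then have "b dvd z2" by simp
        obtain l1 where l1: "is_join x1 a l1" "supp l1 \<subseteq> supp x1 \<union> supp a"
          using less.hyps[OF len(1) z1(2) \<open>a dvd z1\<close>] by blast
        obtain l2 where l2: "is_join y1 b l2" "supp l2 \<subseteq> supp y1 \<union> supp b"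
          using less.hyps[OF len(2) z2(2) \<open>b dvd z2\<close>] by blast
        have j1: "is_join x D (atom s * l1)" and j2: "is_join y D (atom t * l2)"
          using is_join_mult[OF l1(1), of "atom s"] is_join_mult[OF l2(1), of "atom t"] x y a b by auto
        obtain e f where e: "atom s * l1 = D * e" and f: "atom t * l2 = D * f"
          using is_joinD(2)[OF j1] is_joinD(2)[OF j2] by (auto simp: dvd_def)
        have "e dvd d" "f dvd d"
          using is_joinD(3)[OF j1 less.prems(1)] is_joinD(3)[OF j2 less.prems(2)] by (auto simp: d e f)
        moreover have "len d < len z" using arg_cong[OF d, of len] arg_cong[OF a, of len] by simp
        ultimately obtain g where g: "is_join e f g" "supp g \<subseteq> supp e \<union> supp f"
          using less.hyps by blast
        have Dg: "is_join (D * e) (D * f) (D * g)" by (rule is_join_mult[OF g(1)])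
        have "is_join x y (D * g)"
          unfolding is_join_def
        proof (intro conjI allI impI)
          show "x dvd D * g" "y dvd D * g"
            using dvd_left_trans[OF is_joinD(1)[OF j1]] dvd_left_trans[OF is_joinD(1)[OF j2]]
              is_joinD(1,2)[OF Dg] e f by auto
          fix u assume u: "x dvd u" "y dvd u"
          then have "D dvd u" using x y is_joinD(3)[OF D] dvd_left_multD by metis
          then show "D * g dvd u"
            using is_joinD(3)[OF Dg] is_joinD(3)[OF j1 u(1)] is_joinD(3)[OF j2 u(2)] e f by simp
        qed
        moreover have "supp (D * g) \<subseteq> supp x \<union> supp y"
        proof -
          have "supp e \<subseteq> {s} \<union> supp l1" "supp f \<subseteq> {t} \<union> supp l2"
            using arg_cong[OF e, of supp] arg_cong[OF f, of supp] by simp_all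
          moreover have "supp a \<subseteq> {s, t}" "supp b \<subseteq> {s, t}"
            using suppD arg_cong[OF a, of supp] suppD[unfolded b] by simp_all
          moreover have "{s, t} \<subseteq> supp x \<union> supp y" "supp x1 \<subseteq> supp x" "supp y1 \<subseteq> supp y"
            using x y by auto
          ultimately have *: "supp l1 \<subseteq> supp x \<union> supp y" "supp l2 \<subseteq> supp x \<union> supp y"
              "{s, t} \<subseteq> supp x \<union> supp y"
            using l1(2) l2(2) by auto
          have "supp e \<subseteq> supp x \<union> supp y" "supp f \<subseteq> supp x \<union> supp y"
            using *(1,3) \<open>supp e \<subseteq> _\<close> *(2) \<open>supp f \<subseteq> _\<close> by auto
          then show ?thesis using g(2) suppD *(3) by auto
        qed
        ultimately show ?thesis by blast
      qed
    qed
  qed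
qed

lemma compat_join:
  assumes "compat x y"
  obtains a b where "is_join x y (x * a)" "x * a = y * b" "supp (x * a) \<subseteq> supp x \<union> supp y"
proof -
  obtain l where l: "is_join x y l" "supp l \<subseteq> supp x \<union> supp y"
    using assms join_exists unfolding compat_def by blast
  obtain a where a: "l = x * a" using is_joinD(1)[OF l(1)] unfolding dvd_def ..
  obtain b where b: "l = y * b" using is_joinD(2)[OF l(1)] unfolding dvd_def ..
  show thesis by (rule that[of a b, OF l(1)[unfolded a] _ l(2)[unfolded a]]) (use a b in metis)
qed

text \<open>Here \<open>a\<close> is the complement of \<open>y\<close> after \<open>x\<close>. This
  lemma and \<open>dvd_mult_iff\<close> strip the factor \<open>x\<close> from a question about
  \<open>y\<close>, at the price of replacing \<open>y\<close> by \<open>a\<close>; the inductions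
  on left factors rely on them.\<close>

lemma compat_mult_iff:
  assumes "is_join x y (x * a)"
  shows "compat y (x * z) \<longleftrightarrow> compat a z"
proof
  assume "compat y (x * z)"
  then obtain u where u: "y dvd u" "x * z dvd u" by (auto simp: compat_def)
  then have "x * a dvd u" using is_joinD(3)[OF assms dvd_left_multD[OF u(2)] u(1)] by simp
  then show "compat a z" using u(2) by (auto simp: dvd_def mult.assoc compat_def) (metis)
next
  assume "compat a z"
  then obtain u where "a dvd u" "z dvd u" by (auto simp: compat_def)
  then show "compat y (x * z)"
    using dvd_left_trans[OF is_joinD(2)[OF assms], of "x * u"] by (intro compatI[of _ "x * u"]) auto
qed

lemma dvd_mult_iff:
  assumes "is_join x y (x * a)"
  shows "y dvd x * z \<longleftrightarrow> a dvd z"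
proof
  assume y: "y dvd x * z"
  have "x * a dvd x * z" by (rule is_joinD(3)[OF assms dvd_left_mult y])
  then show "a dvd z" by simp
next
  assume "a dvd z"
  then show "y dvd x * z" using dvd_left_trans[OF is_joinD(2)[OF assms], of "x * z"] by simp
qed

subsection \<open>Garside elements\<close>

definition bounded :: "'s::coxeter set \<Rightarrow> bool" where
  "bounded I \<longleftrightarrow> finite I \<and> (\<exists>z. \<forall>s\<in>I. atom s dvd z)"

definition garside :: "'s::coxeter set \<Rightarrow> 's artin" where
  "garside I = (THE d. (\<forall>s\<in>I. atom s dvd d) \<and> (\<forall>z. (\<forall>s\<in>I. atom s dvd z) \<longrightarrow> d dvd z))"

lemma garside_exists:
  assumes "finite I" "\<forall>s\<in>I. atom s dvd z"
  shows "\<exists>d. supp d \<subseteq> I \<and> (\<forall>s\<in>I. atom s dvd d) \<and> (\<forall>z. (\<forall>s\<in>I. atom s dvd z) \<longrightarrow> d dvd z)"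
  using assms
proof (induction I rule: finite_induct)
  case empty
  show ?case by (intro exI[of _ 1]) auto
next
  case (insert s I)
  then obtain d where d: "supp d \<subseteq> I" "\<forall>s\<in>I. atom s dvd d" "\<And>z. (\<forall>s\<in>I. atom s dvd z) \<Longrightarrow> d dvd z"
    by auto
  have "d dvd z" "atom s dvd z" using d(3) insert.prems by auto
  then obtain l where l: "is_join (atom s) d l" "supp l \<subseteq> supp (atom s) \<union> supp d"
    using join_exists by blast
  have "l dvd z" if "\<forall>s\<in>insert s I. atom s dvd z" for z
    using that d(3) by (intro is_joinD(3)[OF l(1)]) auto
  moreover have "\<forall>t\<in>insert s I. atom t dvd l"
    using is_joinD(1,2)[OF l(1)] d(2) dvd_left_trans by blast
  ultimately show ?case using l(2) d(1) by (intro exI[of _ l]) auto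
qed

lemma garside_unique:
  assumes "\<forall>s\<in>I. atom s dvd d" "\<And>z. (\<forall>s\<in>I. atom s dvd z) \<Longrightarrow> d dvd z"
  shows "garside I = d"
  unfolding garside_def
  by (rule the_equality) (use assms in \<open>auto intro: dvd_left_antisym\<close>)

lemma garside:
  assumes "bounded I"
  shows atom_dvd_garside: "s \<in> I \<Longrightarrow> atom s dvd garside I"
    and garside_dvd: "(\<And>s. s \<in> I \<Longrightarrow> atom s dvd z) \<Longrightarrow> garside I dvd z"
    and supp_garside: "supp (garside I) = I"
    and simple_garside: "simple (garside I)"
proof -
  obtain b where b: "finite I" "\<forall>s\<in>I. atom s dvd b" using assms by (auto simp: bounded_def)
  obtain d where d: "supp d \<subseteq> I" "\<forall>s\<in>I. atom s dvd d" "\<And>z. (\<forall>s\<in>I. atom s dvd z) \<Longrightarrow> d dvd z"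
    using garside_exists[OF b] by auto
  have e: "garside I = d" using d by (intro garside_unique) auto
  show "s \<in> I \<Longrightarrow> atom s dvd garside I" "(\<And>s. s \<in> I \<Longrightarrow> atom s dvd z) \<Longrightarrow> garside I dvd z"
    using d by (auto simp: e)
  show "supp (garside I) = I" using d(1) atom_dvd_supp[OF bspec[OF d(2)]] by (auto simp: e)
  obtain c where c: "simple c" "\<And>s. atom s dvd d \<Longrightarrow> atom s dvd c"
    using simple_bound by blast
  then have "d dvd c" using d(2,3) by blast
  then show "simple (garside I)" using c(1) simple_dvd by (simp add: e)
qed

text \<open>For a letter \<open>b\<close> other than \<open>s\<close>, the dihedral element of
  \<open>b\<close> and \<open>s\<close> divides \<open>garside I\<close>, and its prefix of length n
  - 1 starting with \<open>b\<close> gives it back when multiplied by \<open>s\<close> on the left;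
  so \<open>b\<close> divides \<open>atom s * garside I\<close>. The length leaves a single letter
  as cofactor.\<close>

lemma atom_mult_garside:
  assumes I: "bounded I" and s: "s \<in> I"
  shows "\<exists>t\<in>I. atom s * garside I = garside I * atom t"
proof -
  have "atom b dvd atom s * garside I" if b: "b \<in> I" for b
  proof (cases "b = s")
    case False
    have "atom b dvd garside I" "atom s dvd garside I" using garside(1)[OF I] b s by auto
    then obtain n where n: "cm b s = enat n" "altp n (atom b) (atom s) dvd garside I"
      using atoms_dvd[OF _ _ False] by blast
    obtain j where j: "n = Suc j" using cm_enat_ge2[OF False n(1)] by (cases n) auto
    have "altp j (atom b) (atom s) dvd altp n (atom b) (atom s)"
      using altp_add[of j 1 "atom b" "atom s"] by (simp add: j)
    then have "atom s * altp j (atom b) (atom s) dvd atom s * garside I"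
      using n(2) dvd_left_trans by auto
    moreover have "atom s * altp j (atom b) (atom s) = altp n (atom b) (atom s)"
      unfolding braid_relation[OF False n(1)] by (simp add: j)
    moreover have "atom b dvd altp n (atom b) (atom s)" by (simp add: j)
    ultimately show ?thesis using dvd_left_trans by metis
  qed simp
  then have "garside I dvd atom s * garside I" by (rule garside(2)[OF I])
  then obtain c where c: "atom s * garside I = garside I * c" by (auto simp: dvd_def)
  have "len c = 1" using arg_cong[OF c, of len] by simp
  then obtain t where t: "c = atom t" using len_1_atom by blast
  have "t \<in> I" using arg_cong[OF c, of supp] garside(3)[OF I] s by (auto simp: t)
  then show ?thesis using c t by blast
qed

text \<open>Moving letters across \<open>garside I\<close> induces an injective map of the finite
  set \<open>I\<close> to itself, hence a surjective one.\<close>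

lemma garside_ends:
  assumes I: "bounded I" and t: "t \<in> I"
  shows "\<exists>a. garside I = a * atom t"
proof -
  obtain f where f: "\<And>s. s \<in> I \<Longrightarrow> f s \<in> I" "\<And>s. s \<in> I \<Longrightarrow> atom s * garside I = garside I * atom (f s)"
    using atom_mult_garside[OF I] by metis
  have "inj_on f I" by (rule inj_onI) (metis artin_right_cancel atom_eq_iff f(2))
  then have "f ` I = I" using f(1) I by (intro endo_inj_surj) (auto simp: bounded_def)
  then have "t \<in> f ` I" using t by simp
  then obtain s where s: "s \<in> I" "f s = t" by auto
  obtain a where a: "garside I = atom s * a" using garside(1)[OF I s(1)] by (auto simp: dvd_def)
  have "atom s * garside I = atom s * (a * atom t)" using f(2)[OF s(1)] s(2) a by (metis mult.assoc)
  then show ?thesis by auto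
qed

lemma flip_garside:
  assumes I: "bounded I"
  shows "flip (garside I) = garside I"
proof -
  have "atom s dvd flip (garside I)" if "s \<in> I" for s
    using garside_ends[OF I that] by auto
  then have "garside I dvd flip (garside I)" by (rule garside(2)[OF I])
  then obtain c where c: "flip (garside I) = garside I * c" by (auto simp: dvd_def)
  have "c = 1" using arg_cong[OF c, of len] by simp
  then show ?thesis using c by simp
qed

lemma garside_mult_atom_not_simple:
  assumes "bounded I" "t \<in> I" "garside I * atom t dvd z"
  shows "\<not> simple z"
proof
  assume z: "simple z"
  obtain a where "garside I = a * atom t" using garside_ends[OF assms(1,2)] by blast
  then have "a * (atom t * (atom t * 1)) dvd z" using assms(3) by (simp add: mult.assoc)
  then show False using not_simple_square[of t 1] simple_multD2 simple_dvd[OF _ z] by blast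
qed

lemma mult_garside:
  assumes "bounded I"
  shows "supp x \<subseteq> I \<Longrightarrow> \<exists>y. x * garside I = garside I * y"
proof (induction x rule: atom_induct)
  case (atom s x)
  then obtain y where y: "x * garside I = garside I * y" by auto
  obtain t where t: "atom s * garside I = garside I * atom t"
    using atom_mult_garside[OF assms] atom.prems by auto
  have "atom s * x * garside I = garside I * (atom t * y)"
    using t y by (metis mult.assoc)
  then show ?case by blast
qed (auto intro: exI[of _ 1])

text \<open>Each copy of \<open>y\<close> contributes a factor \<open>garside I\<close>, which moves
  left across the remainder \<open>v\<close> and supplies the next letter of \<open>x\<close>. A
  multiple \<open>y\<close> is allowed because this will be applied to the image of a Garside
  element under \<open>\<Phi>\<close>, which is only known to be one.\<close>

lemma dvd_power_of_multiple:
  assumes I: "bounded I" and y: "supp y \<subseteq> I" "garside I dvd y" and x: "supp x \<subseteq> I"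
  shows "x dvd y ^ len x"
proof -
  obtain w where w: "x = el w" using el_surj by blast
  obtain h where h: "y = garside I * h" using y(2) by (auto simp: dvd_def)
  have "el w dvd y ^ length w" if "set w \<subseteq> I" for w
    using that
  proof (induction w rule: rev_induct)
    case (snoc s w)
    then obtain v where v: "y ^ length w = el w * v" by (auto simp: dvd_def)
    have "supp (y ^ n) \<subseteq> I" for n by (induction n) (use y(1) in auto)
    then have "supp v \<subseteq> I" using arg_cong[OF v, of supp] by (metis Un_subset_iff supp_simps(2))
    then obtain v' where v': "v * garside I = garside I * v'" using mult_garside[OF I] by blast
    obtain g where g: "garside I = atom s * g"
      using garside(1)[OF I, of s] snoc.prems by (auto simp: dvd_def)
    have "y ^ length (w @ [s]) = el w * (v * garside I) * h"
      by (simp add: power_Suc2 v mult.assoc del: power_Suc) (simp add: h)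
    also have "\<dots> = el (w @ [s]) * (g * v' * h)"
      unfolding v' by (subst g) (simp add: mult.assoc)
    finally show ?case by simp
  qed simp
  then show ?thesis using w x by simp
qed

lemma dvd_garside_power: "bounded I \<Longrightarrow> supp x \<subseteq> I \<Longrightarrow> x dvd garside I ^ len x"
  by (rule dvd_power_of_multiple) (simp_all add: garside(3))

lemma compat_bounded:
  assumes I: "bounded I" and x: "supp x \<subseteq> I" "supp y \<subseteq> I"
  shows "compat x y"
proof (rule compatI)
  show "x dvd garside I ^ (len x + len y)"
    using dvd_garside_power[OF I x(1)] by (simp add: power_add dvd_left_mult2)
  show "y dvd garside I ^ (len x + len y)"
    using dvd_garside_power[OF I x(2)] by (simp add: power_add dvd_left_mult2 add.commute[of "len x"])
qed

section \<open>Type FC and the 3-Ore condition\<close>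

definition clique :: "'s::coxeter set \<Rightarrow> bool" where
  "clique I \<longleftrightarrow> (\<forall>s\<in>I. \<forall>t\<in>I. cm s t \<noteq> \<infinity>)"

text \<open>The positions of the numbers game on \<open>I\<close> correspond to the elements of the Coxeter group, so the
  axiom says that \<open>I\<close> is of spherical type if no label is infinite.\<close>

class fc_coxeter = coxeter +
  assumes finite_positions: "finite I \<Longrightarrow> \<forall>s\<in>I. \<forall>t\<in>I. cm s t \<noteq> \<infinity> \<Longrightarrow> finite (pos ` lists I)"

text \<open>Legal words with the same position have the same length, so finitely many positions
  bound the lengths. At a legal word over \<open>I\<close> of maximal length no letter of
  \<open>I\<close> is positive, so each can be moved to the front: the word represents a common
  multiple of \<open>I\<close>.\<close>

lemma finite_positions_bounded:
  assumes "finite I" "finite (pos ` lists I)"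
  shows "bounded I"
proof -
  define L where "L = {w \<in> lists I. legal w}"
  have "length ` L = (\<lambda>f. length (SOME w. w \<in> L \<and> pos w = f)) ` pos ` L"
  proof -
    have "length (SOME w. w \<in> L \<and> pos w = pos v) = length v" if "v \<in> L" for v
    proof -
      have "(SOME w. w \<in> L \<and> pos w = pos v) \<in> L \<and> pos (SOME w. w \<in> L \<and> pos w = pos v) = pos v"
        by (rule someI[of _ v]) (use that in simp)
      then show ?thesis using that unfolding L_def
        by (metis (mono_tags, lifting) braid_length legal_pos_braid mem_Collect_eq)
    qed
    then show ?thesis by (auto simp: image_image)
  qed
  moreover have "finite (pos ` L)" using assms(2) by (rule rev_finite_subset) (auto simp: L_def)
  ultimately have fin: "finite (length ` L)" by simp
  have "[] \<in> L" by (simp add: L_def)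
  define N where "N = Max (length ` L)"
  have "N \<in> length ` L" unfolding N_def using fin \<open>[] \<in> L\<close> by (intro Max_in) auto
  then obtain w where w: "w \<in> L" "length w = N" by auto
  have max: "length v \<le> N" if "v \<in> L" for v
    unfolding N_def using fin that by (intro Max_ge) auto
  have "atom s dvd el w" if s: "s \<in> I" for s
  proof -
    have "\<not> 0 < pos w s"
    proof
      assume "0 < pos w s"
      then have "s # w \<in> L" using w s by (auto simp: L_def)
      then show False using max[of "s # w"] w by simp
    qed
    moreover have "legal w" using w by (simp add: L_def)
    ultimately obtain v where "braid w (s # v)" using legal_descent[of w s] by force
    then have "el w = el (s # v)" by (simp only: el_eq_iff)
    then show ?thesis by simp
  qed
  then show ?thesis using assms(1) by (auto simp: bounded_def)
qed

lemma clique_bounded: "finite I \<Longrightarrow> clique I \<Longrightarrow> bounded (I :: 's::fc_coxeter set)"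
  by (rule finite_positions_bounded) (auto simp: clique_def intro!: finite_positions)

lemma bounded_clique: "bounded I \<Longrightarrow> clique I"
  unfolding clique_def
proof (intro ballI)
  fix s t assume I: "bounded I" and s: "s \<in> I" "t \<in> I"
  show "cm s t \<noteq> \<infinity>"
  proof (cases "s = t")
    case False
    obtain n where "cm s t = enat n"
      using atoms_dvd[OF garside(1)[OF I s(1)] garside(1)[OF I s(2)] False] by blast
    then show ?thesis by simp
  qed (simp add: one_enat_def)
qed

lemma clique_subset: "clique I \<Longrightarrow> J \<subseteq> I \<Longrightarrow> clique J"
  by (auto simp: clique_def)

lemma clique_singleton [simp]: "clique {s}"
  by (auto simp: clique_def one_enat_def)

lemma clique_Un:
  "clique (I \<union> J) \<longleftrightarrow> clique I \<and> clique J \<and> (\<forall>s\<in>I. \<forall>t\<in>J. cm s t \<noteq> \<infinity>)"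
  by (auto simp: clique_def) (metis cm_sym)

lemma compat_multD: "compat (x * y) z \<Longrightarrow> compat x z"
  unfolding compat_def using dvd_left_multD by metis

text \<open>If \<open>c\<close> and a different first letter \<open>v\<close> of \<open>x\<close>
  divide \<open>z\<close>, their label is finite and at least 2, so the braid relation has a side
  beginning with \<open>v c\<close>, and \<open>c\<close> still divides what remains of
  \<open>z\<close> after \<open>v\<close>. Thus \<open>c\<close> meets every letter of
  \<open>x\<close> in turn.\<close>

lemma clique_insert_compat:
  assumes "clique (supp x)" "compat (atom c) x"
  shows "clique (insert c (supp x))"
proof -
  have "cm c u \<noteq> \<infinity>" if "clique (supp x)" "atom c dvd z" "x dvd z" "u \<in> supp x" for z u
    using that
  proof (induction x arbitrary: z rule: atom_induct)
    case (atom v x)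
    show ?case
    proof (cases "c = v")
      case True
      then show ?thesis using atom by (auto simp: clique_def)
    next
      case False
      have "atom v dvd z" using atom.prems(3) dvd_left_multD by blast
      then obtain n where n: "cm c v = enat n" "altp n (atom c) (atom v) dvd z"
        using atoms_dvd[OF atom.prems(2) _ False] by blast
      obtain j where j: "n = Suc (Suc j)"
        using cm_enat_ge2[OF False n(1)] by (metis add_2_eq_Suc le_Suc_ex)
      obtain z' where z': "z = atom v * z'" "x dvd z'"
        using atom.prems(3) by (auto simp: dvd_def mult.assoc)
      have "atom c * altp j (atom v) (atom c) dvd z'"
        using n(2) unfolding braid_relation[OF False n(1)] z' by (simp add: j)
      then have "atom c dvd z'" by (rule dvd_left_multD)
      then have "u \<in> supp x \<Longrightarrow> cm c u \<noteq> \<infinity>"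
        using atom.IH[of z'] z' atom.prems(1) clique_subset[of "supp (atom v * x)" "supp x"] by auto
      then show ?thesis using atom.prems(4) n(1) by auto
    qed
  qed simp
  then have "\<forall>u\<in>supp x. cm c u \<noteq> \<infinity>" using assms by (auto simp: compat_def)
  then show ?thesis using assms(1) clique_Un[of "{c}" "supp x"] by auto
qed

text \<open>Passing from \<open>x\<close> to its complement \<open>x1\<close> after the first letter
  of \<open>y\<close> loses at most that letter from the support, so induction on \<open>y\<close>
  compares all letters.\<close>

lemma clique_Un_compat:
  fixes x y :: "'s::fc_coxeter artin"
  assumes "clique (supp x)" "clique (supp y)" "compat x y"
  shows "clique (supp x \<union> supp y)"
proof -
  have "clique (supp x \<union> supp y)" if "clique (supp x)" "clique (supp y)" "x dvd z" "y dvd z" for z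
    using that
  proof (induction y arbitrary: x z rule: atom_induct)
    case (atom c y)
    obtain z' where z': "z = atom c * z'" "y dvd z'"
      using atom.prems(4) by (auto simp: dvd_def mult.assoc)
    have c: "atom c dvd z" by (simp add: z'(1))
    have K: "clique (insert c (supp x))"
      using clique_insert_compat[OF atom.prems(1) compatI[OF c atom.prems(3)]] .
    obtain x1 b where x1: "is_join (atom c) x (atom c * x1)" "supp (atom c * x1) \<subseteq> supp (atom c) \<union> supp x"
      using compat_join[OF compatI[OF c atom.prems(3)]] by metis
    have "x1 dvd z'" using is_joinD(3)[OF x1(1) c atom.prems(3)] by (simp add: z'(1))
    moreover have "clique (supp x1)" using clique_subset[OF K] x1(2) by auto
    ultimately have "clique (supp x1 \<union> supp y)"
      using atom.IH[of x1 z'] z'(2) atom.prems(2) clique_subset[of "supp (atom c * y)" "supp y"] by auto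
    moreover have "supp x \<subseteq> insert c (supp x1)" using dvd_supp[OF is_joinD(2)[OF x1(1)]] by simp
    ultimately show ?case
      using K atom.prems(2) unfolding clique_def by (simp add: Ball_def subset_iff) (metis cm_sym)
  qed simp
  then show ?thesis using assms by (auto simp: compat_def)
qed

text \<open>
  The elements with clique support generate the monoid and are closed under taking complements in
  least common multiples; this reduces the 3-Ore condition to such elements, for which it is the
  fact that a pairwise compatible triple lives in a single spherical submonoid.
\<close>

inductive clique_prod :: "nat \<Rightarrow> 's::coxeter artin \<Rightarrow> bool" where
  "clique_prod 0 1"
| "clique (supp x) \<Longrightarrow> clique_prod n y \<Longrightarrow> clique_prod (Suc n) (x * y)"

lemma clique_prod_exists: "\<exists>n. clique_prod n x"
proof (induction x rule: atom_induct)
  case one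
  show ?case by (auto intro: clique_prod.intros)
next
  case (atom s x)
  then show ?case using clique_prod.intros(2)[of "atom s"] by auto
qed

lemma clique_join:
  fixes x y :: "'s::fc_coxeter artin"
  assumes "clique (supp x)" "clique (supp y)" "compat x y"
  obtains a b where "is_join x y (x * a)" "x * a = y * b" "clique (supp a)" "clique (supp b)"
proof -
  obtain a b where ab: "is_join x y (x * a)" "x * a = y * b" "supp (x * a) \<subseteq> supp x \<union> supp y"
    using compat_join[OF assms(3)] by metis
  have "supp b \<subseteq> supp x \<union> supp y" using ab(3) unfolding ab(2) by simp
  then show thesis
    using that[OF ab(1,2)] clique_subset[OF clique_Un_compat[OF assms]] ab(3) by simp
qed

text \<open>\<open>x\<close> is pushed through the factors of \<open>y\<close> one by one. Each
  square is a join of two elements with clique support, its far side again has clique support and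
  enters the next square, and the number of factors is kept.\<close>

lemma clique_prod_complement:
  fixes x y :: "'s::fc_coxeter artin"
  assumes "clique_prod k y" "clique (supp x)" "compat x y"
  shows "\<exists>a b. is_join x y (x * a) \<and> x * a = y * b \<and> clique_prod k a \<and> clique (supp b)"
  using assms
proof (induction arbitrary: x rule: clique_prod.induct)
  case 1
  show ?case by (rule exI[of _ 1], rule exI[of _ x]) (auto simp: is_join_def 1 intro: clique_prod.intros)
next
  case (2 y n z)
  obtain u where u: "x dvd u" "y * z dvd u" using 2(5) by (auto simp: compat_def)
  have yu: "y dvd u" by (rule dvd_left_multD[OF u(2)])
  obtain b a where ab: "is_join y x (y * b)" "y * b = x * a" "clique (supp b)" "clique (supp a)"
    using clique_join[OF 2(1) 2(4) compatI[OF yu u(1)]] by metis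
  have "compat b z" using compat_mult_iff[OF ab(1), of z] 2(5) by simp
  then obtain c d where cd: "is_join b z (b * c)" "b * c = z * d" "clique_prod n c" "clique (supp d)"
    using 2(3)[OF ab(3)] by blast
  have "is_join x (y * z) (x * (a * c))"
    unfolding is_join_def
  proof (intro conjI allI impI)
    show "y * z dvd x * (a * c)"
      using is_joinD(2)[OF cd(1)] ab(2) by (metis dvd_left_mono mult.assoc)
    fix v assume v: "x dvd v" "y * z dvd v"
    obtain v' where v': "v = y * v'" using dvd_left_multD[OF v(2)] by (auto simp: dvd_def)
    have "b dvd v'" using v(1) dvd_mult_iff[OF ab(1)] by (simp add: v')
    moreover have "z dvd v'" using v(2) by (simp add: v')
    ultimately have "b * c dvd v'" by (rule is_joinD(3)[OF cd(1)])
    moreover have "x * (a * c) = y * (b * c)" using ab(2) by (metis mult.assoc)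
    ultimately show "x * (a * c) dvd v" by (simp add: v')
  qed simp
  moreover have "x * (a * c) = y * z * d"
    using ab(2) cd(2) by (metis mult.assoc)
  ultimately show ?case using clique_prod.intros(2)[OF ab(4) cd(3)] cd(4) by blast
qed

text \<open>The induction peels the first factor \<open>x1\<close> off \<open>x\<close>. A common
  multiple of \<open>x1\<close>, \<open>y\<close>, \<open>z\<close> makes the complements
  \<open>y1\<close>, \<open>z1\<close> of \<open>y\<close> and \<open>z\<close> compatible, and a
  common multiple of \<open>x2\<close>, \<open>y1\<close>, \<open>z1\<close> then lifts. By
  \<open>clique_prod_complement\<close> both triples have fewer factors in total.\<close>

lemma three_ore_clique_prod:
  fixes x y z :: "'s::fc_coxeter artin"
  assumes "clique_prod p x" "clique_prod q y" "clique_prod r z"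
    and "compat x y" "compat y z" "compat x z"
  shows "\<exists>u. x dvd u \<and> y dvd u \<and> z dvd u"
  using assms
proof (induction "p + q + r" arbitrary: p q r x y z rule: less_induct)
  case less
  \<comment> \<open>Stated for a variable triple, so that any of the three elements can play the
    first role; at least two factors are required of it for \<open>x1\<close>, \<open>y\<close>,
    \<open>z\<close> to be a smaller triple.\<close>
  have step: "\<exists>u. x dvd u \<and> y dvd u \<and> z dvd u"
    if pq: "a + b + c = p + q + r" "2 \<le> a" "clique_prod a x" "clique_prod b y" "clique_prod c z"
      and com: "compat x y" "compat y z" "compat x z" for a b c and x y z :: "'s artin"
  proof -
    obtain a' where a': "a = Suc (Suc a')" using pq(2) by (metis add_2_eq_Suc le_Suc_ex)
    from pq(3) obtain x1 x2 where x: "x = x1 * x2" "clique (supp x1)" "clique_prod (Suc a') x2"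
      by (cases rule: clique_prod.cases) (auto simp: a')
    have x1: "clique_prod 1 x1" using clique_prod.intros(2)[OF x(2) clique_prod.intros(1)] by simp
    have c1: "compat x1 y" "compat x1 z"
      using com(1,3) compat_multD unfolding x(1) by metis+
    obtain u where u: "x1 dvd u" "y dvd u" "z dvd u"
      using less.hyps[OF _ x1 pq(4,5) c1(1) com(2) c1(2)] pq(1) a' by auto
    obtain y1 where y1: "is_join x1 y (x1 * y1)" "clique_prod b y1"
      using clique_prod_complement[OF pq(4) x(2) c1(1)] by blast
    obtain z1 where z1: "is_join x1 z (x1 * z1)" "clique_prod c z1"
      using clique_prod_complement[OF pq(5) x(2) c1(2)] by blast
    obtain u' where u': "u = x1 * u'" using u(1) by (auto simp: dvd_def)
    have "y1 dvd u'" "z1 dvd u'"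
      using is_joinD(3)[OF y1(1) u(1,2)] is_joinD(3)[OF z1(1) u(1,3)] by (simp_all add: u')
    then have "compat y1 z1" by (rule compatI)
    moreover have "compat x2 y1" "compat x2 z1"
      using compat_mult_iff[OF y1(1), of x2] compat_mult_iff[OF z1(1), of x2]
        compat_sym[OF com(1)] compat_sym[OF com(3)] compat_sym[of y1 x2] compat_sym[of z1 x2]
      unfolding x(1) by simp_all
    ultimately obtain v where v: "x2 dvd v" "y1 dvd v" "z1 dvd v"
      using less.hyps[OF _ x(3) y1(2) z1(2)] pq(1) a' by auto
    have "y dvd x1 * v" "z dvd x1 * v"
      using dvd_mult_iff[OF y1(1)] dvd_mult_iff[OF z1(1)] v(2,3) by simp_all
    moreover have "x dvd x1 * v" using v(1) by (simp add: x(1))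
    ultimately show ?thesis by metis
  qed
  show ?case
  proof (cases "p \<le> 1 \<and> q \<le> 1 \<and> r \<le> 1")
    case True
    have *: "clique (supp x)" if n: "clique_prod n x" "n \<le> 1" for n and x :: "'s artin"
      using n(1)
    proof (cases rule: clique_prod.cases)
      case (2 y m z)
      then have "clique_prod 0 z" using n(2) by simp
      then have "z = 1" by (cases rule: clique_prod.cases) auto
      then show ?thesis using 2 by simp
    qed (simp add: clique_def)
    note cl = *[OF less.prems(1)] *[OF less.prems(2)] *[OF less.prems(3)]
    \<comment> \<open>Being a clique is a condition on pairs, so the pairwise unions suffice for the
      whole union; type FC then makes it bounded.\<close>
    have K: "clique (supp x \<union> supp y \<union> supp z)"
      using clique_Un_compat[OF cl(1,2) less.prems(4)] clique_Un_compat[OF cl(2,3) less.prems(5)]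
        clique_Un_compat[OF cl(1,3) less.prems(6)] True
      unfolding clique_Un by auto
    then have B: "bounded (supp x \<union> supp y \<union> supp z)" by (intro clique_bounded) auto
    let ?d = "garside (supp x \<union> supp y \<union> supp z)"
    have "v dvd ?d ^ (len x + len y + len z)"
      if v: "supp v \<subseteq> supp x \<union> supp y \<union> supp z" "len v \<le> len x + len y + len z" for v
    proof -
      obtain k where "len x + len y + len z = len v + k" using v(2) le_Suc_ex by blast
      then show ?thesis using dvd_garside_power[OF B v(1)] by (simp add: power_add dvd_left_mult2)
    qed
    from this[of x] this[of y] this[of z] show ?thesis by auto
  next
    case False
    then consider "2 \<le> p" | "2 \<le> q" | "2 \<le> r" by linarith
    then show ?thesis
    proof cases
      case 1
      then show ?thesis using step[OF _ 1 less.prems(1,2,3) less.prems(4,5,6)] by simp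
    next
      case 2
      then show ?thesis
        using step[OF _ 2 less.prems(2,1,3) compat_sym[OF less.prems(4)] less.prems(6,5)] by auto
    next
      case 3
      then show ?thesis
        using step[OF _ 3 less.prems(3,1,2) compat_sym[OF less.prems(6)] less.prems(4)
            compat_sym[OF less.prems(5)]] by auto
    qed
  qed
qed

theorem three_ore:
  fixes x y z :: "'s::fc_coxeter artin"
  assumes "compat x y" "compat y z" "compat x z"
  shows "\<exists>u. x dvd u \<and> y dvd u \<and> z dvd u"
  using three_ore_clique_prod[OF _ _ _ assms] clique_prod_exists by metis

section \<open>Multifractions\<close>

text \<open>
  We follow Dehornoy's reduction of multifractions: a finitely supported sequence \<open>a\<close> stands for
  \<open>a\<^sub>0 a\<^sub>1\<inverse> a\<^sub>2 a\<^sub>3\<inverse> \<dots>\<close>. Passing from one level to the next exchanges left and right, so a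
  statement about the multiplication \<open>f\<close> is used for \<open>f\<close> and for its opposite.
\<close>

definition ljoin :: "('m \<Rightarrow> 'm \<Rightarrow> 'm) \<Rightarrow> 'm \<Rightarrow> 'm \<Rightarrow> 'm \<Rightarrow> 'm \<Rightarrow> bool" where
  "ljoin f x y a b \<longleftrightarrow> f x a = f y b \<and>
    (\<forall>a' b'. f x a' = f y b' \<longrightarrow> (\<exists>k. a' = f a k \<and> b' = f b k))"

locale half_ore =
  fixes f :: "'m \<Rightarrow> 'm \<Rightarrow> 'm" (infixl "\<odot>" 70) and e :: 'm and sz :: "'m \<Rightarrow> nat"
  assumes assoc: "(x \<odot> y) \<odot> z = x \<odot> (y \<odot> z)"
    and left_one [simp]: "e \<odot> x = x" and right_one [simp]: "x \<odot> e = x"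
    and left_cancel [simp]: "x \<odot> y = x \<odot> z \<longleftrightarrow> y = z"
    and sz_mult: "sz (x \<odot> y) = sz x + sz y"
    and sz_0: "sz x = 0 \<longleftrightarrow> x = e"
    and ljoin_exists: "x \<odot> a = y \<odot> b \<Longrightarrow> \<exists>c d. ljoin f x y c d"
    and three_ore: "x \<odot> a = y \<odot> b \<Longrightarrow> y \<odot> a' = z \<odot> b' \<Longrightarrow> x \<odot> a'' = z \<odot> b'' \<Longrightarrow>
      \<exists>p q r. x \<odot> p = y \<odot> q \<and> x \<odot> p = z \<odot> r"
begin

lemma mult_eq_e: "x \<odot> y = e \<longleftrightarrow> x = e \<and> y = e"
  by (metis sz_mult sz_0 add_is_0 left_one)

lemma ljoinD: "ljoin f x y a b \<Longrightarrow> x \<odot> a = y \<odot> b"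
  by (simp add: ljoin_def)

lemma ljoin_factor:
  assumes "ljoin f x y a b" "x \<odot> a' = y \<odot> b'"
  obtains k where "a' = a \<odot> k" "b' = b \<odot> k"
proof -
  have "\<exists>k. a' = a \<odot> k \<and> b' = b \<odot> k" using assms unfolding ljoin_def by blast
  then show thesis using that by blast
qed

lemma ljoin_unique:
  assumes "ljoin f x y a b" "ljoin f x y a' b'"
  shows "a = a' \<and> b = b'"
proof -
  obtain k where k: "a' = a \<odot> k" "b' = b \<odot> k" by (rule ljoin_factor[OF assms(1) ljoinD[OF assms(2)]])
  obtain l where l: "a = a' \<odot> l" "b = b' \<odot> l" by (rule ljoin_factor[OF assms(2) ljoinD[OF assms(1)]])
  have "a \<odot> (k \<odot> l) = a \<odot> e" using k(1) l(1) by (metis assoc right_one)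
  then have "k \<odot> l = e" by (simp only: left_cancel)
  then have "k = e" by (simp only: mult_eq_e)
  then show ?thesis using k by simp
qed

lemma ljoin_trans:
  assumes "ljoin f x m q x'" "ljoin f u q q1 x1"
  shows "ljoin f (x \<odot> u) m q1 (x' \<odot> x1)"
  unfolding ljoin_def
proof (intro conjI allI impI)
  show "x \<odot> u \<odot> q1 = m \<odot> (x' \<odot> x1)"
    using ljoinD[OF assms(1)] ljoinD[OF assms(2)] by (metis assoc)
  fix a' b' assume "x \<odot> u \<odot> a' = m \<odot> b'"
  then have "x \<odot> (u \<odot> a') = m \<odot> b'" by (simp add: assoc)
  then obtain k where k: "u \<odot> a' = q \<odot> k" "b' = x' \<odot> k" by (rule ljoin_factor[OF assms(1)])
  obtain l where "a' = q1 \<odot> l" "k = x1 \<odot> l" using k(1) by (rule ljoin_factor[OF assms(2)])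
  then show "\<exists>k. a' = q1 \<odot> k \<and> b' = x' \<odot> x1 \<odot> k" using k(2) by (auto simp: assoc)
qed

lemma ljoin_self: "ljoin f x (x \<odot> t) t e"
  by (auto simp: ljoin_def assoc)

lemma ljoin_one: "ljoin f x e e x"
  by (auto simp: ljoin_def)

text \<open>Serves two divisors of one entry that are both carried across the entry
  \<open>m\<close>. The 3-Ore property for \<open>x\<close>, \<open>y\<close>, \<open>m\<close>
  makes their complements \<open>u\<close>, \<open>v\<close> compatible with the respective
  remainders \<open>q\<close>, \<open>p\<close> of \<open>m\<close>, and uniqueness of joins gives
  the same \<open>n\<close> on both sides. The last clause is for level 0, where nothing may be left
  over.\<close>

lemma ljoin_same_level:
  assumes "x \<odot> r = y \<odot> s" "ljoin f x m q x'" "ljoin f y m p y'"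
  obtains u t v n x1 y1 where "r = u \<odot> t" "s = v \<odot> t" "ljoin f u q n x1" "ljoin f v p n y1"
    "x' \<odot> x1 = y' \<odot> y1" "x' = e \<and> y' = e \<longrightarrow> x1 = e \<and> y1 = e"
proof -
  obtain u v where uv: "ljoin f x y u v" using ljoin_exists[OF assms(1)] by blast
  obtain t where t: "r = u \<odot> t" "s = v \<odot> t" by (rule ljoin_factor[OF uv assms(1)])
  obtain a b c where abc: "x \<odot> a = y \<odot> b" "x \<odot> a = m \<odot> c"
    using three_ore[OF assms(1) ljoinD[OF assms(3)] ljoinD[OF assms(2)]] by blast
  obtain k where k: "a = u \<odot> k" "b = v \<odot> k" by (rule ljoin_factor[OF uv abc(1)])
  obtain l where l: "a = q \<odot> l" by (rule ljoin_factor[OF assms(2) abc(2)])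
  have "y \<odot> b = m \<odot> c" using abc by simp
  then obtain l' where l': "b = p \<odot> l'" by (rule ljoin_factor[OF assms(3)])
  have "u \<odot> k = q \<odot> l" "v \<odot> k = p \<odot> l'" using k l l' by simp_all
  then obtain n x1 n' y1 where j: "ljoin f u q n x1" "ljoin f v p n' y1"
    using ljoin_exists by meson
  have "ljoin f (x \<odot> u) m n (x' \<odot> x1)" "ljoin f (y \<odot> v) m n' (y' \<odot> y1)"
    using ljoin_trans assms(2,3) j by blast+
  then have "n = n' \<and> x' \<odot> x1 = y' \<odot> y1" using ljoinD[OF uv] ljoin_unique by metis
  moreover have "x1 = e \<and> y1 = e" if "x' = e" "y' = e"
  proof -
    have "x \<odot> q = y \<odot> p" using ljoinD[OF assms(2)] ljoinD[OF assms(3)] that by simp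
    then obtain h where h: "q = u \<odot> h" "p = v \<odot> h" by (rule ljoin_factor[OF uv])
    show ?thesis using ljoin_unique[OF j(1)] ljoin_unique[OF j(2)] ljoin_self[of u h] ljoin_self[of v h] h
      by metis
  qed
  ultimately show thesis using that[OF t j(1)] j(2) by metis
qed

end

locale ore_monoid = half_ore f e sz + opp: half_ore "\<lambda>x y. f y x" e sz
  for f :: "'m \<Rightarrow> 'm \<Rightarrow> 'm" (infixl "\<odot>" 70) and e :: 'm and sz :: "'m \<Rightarrow> nat"
begin

text \<open>Entries \<open>i\<close> and \<open>i + 1\<close> meet as
  \<open>a\<^sub>i a\<^sub>i\<^sub>+\<^sub>1\<inverse>\<close> for even \<open>i\<close> and as
  \<open>a\<^sub>i\<inverse> a\<^sub>i\<^sub>+\<^sub>1\<close> for odd \<open>i\<close>, so the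
  divisors to be removed stand on the right at even levels and on the left at odd ones.\<close>

definition op :: "nat \<Rightarrow> 'm \<Rightarrow> 'm \<Rightarrow> 'm" where
  "op i = (if odd i then f else (\<lambda>x y. f y x))"

lemma half_ore_op: "half_ore (op i) e sz"
  unfolding op_def using half_ore_axioms opp.half_ore_axioms by simp

lemma op_Suc: "op (Suc i) x y = op i y x"
  by (simp add: op_def)

lemma op_one [simp]: "op i x e = x" "op i e x = x"
  by (simp_all add: op_def)

definition upd :: "nat \<Rightarrow> (nat \<Rightarrow> 'm) \<Rightarrow> 'm \<Rightarrow> 'm \<Rightarrow> 'm \<Rightarrow> nat \<Rightarrow> 'm" where
  "upd i a x' q r = (\<lambda>k. if k = Suc i then r else if k = i then q
     else if Suc k = i then op i (a k) x' else a k)"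

text \<open>The divisor \<open>x\<close> of the entry \<open>i + 1\<close> is carried across the entry \<open>i\<close> to the entry \<open>i - 1\<close>. At
  level \<open>0\<close> there is no such entry, and \<open>x\<close> has to cancel.\<close>

definition red :: "nat \<Rightarrow> 'm \<Rightarrow> (nat \<Rightarrow> 'm) \<Rightarrow> (nat \<Rightarrow> 'm) \<Rightarrow> bool" where
  "red i x a b \<longleftrightarrow> (\<exists>r q x'. a (Suc i) = op i x r \<and> ljoin (op i) x (a i) q x' \<and> (i = 0 \<longrightarrow> x' = e)
     \<and> b = upd i a x' q r)"

definition step :: "(nat \<Rightarrow> 'm) \<Rightarrow> (nat \<Rightarrow> 'm) \<Rightarrow> bool" where
  "step a b \<longleftrightarrow> (\<exists>i x. x \<noteq> e \<and> red i x a b)"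

definition irred :: "(nat \<Rightarrow> 'm) \<Rightarrow> bool" where
  "irred a \<longleftrightarrow> (\<nexists>b. step a b)"

definition supp_below :: "nat \<Rightarrow> (nat \<Rightarrow> 'm) \<Rightarrow> bool" where
  "supp_below n a \<longleftrightarrow> (\<forall>k\<ge>n. a k = e)"

lemma redI: "a (Suc i) = op i x r \<Longrightarrow> ljoin (op i) x (a i) q x' \<Longrightarrow> (i = 0 \<Longrightarrow> x' = e) \<Longrightarrow>
    b = upd i a x' q r \<Longrightarrow> red i x a b"
  unfolding red_def by blast

lemma red_step:
  assumes "red i x a b"
  shows "step\<^sup>*\<^sup>* a b"
proof (cases "x = e")
  case True
  interpret O: half_ore "op i" e sz by (rule half_ore_op)
  obtain r q x' where r: "a (Suc i) = r" "ljoin (op i) e (a i) q x'" "b = upd i a x' q r"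
    using assms unfolding red_def True by auto
  have "ljoin (op i) e (a i) (a i) e" using O.ljoin_self[of e "a i"] by simp
  then have "q = a i" "x' = e" using O.ljoin_unique r(2) by blast+
  then have "b = a" using r by (auto simp: upd_def)
  then show ?thesis by simp
next
  case False
  then have "step a b" using assms unfolding step_def by blast
  then show ?thesis by blast
qed

lemma step_level:
  assumes "red i x a b" "x \<noteq> e" "supp_below n a"
  shows "Suc i < n" "supp_below n b" "sz (b (Suc i)) < sz (a (Suc i))" "\<And>k. Suc i < k \<Longrightarrow> b k = a k"
proof -
  interpret O: half_ore "op i" e sz by (rule half_ore_op)
  obtain r q x' where r: "a (Suc i) = op i x r" "b = upd i a x' q r"
    using assms(1) unfolding red_def by blast
  have "a (Suc i) \<noteq> e" using assms(2) r(1) by (simp add: O.mult_eq_e)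
  then show i: "Suc i < n" using assms(3) by (meson supp_below_def not_less)
  then show "supp_below n b" using assms(3) by (auto simp: supp_below_def r(2) upd_def)
  show "sz (b (Suc i)) < sz (a (Suc i))" using assms(2) O.sz_0[of x] by (simp add: r upd_def O.sz_mult)
  show "\<And>k. Suc i < k \<Longrightarrow> b k = a k" by (simp add: r(2) upd_def)
qed

lemma step_supp_below: "step a b \<Longrightarrow> supp_below n a \<Longrightarrow> supp_below n b"
  unfolding step_def using step_level(2) by blast

lemma steps_supp_below: "step\<^sup>*\<^sup>* a b \<Longrightarrow> supp_below n a \<Longrightarrow> supp_below n b"
  by (induction rule: rtranclp_induct) (auto intro: step_supp_below)

text \<open>A reduction at level \<open>i\<close> may lengthen lower entries, but the highest entry
  it touches, i + 1, becomes shorter. So the lengths, listed from the top, decrease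
  lexicographically; \<open>n\<close> fixes the length of these lists.\<close>

lemma wf_step: "wf {(b, a). supp_below n a \<and> step a b}"
proof (rule wf_subset[OF wf_inv_image[OF wf_lex[OF wf_less_than]]])
  let ?m = "\<lambda>a. map (\<lambda>k. sz (a k)) (rev [0..<n])"
  show "{(b, a). supp_below n a \<and> step a b} \<subseteq> inv_image (lex less_than) ?m"
  proof clarify
    fix b a assume n: "supp_below n a" and "step a b"
    then obtain i x where red: "red i x a b" "x \<noteq> e" by (auto simp: step_def)
    note l = step_level[OF red n]
    obtain j where j: "n = Suc (Suc i) + j" using l(1) by (metis Suc_leI le_Suc_ex)
    have "[0..<n] = [0..<Suc (Suc i)] @ [Suc (Suc i)..<n]"
      unfolding j by (rule upt_add_eq_append) simp
    then have "[0..<n] = [0..<Suc i] @ [Suc i] @ [Suc (Suc i)..<n]" by simp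
    then have "rev [0..<n] = rev [Suc (Suc i)..<n] @ Suc i # rev [0..<Suc i]" by simp
    then show "(b, a) \<in> inv_image (lex less_than) ?m"
      using l(3,4) by (auto simp: lex_conv in_inv_image simp del: upt_Suc intro!: exI)
  qed
qed

section \<open>Confluence: reductions at equal, adjacent and distant levels\<close>

lemma local_confluence_same:
  assumes "red i x a b" "red i y a c"
  shows "\<exists>d. step\<^sup>*\<^sup>* b d \<and> step\<^sup>*\<^sup>* c d"
proof -
  interpret O: half_ore "op i" e sz by (rule half_ore_op)
  obtain r q x' where b: "a (Suc i) = op i x r" "ljoin (op i) x (a i) q x'" "i = 0 \<longrightarrow> x' = e"
    "b = upd i a x' q r" using assms(1) unfolding red_def by blast
  obtain s p y' where c: "a (Suc i) = op i y s" "ljoin (op i) y (a i) p y'" "i = 0 \<longrightarrow> y' = e"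
    "c = upd i a y' p s" using assms(2) unfolding red_def by blast
  have rs: "op i x r = op i y s" using b(1) c(1) by simp
  obtain u t v n x1 y1 where j: "r = op i u t" "s = op i v t" "ljoin (op i) u q n x1"
    "ljoin (op i) v p n y1" "op i x' x1 = op i y' y1" "x' = e \<and> y' = e \<longrightarrow> x1 = e \<and> y1 = e"
    by (rule O.ljoin_same_level[OF rs b(2) c(2)])
  let ?d = "upd i a (op i x' x1) n t"
  have "red i u b ?d"
    by (rule redI[of _ _ _ t n x1]) (use j b(3) c(3) in \<open>auto simp: b(4) upd_def O.assoc\<close>)
  moreover have "red i v c ?d"
    by (rule redI[of _ _ _ t n y1]) (use j b(3) c(3) in \<open>auto simp: c(4) upd_def O.assoc\<close>)
  ultimately show ?thesis using red_step by blast
qed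

text \<open>After division by \<open>x\<close>, \<open>y\<close> crosses the remaining factor
  \<open>r\<close> of the entry i + 1 and becomes \<open>y1\<close>. If \<open>y\<close> crosses
  first, a divisor \<open>k\<close> of the new entry \<open>p\<close> remains to be carried across
  the entry \<open>i\<close>. The results then differ by a common factor \<open>w\<close> of the
  entries \<open>i\<close> and i - 1, which one more reduction at level i - 1 cancels; at level 0 it
  is trivial.\<close>

lemma local_confluence_Suc:
  assumes "red i x a b" "red (Suc i) y a c"
  shows "\<exists>d. step\<^sup>*\<^sup>* b d \<and> step\<^sup>*\<^sup>* c d"
proof -
  interpret O: half_ore "op i" e sz by (rule half_ore_op)
  interpret P: half_ore "op (Suc i)" e sz by (rule half_ore_op)
  obtain r q x' where b: "a (Suc i) = op i x r" "ljoin (op i) x (a i) q x'" "i = 0 \<longrightarrow> x' = e"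
    "b = upd i a x' q r" using assms(1) unfolding red_def by blast
  obtain s p y' where c: "a (Suc (Suc i)) = op (Suc i) y s" "ljoin (op (Suc i)) y (a (Suc i)) p y'"
    "c = upd (Suc i) a y' p s" using assms(2) unfolding red_def by blast
  have e: "op (Suc i) y p = op (Suc i) r (op (Suc i) x y')"
    using P.ljoinD[OF c(2)] b(1) by (simp add: op_Suc O.assoc)
  obtain p1 y1 where j: "ljoin (op (Suc i)) y r p1 y1" using P.ljoin_exists[OF e] by blast
  obtain k where k: "p = op (Suc i) p1 k" "op (Suc i) x y' = op (Suc i) y1 k"
    by (rule P.ljoin_factor[OF j e])
  let ?b = "upd (Suc i) b y1 p1 s"
  have rb: "red (Suc i) y b ?b"
    by (rule redI[of _ _ _ s p1 y1]) (use c(1) j in \<open>auto simp: b(4) upd_def\<close>)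
  have "op i k (op i y1 q) = op i (op i y' x) q" using k(2) by (simp add: op_Suc O.assoc[symmetric])
  also have "\<dots> = op i (op i y' (a i)) x'" using O.ljoinD[OF b(2)] by (simp add: O.assoc)
  finally have kq: "op i k (op i y1 q) = op i (op i y' (a i)) x'" .
  obtain h z where hz: "ljoin (op i) k (op i y' (a i)) h z" using O.ljoin_exists[OF kq] by blast
  obtain w where w: "op i y1 q = op i h w" "x' = op i z w" by (rule O.ljoin_factor[OF hz kq])
  have z0: "z = e \<and> w = e" if "i = 0"
  proof -
    have "op i z w = e" using that b(3) w(2) by metis
    then show ?thesis by (simp only: O.mult_eq_e)
  qed
  let ?c = "upd i c z h p1"
  have rc: "red i k c ?c"
    by (rule redI[of _ _ _ p1 h z]) (use hz z0 k(1) in \<open>auto simp: c(3) upd_def op_Suc\<close>)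
  have "step\<^sup>*\<^sup>* ?b ?c"
  proof (cases i)
    case 0
    then have "y1 \<in> UNIV" "op i y1 q = h" using z0 w(1) by auto
    then have "?b = ?c" using 0 by (auto simp: b(4) c(3) upd_def op_Suc)
    then show ?thesis by simp
  next
    case (Suc j)
    interpret J: half_ore "op j" e sz by (rule half_ore_op)
    have jj: "op i u v = op j v u" for u v by (simp add: Suc op_Suc)
    have "?b i = op j w h" using w(1) by (simp add: b(4) upd_def op_Suc jj)
    moreover have bj: "?b j = op j w (op i (a j) z)"
      using w(2) by (simp add: b(4) upd_def Suc op_Suc J.assoc)
    moreover have "ljoin (op j) w (?b j) (op i (a j) z) e" unfolding bj by (rule J.ljoin_self)
    ultimately have "red j w ?b (upd j ?b e (op i (a j) z) h)"
      by (intro redI[of _ _ _ h "op i (a j) z" e]) (auto simp: Suc)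
    moreover have "upd j ?b e (op i (a j) z) h = ?c"
      by (auto simp: fun_eq_iff b(4) c(3) upd_def Suc)
    ultimately show ?thesis using red_step by metis
  qed
  then show ?thesis using red_step[OF rb] red_step[OF rc] by (meson rtranclp_trans)
qed

lemma local_confluence_far:
  assumes "red i x a b" "red j y a c" "Suc (Suc i) \<le> j"
  shows "\<exists>d. step\<^sup>*\<^sup>* b d \<and> step\<^sup>*\<^sup>* c d"
proof -
  interpret O: half_ore "op i" e sz by (rule half_ore_op)
  obtain r q x' where b: "a (Suc i) = op i x r" "ljoin (op i) x (a i) q x'" "i = 0 \<longrightarrow> x' = e"
    "b = upd i a x' q r" using assms(1) unfolding red_def by blast
  obtain s p y' where c: "a (Suc j) = op j y s" "ljoin (op j) y (a j) p y'" "c = upd j a y' p s"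
    using assms(2) unfolding red_def by blast
  let ?d = "upd j b y' p s"
  let ?r = "if j = Suc (Suc i) then op i r y' else r"
  have "red j y b ?d"
    by (rule redI[of _ _ _ s p y']) (use c(1,2) assms(3) in \<open>auto simp: b(4) upd_def\<close>)
  moreover have "red i x c ?d"
  proof (rule redI[of _ _ _ ?r q x'])
    have jj: "op j = op i" if "j = Suc (Suc i)" by (simp add: op_def that)
    show "c (Suc i) = op i x ?r" using assms(3) b(1) jj by (auto simp: c(3) upd_def O.assoc)
    show "ljoin (op i) x (c i) q x'" using b(2) assms(3) by (simp add: c(3) upd_def)
    show "?d = upd i c x' q ?r"
      using assms(3) jj by (auto simp: fun_eq_iff b(4) c(3) upd_def)
  qed (use b(3) in simp)
  ultimately show ?thesis using red_step by blast
qed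

lemma local_confluence:
  assumes "step a b" "step a c"
  shows "\<exists>d. step\<^sup>*\<^sup>* b d \<and> step\<^sup>*\<^sup>* c d"
proof -
  obtain i x where b: "red i x a b" using assms(1) by (auto simp: step_def)
  obtain j y where c: "red j y a c" using assms(2) by (auto simp: step_def)
  consider "i = j" | "j = Suc i" | "i = Suc j" | "Suc (Suc i) \<le> j" | "Suc (Suc j) \<le> i" by linarith
  then show ?thesis
  proof cases
    case 1
    then show ?thesis using local_confluence_same b c by blast
  next
    case 2
    then show ?thesis using local_confluence_Suc b c by blast
  next
    case 3
    then show ?thesis using local_confluence_Suc[of j y a c x b] b c by blast
  next
    case 4
    then show ?thesis using local_confluence_far b c by blast
  next
    case 5
    then show ?thesis using local_confluence_far[of j y a c i x b] b c by blast
  qed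
qed

text \<open>Newman's lemma. Reduction preserves the bound \<open>n\<close> on the support, and for
  fixed \<open>n\<close> it is well-founded by \<open>wf_step\<close>.\<close>

lemma confluence:
  assumes "supp_below n a" "step\<^sup>*\<^sup>* a b" "step\<^sup>*\<^sup>* a c"
  shows "\<exists>d. step\<^sup>*\<^sup>* b d \<and> step\<^sup>*\<^sup>* c d"
  using assms
proof (induction a arbitrary: b c rule: wf_induct_rule[OF wf_step[of n]])
  case (1 a)
  show ?case
  proof (cases "a = b \<or> a = c")
    case False
    then obtain b1 c1 where s: "step a b1" "step\<^sup>*\<^sup>* b1 b" "step a c1" "step\<^sup>*\<^sup>* c1 c"
      using 1(3,4) by (metis converse_rtranclpE)
    have n: "supp_below n b1" "supp_below n c1" using s 1(2) step_supp_below by blast+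
    obtain d where d: "step\<^sup>*\<^sup>* b1 d" "step\<^sup>*\<^sup>* c1 d" using local_confluence s(1,3) by blast
    obtain b2 where b2: "step\<^sup>*\<^sup>* b b2" "step\<^sup>*\<^sup>* d b2" using 1(1)[of b1] s(1,2) d(1) n(1) 1(2) by blast
    have "step\<^sup>*\<^sup>* c1 b2" using d(2) b2(2) by simp
    then obtain c2 where "step\<^sup>*\<^sup>* b2 c2" "step\<^sup>*\<^sup>* c c2" using 1(1)[of c1] s(3,4) n(2) 1(2) by blast
    then show ?thesis using b2(1) by (meson rtranclp_trans)
  qed (use 1 in blast)
qed

section \<open>Normal forms and the action by multiplication\<close>

definition nf :: "(nat \<Rightarrow> 'm) \<Rightarrow> nat \<Rightarrow> 'm" where
  "nf a = (SOME b. step\<^sup>*\<^sup>* a b \<and> irred b)"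

lemma irred_exists: "supp_below n a \<Longrightarrow> \<exists>b. step\<^sup>*\<^sup>* a b \<and> irred b"
proof (induction a rule: wf_induct_rule[OF wf_step[of n]])
  case (1 a)
  show ?case
  proof (cases "irred a")
    case False
    then obtain b where b: "step a b" by (auto simp: irred_def)
    then obtain c where "step\<^sup>*\<^sup>* b c" "irred c" using 1 step_supp_below by blast
    then show ?thesis using b by (meson converse_rtranclp_into_rtranclp)
  qed blast
qed

lemma nf: "supp_below n a \<Longrightarrow> step\<^sup>*\<^sup>* a (nf a) \<and> irred (nf a)"
  unfolding nf_def using someI_ex[OF irred_exists] by blast

lemma irred_steps: "irred a \<Longrightarrow> step\<^sup>*\<^sup>* a b \<Longrightarrow> b = a"
  by (metis converse_rtranclpE irred_def)

lemma nf_irred: "supp_below n a \<Longrightarrow> irred a \<Longrightarrow> nf a = a"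
  using nf irred_steps by blast

lemma nf_steps:
  assumes "supp_below n a" "step\<^sup>*\<^sup>* a b"
  shows "nf a = nf b"
proof -
  have n: "supp_below n b" using assms steps_supp_below by blast
  have "step\<^sup>*\<^sup>* a (nf b)" using assms(2) nf[OF n] by (meson rtranclp_trans)
  then obtain d where "step\<^sup>*\<^sup>* (nf a) d" "step\<^sup>*\<^sup>* (nf b) d"
    using confluence[OF assms(1)] nf[OF assms(1)] by blast
  then show ?thesis using nf[OF assms(1)] nf[OF n] irred_steps by metis
qed

lemma supp_below_nf: "supp_below n a \<Longrightarrow> supp_below n (nf a)"
  using nf steps_supp_below by blast

lemma supp_below_upd: "supp_below n a \<Longrightarrow> n \<le> k \<Longrightarrow> supp_below (Suc k) (a(k := x))"
  by (auto simp: supp_below_def)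

lemma steps_upd: "step\<^sup>*\<^sup>* a b \<Longrightarrow> supp_below n a \<Longrightarrow> n \<le> k \<Longrightarrow> step\<^sup>*\<^sup>* (a(k := x)) (b(k := x))"
proof (induction rule: rtranclp_induct)
  case (step b c)
  have n: "supp_below n b" using step steps_supp_below by blast
  obtain i y where y: "y \<noteq> e" "red i y b c" using step(2) by (auto simp: step_def)
  have i: "Suc i < n" using step_level[OF y(2,1) n] by simp
  obtain r q x' where "b (Suc i) = op i y r" "ljoin (op i) y (b i) q x'" "i = 0 \<longrightarrow> x' = e"
    "c = upd i b x' q r" using y(2) unfolding red_def by blast
  then have "red i y (b(k := x)) (c(k := x))"
    using i step.prems(2) by (intro redI[of _ _ _ r q x']) (auto simp: upd_def)
  then show ?case using step red_step by (meson rtranclp_trans)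
qed simp

lemma nf_nf_upd: "supp_below n a \<Longrightarrow> n \<le> k \<Longrightarrow> nf ((nf a)(k := x)) = nf (a(k := x))"
  using nf_steps[OF supp_below_upd steps_upd] nf by metis

text \<open>The entry k + 1 is trivial, so \<open>y\<close>, as a divisor of the entry k + 2,
  crosses it unchanged and joins the entry \<open>k\<close>.\<close>

lemma nf_merge:
  assumes "supp_below n c" "n \<le> k"
  shows "nf (c(k := x, Suc (Suc k) := y)) = nf (c(k := op (Suc k) x y))"
proof -
  interpret O: half_ore "op (Suc k)" e sz by (rule half_ore_op)
  have c: "c k = e" "c (Suc k) = e" "c (Suc (Suc k)) = e" using assms by (auto simp: supp_below_def)
  have "red (Suc k) y (c(k := x, Suc (Suc k) := y)) (c(k := op (Suc k) x y))"
    using c O.ljoin_one[of y]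
    by (intro redI[of _ _ _ e e y]) (auto simp: upd_def fun_eq_iff)
  moreover have "supp_below (Suc (Suc (Suc k))) (c(k := x, Suc (Suc k) := y))"
    using assms by (auto simp: supp_below_def)
  ultimately show ?thesis using nf_steps red_step by blast
qed

lemma nf_cancel:
  assumes "supp_below n c" "n \<le> k"
  shows "nf (c(k := x, Suc k := x)) = nf c"
proof -
  interpret O: half_ore "op k" e sz by (rule half_ore_op)
  have c: "c k = e" "c (Suc k) = e" using assms by (auto simp: supp_below_def)
  have "red k x (c(k := x, Suc k := x)) c"
    using c O.ljoin_self[of x e] by (intro redI[of _ _ _ e e e]) (auto simp: upd_def fun_eq_iff)
  moreover have "supp_below (Suc (Suc k)) (c(k := x, Suc k := x))"
    using assms by (auto simp: supp_below_def)
  ultimately show ?thesis using nf_steps red_step by blast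
qed

text \<open>Right multiplication by \<open>x\<close> if \<open>p\<close> holds, and by its inverse otherwise.\<close>

definition act :: "bool \<Rightarrow> 'm \<Rightarrow> (nat \<Rightarrow> 'm) \<Rightarrow> nat \<Rightarrow> 'm" where
  "act p x c = nf (c((if p then 2 * (LEAST n. supp_below n c) else Suc (2 * (LEAST n. supp_below n c))) := x))"

text \<open>With \<open>e\<close> at the lower place \<open>nf_merge\<close> moves an entry down by
  two. So \<open>act\<close> depends on the place where it writes only through the parity.\<close>

lemma nf_upd_parity:
  assumes "supp_below n c" "n \<le> k"
  shows "nf (c(k + 2 * j := x)) = nf (c(k := x))"
proof (induction j)
  case (Suc j)
  have "c(k + 2 * j := e) = c" using assms by (auto simp: supp_below_def fun_eq_iff)
  then have "nf (c(k + 2 * Suc j := x)) = nf (c(k + 2 * j := x))"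
    using nf_merge[OF assms(1), of "k + 2 * j" e x] assms(2) by (simp del: fun_upd_apply)
  then show ?case using Suc by (simp only:)
qed simp

lemma act_nf:
  assumes "supp_below n c" "n \<le> k"
  shows "act (even k) x c = nf (c(k := x))"
proof -
  let ?n = "LEAST n. supp_below n c"
  let ?k = "if even k then 2 * ?n else Suc (2 * ?n)"
  have sb: "supp_below ?n c" using assms(1) by (rule LeastI)
  have le: "?n \<le> k" using Least_le[of "\<lambda>n. supp_below n c", OF assms(1)] assms(2) by simp
  have parity: "\<exists>j. l = k + 2 * j" if "k \<le> l" "even k = even l" for k l :: nat
  proof -
    have "even (l - k)" using that by simp
    then obtain j where "l - k = 2 * j" by (rule evenE)
    then show ?thesis using that(1) by (intro exI[of _ j]) simp
  qed
  have ek: "even k = even ?k" by simp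
  have "nf (c(?k := x)) = nf (c(k := x))"
  proof (cases "k \<le> ?k")
    case True
    then obtain j where j: "?k = k + 2 * j" using parity[of k ?k] ek by auto
    show ?thesis unfolding j by (rule nf_upd_parity[OF assms])
  next
    case False
    then have "?k \<le> k" by simp
    then obtain j where j: "k = ?k + 2 * j" using parity[of ?k k] ek False by auto
    show ?thesis by (subst (2) j) (rule nf_upd_parity[OF sb, symmetric], simp)
  qed
  then show ?thesis by (simp add: act_def)
qed

lemma act_closed: "supp_below n c \<Longrightarrow> (\<exists>n. supp_below n (act p x c)) \<and> irred (act p x c)"
proof -
  assume c: "supp_below n c"
  define k where "k = (if p then 2 * n else Suc (2 * n))"
  have "act p x c = nf (c(k := x))" using act_nf[OF c, of k x] by (auto simp: k_def split: if_splits)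
  moreover have "supp_below (Suc k) (c(k := x))" using c by (rule supp_below_upd) (simp add: k_def)
  ultimately show ?thesis using nf supp_below_nf by metis
qed

lemma act_act:
  assumes "supp_below n c"
  shows "act p y (act p x c) = act p (if p then x \<odot> y else y \<odot> x) c"
proof -
  define k where "k = (if p then 2 * n else Suc (2 * n))"
  have k: "n \<le> k" "even k = p" by (auto simp: k_def)
  have b: "supp_below (Suc k) (c(k := x))" using assms k(1) by (rule supp_below_upd)
  have "act p y (act p x c) = act (even (Suc (Suc k))) y (nf (c(k := x)))"
    using act_nf[OF assms k(1), of x] k(2) by simp
  also have "\<dots> = nf ((nf (c(k := x)))(Suc (Suc k) := y))"
    by (rule act_nf[OF supp_below_nf[OF b]]) simp
  also have "\<dots> = nf (c(k := x, Suc (Suc k) := y))" by (rule nf_nf_upd[OF b]) simp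
  also have "\<dots> = nf (c(k := op (Suc k) x y))" by (rule nf_merge[OF assms k(1)])
  also have "\<dots> = act p (op (Suc k) x y) c" using act_nf[OF assms k(1)] k(2) by simp
  finally show ?thesis using k(2) by (auto simp: op_def)
qed

lemma act_one: "supp_below n c \<Longrightarrow> irred c \<Longrightarrow> act p e c = c"
proof -
  assume c: "supp_below n c" "irred c"
  define k where "k = (if p then 2 * n else Suc (2 * n))"
  have "c(k := e) = c" using c by (auto simp: supp_below_def k_def)
  then show ?thesis using act_nf[OF c(1), of k e] nf_irred[OF c] by (auto simp: k_def split: if_splits)
qed

lemma act_cancel:
  assumes "supp_below n c" "irred c"
  shows "act (\<not> p) x (act p x c) = c"
proof -
  define k where "k = (if p then 2 * n else Suc (2 * n))"
  have k: "n \<le> k" "even k = p" by (auto simp: k_def)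
  have b: "supp_below (Suc k) (c(k := x))" using assms(1) k(1) by (rule supp_below_upd)
  have "act (\<not> p) x (act p x c) = act (even (Suc k)) x (nf (c(k := x)))"
    using act_nf[OF assms(1) k(1), of x] k(2) by simp
  also have "\<dots> = nf ((nf (c(k := x)))(Suc k := x))"
    by (rule act_nf[OF supp_below_nf[OF b]]) simp
  also have "\<dots> = nf (c(k := x, Suc k := x))" by (rule nf_nf_upd[OF b]) simp
  also have "\<dots> = c" using nf_cancel[OF assms(1) k(1)] nf_irred[OF assms] by simp
  finally show ?thesis .
qed

text \<open>Normalizations in between may be postponed by \<open>nf_nf_upd\<close>, so acting with
  the entries of \<open>c\<close> in turn simply writes them down. Hence an irreducible
  \<open>c\<close> can be recovered from the action of its value.\<close>

lemma fold_act_irred: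
  assumes "irred c" "supp_below n c"
  shows "fold (\<lambda>k. act (even k) (c k)) [0..<n] (\<lambda>_. e) = c"
proof -
  let ?c = "\<lambda>j k. if k < j then c k else e"
  have "fold (\<lambda>k. act (even k) (c k)) [0..<j] (\<lambda>_. e) = nf (?c j)" for j
  proof (induction j)
    case 0
    have "supp_below 0 (\<lambda>_. e)" by (simp add: supp_below_def)
    moreover have "irred (\<lambda>_. e)"
      using step_level(1)[of _ _ "\<lambda>_. e" _ 0] by (auto simp: irred_def step_def supp_below_def)
    ultimately show ?case using nf_irred by simp
  next
    case (Suc j)
    have b: "supp_below j (?c j)" by (simp add: supp_below_def)
    have "act (even j) (c j) (nf (?c j)) = nf ((?c j)(j := c j))"
      using act_nf[OF supp_below_nf[OF b] order_refl] nf_nf_upd[OF b order_refl] by simp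
    moreover have "(?c j)(j := c j) = ?c (Suc j)" by (auto simp: fun_eq_iff less_Suc_eq)
    ultimately show ?case using Suc by simp
  qed
  moreover have "?c n = c" using assms(2) by (auto simp: supp_below_def fun_eq_iff)
  ultimately show ?thesis using nf_irred[OF assms(2,1)] by metis
qed

lemma irredI:
  assumes "\<And>i x r q y. x \<noteq> e \<Longrightarrow> a (Suc i) = op i x r \<Longrightarrow> op i x q = op i (a i) y \<Longrightarrow>
    (i = 0 \<Longrightarrow> y = e) \<Longrightarrow> False"
  shows "irred a"
  unfolding irred_def step_def
proof clarify
  fix b i x assume "x \<noteq> e" "red i x a b"
  then obtain r q y where "a (Suc i) = op i x r" "ljoin (op i) x (a i) q y" "i = 0 \<longrightarrow> y = e"
    unfolding red_def by blast
  then show False using assms[of x i r q y] \<open>x \<noteq> e\<close> by (auto simp: ljoin_def)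
qed

text \<open>Any common multiple of \<open>x\<close> and the entry \<open>i\<close> suffices, because
  the least one divides it; at level 0 triviality of \<open>y\<close> passes to the least
  cofactor.\<close>

lemma irredD:
  assumes "irred a" "a (Suc i) = op i x r" "op i x q = op i (a i) y" "i = 0 \<Longrightarrow> y = e"
  shows "x = e"
proof (rule ccontr)
  interpret O: half_ore "op i" e sz by (rule half_ore_op)
  assume x: "x \<noteq> e"
  obtain q' y' where j: "ljoin (op i) x (a i) q' y'" using O.ljoin_exists[OF assms(3)] by blast
  obtain k where "y = op i y' k" by (rule O.ljoin_factor[OF j assms(3)])
  then have "i = 0 \<Longrightarrow> y' = e" using assms(4) O.mult_eq_e by metis
  then have "red i x a (upd i a y' q' r)" using assms(2) j by (intro redI) auto
  then show False using assms(1) x by (auto simp: irred_def step_def)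
qed

end

lemma compat_eqI: "x * a = y * b \<Longrightarrow> compat x y"
  by (metis compatI dvd_left_mult)

lemma ore_monoid_artin: "ore_monoid (*) (1 :: 's::fc_coxeter artin) len"
proof -
  have join: "\<exists>c d. ljoin (*) x y c d" if "x * a = y * b" for x y a b :: "'s artin"
  proof -
    have "compat x y" using that by (rule compat_eqI)
    then obtain c d where cd: "is_join x y (x * c)" "x * c = y * d" by (rule compat_join)
    have "\<exists>k. a' = c * k \<and> b' = d * k" if "x * a' = y * b'" for a' b'
    proof -
      have "y dvd x * a'" unfolding that by simp
      then have "x * c dvd x * a'" by (rule is_joinD(3)[OF cd(1) dvd_left_mult])
      then have "c dvd a'" by simp
      then obtain k where k: "a' = c * k" unfolding dvd_def ..
      have "y * b' = y * (d * k)" using that cd(2) k by (metis mult.assoc)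
      then show ?thesis using k by auto
    qed
    then show ?thesis using cd(2) by (auto simp: ljoin_def)
  qed
  have ore: "\<exists>p q r. x * p = y * q \<and> x * p = z * r"
    if "x * a = y * b" "y * a' = z * b'" "x * a'' = z * b''"
    for x y z a b a' b' a'' b'' :: "'s artin"
  proof -
    have "compat x y" "compat y z" "compat x z"
      using that compat_eqI by blast+
    then obtain u where "x dvd u" "y dvd u" "z dvd u" using three_ore by metis
    then show ?thesis by (auto simp: dvd_def)
  qed
  have fl: "flip x * flip a = flip y * flip b \<longleftrightarrow> a * x = b * y" for x y a b :: "'s artin"
    by (metis flip_simps(2,4))
  show ?thesis
  proof (rule ore_monoid.intro)
    show "half_ore (*) (1 :: 's artin) len"
      by unfold_locales (use join ore in \<open>auto simp: mult.assoc\<close>)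
    show "half_ore (\<lambda>x y. y * x) (1 :: 's artin) len"
    proof (unfold_locales, goal_cases)
      case (7 x a y b)
      then have "flip x * flip a = flip y * flip b" by (simp add: fl)
      then obtain c d where cd: "ljoin (*) (flip x) (flip y) c d" using join by blast
      have "ljoin (\<lambda>x y. y * x) x y (flip c) (flip d)"
        unfolding ljoin_def
      proof (intro conjI allI impI)
        show "flip c * x = flip d * y" using cd fl[of x "flip c" y "flip d"] by (simp add: ljoin_def)
        fix a' b' assume "a' * x = b' * y"
        then have "flip x * flip a' = flip y * flip b'" by (simp add: fl)
        then obtain k where "flip a' = c * k" "flip b' = d * k" using cd by (auto simp: ljoin_def)
        then show "\<exists>k. a' = k * flip c \<and> b' = k * flip d"
          by (intro exI[of _ "flip k"]) (metis flip_simps(2,4))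
      qed
      then show ?case by blast
    next
      case (8 x a y b a' z b' a'' b'')
      then have "flip x * flip a = flip y * flip b" "flip y * flip a' = flip z * flip b'"
        "flip x * flip a'' = flip z * flip b''"
        by (simp_all add: fl)
      from ore[OF this] obtain p q r where "flip x * p = flip y * q" "flip x * p = flip z * r" by blast
      then have "flip p * x = flip q * y" "flip p * x = flip r * z"
        by (metis flip_simps(2,4))+
      then show ?case by blast
    qed (auto simp: mult.assoc)
  qed
qed

section \<open>LCM-homomorphisms between Artin monoids\<close>

definition extend :: "('s::coxeter \<Rightarrow> 'm::monoid_mult) \<Rightarrow> 's artin \<Rightarrow> 'm" where
  "extend h x = prod_list (map h (SOME w. el w = x))"

lemma prod_list_alternating: "prod_list (map h (alternating n s t)) = altp n (h s) (h t)"
  by (induction n arbitrary: s t) auto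

lemma extend_el:
  assumes "\<And>s t n. s \<noteq> t \<Longrightarrow> cm s t = enat n \<Longrightarrow> altp n (h s) (h t) = altp n (h t) (h s)"
  shows "extend h (el w) = prod_list (map h w)"
proof -
  have *: "prod_list (map h u) = prod_list (map h v)" if "braid u v" for u v
    using that
  proof (induction rule: braid.induct)
    case (braid_swap s t n u v)
    then show ?case using assms[OF braid_swap] by (simp add: prod_list_alternating)
  qed auto
  have "el (SOME v. el v = el w) = el w" by (rule someI[of _ w]) simp
  then have "braid (SOME v. el v = el w) w" by (simp only: el_eq_iff)
  then show ?thesis unfolding extend_def by (rule *)
qed

lemma max_altp_prefix:
  obtains k c where "a = altp k (atom s) (atom t) * c" "\<not> altp (Suc k) (atom s) (atom t) dvd a"
    "\<And>j. altp j (atom s) (atom t) dvd a \<Longrightarrow> j \<le> k"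
proof -
  have "j \<le> len a" if "altp j (atom s) (atom t) dvd a" for j using dvd_len[OF that] by simp
  moreover have "altp 0 (atom s) (atom t) dvd a" by simp
  ultimately obtain k where k: "altp k (atom s) (atom t) dvd a"
    "\<And>j. altp j (atom s) (atom t) dvd a \<Longrightarrow> j \<le> k"
    using Nat.ex_has_greatest_nat[of "\<lambda>j. altp j (atom s) (atom t) dvd a" 0 "len a"] by blast
  obtain c where c: "a = altp k (atom s) (atom t) * c" using k(1) unfolding dvd_def ..
  have "\<not> altp (Suc k) (atom s) (atom t) dvd a" using k(2) by fastforce
  then show thesis using that[OF c] k(2) by blast
qed

lemma altp_dvd_mono: "k \<le> n \<Longrightarrow> altp k x y dvd altp n x (y :: 's::coxeter artin)"
  using altp_add[of k "n - k" x y] by simp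

text \<open>\<open>A\<close> is one system among all letters of the type, and
  \<open>isolated\<close> separates it from the others. \<open>P_infinite\<close> is what
  non-sphericity of \<open>{u} \<union> P t\<close> becomes under type FC: some label in it is
  infinite, and this label cannot lie inside the bounded set \<open>P t\<close>.\<close>

locale lcm_map =
  fixes A :: "'s::fc_coxeter set" and P :: "'s \<Rightarrow> 't::fc_coxeter set"
  assumes isolated: "s \<in> A \<Longrightarrow> t \<notin> A \<Longrightarrow> cm s t = \<infinity>"
    and P_bounded: "s \<in> A \<Longrightarrow> bounded (P s)" and P_ne: "s \<in> A \<Longrightarrow> P s \<noteq> {}"
    and P_disjoint: "s \<in> A \<Longrightarrow> t \<in> A \<Longrightarrow> s \<noteq> t \<Longrightarrow> P s \<inter> P t = {}"
    and P_finite: "s \<in> A \<Longrightarrow> t \<in> A \<Longrightarrow> s \<noteq> t \<Longrightarrow> cm s t = enat n \<Longrightarrow>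
      altp n (garside (P s)) (garside (P t)) = altp n (garside (P t)) (garside (P s)) \<and>
      is_join (garside (P s)) (garside (P t)) (altp n (garside (P t)) (garside (P s)))"
    and P_infinite: "s \<in> A \<Longrightarrow> t \<in> A \<Longrightarrow> s \<noteq> t \<Longrightarrow> cm s t = \<infinity> \<Longrightarrow> u \<in> P s \<Longrightarrow>
      \<exists>v\<in>P t. cm u v = \<infinity>"
begin

text \<open>The value 1 outside \<open>A\<close> respects the relations: letters inside and outside
  \<open>A\<close> are joined by \<infinity>, so no relation mixes them.\<close>

definition D :: "'s \<Rightarrow> 't artin" where
  "D s = (if s \<in> A then garside (P s) else 1)"

definition \<Phi> :: "'s artin \<Rightarrow> 't artin" where
  "\<Phi> = extend D"

lemma D_relation: "s \<noteq> t \<Longrightarrow> cm s t = enat n \<Longrightarrow> altp n (D s) (D t) = altp n (D t) (D s)"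
proof (cases "s \<in> A"; cases "t \<in> A")
  assume "s \<notin> A" "t \<notin> A"
  then show ?thesis by (simp add: D_def)
qed (use P_finite isolated cm_sym[of s t] in \<open>auto simp: D_def\<close>)

lemma Phi_el: "\<Phi> (el w) = prod_list (map D w)"
  unfolding \<Phi>_def by (rule extend_el[OF D_relation])

lemma Phi_one [simp]: "\<Phi> 1 = 1"
  using Phi_el[of "[]"] by simp

lemma Phi_mult [simp]: "\<Phi> (x * y) = \<Phi> x * \<Phi> y"
proof -
  obtain u v where "x = el u" "y = el v" using el_surj by metis
  then show ?thesis using Phi_el[of "u @ v"] Phi_el[of u] Phi_el[of v] by simp
qed

lemma Phi_atom: "s \<in> A \<Longrightarrow> \<Phi> (atom s) = garside (P s)"
  using Phi_el[of "[s]"] by (simp add: D_def)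

lemma Phi_altp: "\<Phi> (altp n x y) = altp n (\<Phi> x) (\<Phi> y)"
  by (induction n arbitrary: x y) auto

lemma Phi_power: "\<Phi> (x ^ n) = \<Phi> x ^ n"
  by (induction n) auto

lemma Phi_dvd: "x dvd y \<Longrightarrow> \<Phi> x dvd \<Phi> y"
  by (auto simp: dvd_def)

lemma Phi_flip: "\<Phi> (flip x) = flip (\<Phi> x)"
proof (induction x rule: atom_induct)
  case (atom s x)
  have "flip (\<Phi> (atom s)) = \<Phi> (atom s)"
    using Phi_el[of "[s]"] flip_garside[OF P_bounded] by (simp add: D_def)
  then show ?case using atom by simp
qed simp

lemma supp_Phi: "supp x \<subseteq> A \<Longrightarrow> supp (\<Phi> x) = \<Union> (P ` supp x)"
  by (induction x rule: atom_induct) (auto simp: Phi_atom garside(3)[OF P_bounded])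

lemma Phi_eq_one: "supp x \<subseteq> A \<Longrightarrow> \<Phi> x = 1 \<Longrightarrow> x = 1"
proof (cases x rule: atom_cases)
  case (2 s y)
  assume "supp x \<subseteq> A" "\<Phi> x = 1"
  then have "s \<in> A" "supp (garside (P s)) = {}" using 2 by (auto simp: Phi_atom)
  then show ?thesis using garside(3)[OF P_bounded] P_ne by auto
qed

text \<open>The label is finite, so the two Garside elements are compatible, their letters together
  form a clique, and their join divides the simple element
  \<open>garside (P s \<union> P t)\<close>.\<close>

lemma altp_D:
  assumes "s \<in> A" "t \<in> A" "s \<noteq> t" "cm s t = enat n"
  defines "L \<equiv> altp n (garside (P s)) (garside (P t))"
  shows "simple L" "supp L \<subseteq> P s \<union> P t" "garside (P s) dvd L" "garside (P t) dvd L"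
    "altp n (garside (P t)) (garside (P s)) = L"
proof -
  have L: "is_join (garside (P s)) (garside (P t)) L" "altp n (garside (P t)) (garside (P s)) = L"
    using P_finite[OF assms(1-4)] by (auto simp: L_def)
  note sg = garside(3)[OF P_bounded[OF assms(1)]] garside(3)[OF P_bounded[OF assms(2)]]
  have "clique (P s \<union> P t)"
    using clique_Un_compat[of "garside (P s)" "garside (P t)"] compatI[OF is_joinD(1,2)[OF L(1)]]
      bounded_clique[OF P_bounded] assms(1,2) by (simp add: sg)
  then have B: "bounded (P s \<union> P t)"
    using P_bounded assms(1,2) by (intro clique_bounded) (auto simp: bounded_def)
  have "garside (P s) dvd garside (P s \<union> P t)" "garside (P t) dvd garside (P s \<union> P t)"
    using garside(1)[OF B] by (auto intro!: garside(2)[OF P_bounded] assms(1,2))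
  then have "L dvd garside (P s \<union> P t)" by (rule is_joinD(3)[OF L(1)])
  then show "simple L" "supp L \<subseteq> P s \<union> P t"
    using simple_dvd garside(4)[OF B] dvd_supp garside(3)[OF B] by blast+
  show "garside (P s) dvd L" "garside (P t) dvd L"
    "altp n (garside (P t)) (garside (P s)) = L"
    using is_joinD(1,2)[OF L(1)] L(2) by auto
qed

text \<open>Otherwise multiplication by \<open>garside (P t)\<close> on the left would make
  \<open>garside (P t) * atom u\<close> a divisor of the full alternating product, which is simple;
  \<open>garside_mult_atom_not_simple\<close> forbids this.\<close>

lemma not_dvd_altp_D:
  assumes "s \<in> A" "t \<in> A" "s \<noteq> t" "cm s t = enat n" "u \<in> P t" "k < n"
  shows "\<not> atom u dvd altp k (garside (P s)) (garside (P t))"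
proof
  let ?X = "garside (P s)" and ?Y = "garside (P t)"
  assume "atom u dvd altp k ?X ?Y"
  then have "atom u dvd altp (n - 1) ?X ?Y"
    using assms(6) by (intro dvd_left_trans[OF _ altp_dvd_mono[of k "n - 1" ?X ?Y]]) auto
  then have d: "?Y * atom u dvd ?Y * altp (n - 1) ?X ?Y" by simp
  have "?Y * altp (n - 1) ?X ?Y = altp n ?Y ?X" using assms(6) by (cases n) auto
  then have "?Y * altp (n - 1) ?X ?Y = altp n ?X ?Y" by (simp only: altp_D(5)[OF assms(1-4)])
  with d have "?Y * atom u dvd altp n ?X ?Y" by (simp only:)
  then show False
    using garside_mult_atom_not_simple[OF P_bounded[OF assms(2)] assms(5)] altp_D(1)[OF assms(1-4)] by blast
qed

text \<open>With a = t a' and \<open>u\<close> outside \<open>P t\<close>, the complement of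
  \<open>u\<close> after \<open>garside (P t)\<close> starts with \<open>u\<close>, so by induction
  some \<open>t'\<close> with \<open>u \<in> P t'\<close> divides \<open>a'\<close>. To bring
  \<open>t'\<close> to the front of \<open>a\<close>, the longest alternating prefix in
  \<open>t\<close> and \<open>t'\<close> is shown to have at least the length \<open>n\<close> of
  the braid relation.\<close>

lemma atom_dvd_Phi:
  assumes "supp a \<subseteq> A" "atom u dvd \<Phi> a"
  shows "\<exists>t\<in>A. u \<in> P t \<and> atom t dvd a"
  using assms
proof (induction "len a" arbitrary: a u rule: less_induct)
  case less
  show ?case
  proof (cases a rule: atom_cases)
    case 1
    then show ?thesis using less.prems atom_dvd_supp by force
  next
    case (2 t a')
    then have t: "t \<in> A" and a': "supp a' \<subseteq> A" using less.prems by auto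
    have Ta: "\<Phi> a = garside (P t) * \<Phi> a'" using 2 t by (simp add: Phi_atom)
    show ?thesis
    proof (cases "u \<in> P t")
      case True
      then show ?thesis using 2 t by auto
    next
      case False
      note st = garside(3)[OF P_bounded[OF t]]
      have co: "compat (atom u) (garside (P t))"
        using less.prems(2) Ta by (intro compatI[of _ "\<Phi> a"]) auto
      then have K: "clique (insert u (P t))"
        using clique_insert_compat[of "garside (P t)" u] bounded_clique[OF P_bounded[OF t]] by (simp add: st)
      then have B: "bounded (insert u (P t))"
        using P_bounded[OF t] by (intro clique_bounded) (auto simp: bounded_def)
      obtain r where r: "is_join (garside (P t)) (atom u) (garside (P t) * r)"
        "supp (garside (P t) * r) \<subseteq> supp (garside (P t)) \<union> supp (atom u)"
        using compat_join[OF compat_sym[OF co]] by metis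
      have "garside (P t) * r dvd garside (insert u (P t))"
        using garside(1)[OF B] by (intro is_joinD(3)[OF r(1)] garside(2)[OF P_bounded[OF t]]) auto
      then have sim: "simple (garside (P t) * r)" using simple_dvd garside(4)[OF B] by blast
      have "r \<noteq> 1" using is_joinD(2)[OF r(1)] atom_dvd_supp False st by fastforce
      then obtain v r' where v: "r = atom v * r'" by (cases r rule: atom_cases) auto
      \<comment> \<open>Since \<open>garside (P t) * r\<close> is simple, \<open>r\<close> cannot
        start with a letter of \<open>P t\<close>; only \<open>u\<close> is left.\<close>
      have "v \<notin> P t"
        using garside_mult_atom_not_simple[OF P_bounded[OF t], of v "garside (P t) * r"] sim v by auto
      then have "v = u" using r(2) v st by auto
      then have "atom u dvd \<Phi> a'"
        using dvd_mult_iff[OF r(1), of "\<Phi> a'"] less.prems(2) Ta v dvd_left_multD by metis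
      moreover have "len a' < len a" using 2 by simp
      ultimately obtain t' where t': "t' \<in> A" "u \<in> P t'" "atom t' dvd a'"
        using less.hyps a' by blast
      have ne: "t \<noteq> t'" using t'(2) False by auto
      have "cm t t' \<noteq> \<infinity>"
      proof
        assume "cm t t' = \<infinity>"
        then obtain v where "v \<in> P t" "cm u v = \<infinity>"
          using P_infinite[OF t'(1) t _ _ t'(2)] ne cm_sym[of t t'] by auto
        then show False using K unfolding clique_def by blast
      qed
      then obtain n where n: "cm t t' = enat n" by auto
      obtain k c where k: "a = altp k (atom t) (atom t') * c" "\<not> altp (Suc k) (atom t) (atom t') dvd a"
        "\<And>j. altp j (atom t) (atom t') dvd a \<Longrightarrow> j \<le> k"
        by (rule max_altp_prefix[of a t t']) blast
      have k1: "1 \<le> k" using 2 by (intro k(3)) simp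
      show ?thesis
      proof (cases "n \<le> k")
        case True
        then have "altp n (atom t) (atom t') dvd a"
          using altp_dvd_mono[OF True, of "atom t" "atom t'"] dvd_left_trans k(1) dvd_left_mult by metis
        moreover have "atom t' dvd altp n (atom t) (atom t')"
          using is_joinD(2)[OF is_join_atoms[OF ne n]] .
        ultimately show ?thesis using dvd_left_trans t'(1,2) by blast
      next
        case False
        then have kn: "k < n" by simp
        \<comment> \<open>\<open>z\<close> is the letter that would prolong the prefix,
          \<open>y\<close> the one that ends it. The aim is that \<open>z\<close> divides
          \<open>c\<close>, against the choice of \<open>k\<close>.\<close>
        define z where "z = nxt k t t'"
        define y where "y = nxt k t' t"
        let ?Q = "altp k (garside (P t)) (garside (P t'))"
        let ?R = "altp (n - k) (garside (P z)) (garside (P y))"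
        let ?L = "altp n (garside (P t)) (garside (P t'))"
        have zy: "z \<in> A" "y \<in> A" "z \<noteq> y" "cm z y = enat n" "P t \<union> P t' = P z \<union> P y"
          using t t'(1) ne n by (auto simp: z_def y_def nxt_def cm_sym)
        have L: "?L = ?Q * ?R"
          using altp_add[of k "n - k" "garside (P t)" "garside (P t')"] kn by (simp add: z_def y_def nxt_def)
        have fa: "\<Phi> a = ?Q * \<Phi> c" using k(1) t t'(1) by (simp add: Phi_altp Phi_atom)
        have c: "supp c \<subseteq> A" "len c < len a"
          using less.prems(1) k1 arg_cong[OF k(1), of supp] arg_cong[OF k(1), of len] by auto
        have uL: "atom u dvd ?L"
          using dvd_left_trans[OF garside(1)[OF P_bounded[OF t'(1)] t'(2)] altp_D(4)[OF t t'(1) ne n]] .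
        have "?Q dvd ?L" unfolding L by simp
        then obtain q where q: "is_join ?Q (atom u) (?Q * q)"
          using compat_join[OF compatI[OF _ uL]] by metis
        have "q \<noteq> 1"
          using is_joinD(2)[OF q] not_dvd_altp_D[OF t t'(1) ne n t'(2) kn] by auto
        then obtain v q' where v: "q = atom v * q'" by (cases q rule: atom_cases) auto
        have "q dvd ?R" using is_joinD(3)[OF q \<open>?Q dvd ?L\<close> uL] unfolding L by simp
        then have vR: "atom v dvd ?R" using v dvd_left_multD by blast
        then have "v \<in> supp ?L" unfolding L using atom_dvd_supp by fastforce
        then have "v \<in> P z \<union> P y" using altp_D(2)[OF t t'(1) ne n] zy(5) by blast
        \<comment> \<open>The rest \<open>?R\<close> has fewer than \<open>n\<close> factors, so no
          letter of \<open>P y\<close> divides it; the first letter \<open>v\<close> of the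
          complement thus lies in \<open>P z\<close>.\<close>
        moreover have "v \<notin> P y" using not_dvd_altp_D[OF zy(1-4), of v "n - k"] vR k1 kn by auto
        ultimately have vz: "v \<in> P z" by blast
        have "atom u dvd ?Q * \<Phi> c" using less.prems(2) fa by simp
        then have "q dvd \<Phi> c" using dvd_mult_iff[OF q] by simp
        then have "atom v dvd \<Phi> c" using v dvd_left_multD by blast
        then obtain w where w: "w \<in> A" "v \<in> P w" "atom w dvd c"
          using less.hyps[OF c(2,1)] by blast
        then have "w = z" using P_disjoint[OF w(1) zy(1)] vz by auto
        then have "altp k (atom t) (atom t') * atom z dvd a" using w(3) k(1) by simp
        then have "altp (Suc k) (atom t) (atom t') dvd a"
          using altp_add[of k 1 "atom t" "atom t'"] by (simp add: z_def nxt_def split: if_splits)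
        then show ?thesis using k(2) by blast
      qed
    qed
  qed
qed

text \<open>
  Here \<open>e\<close> is the least element with \<open>r dvd \<Phi> e\<close>. Multiplying by a letter on the left, this
  relation between \<open>r\<close> and \<open>e\<close> passes to their complements, which allows an induction on \<open>a\<close>.
\<close>

lemma compat_Phi:
  assumes "clique (supp r)" "clique (supp e)" "supp e \<subseteq> A"
    and "\<And>f. supp f \<subseteq> A \<Longrightarrow> r dvd \<Phi> f \<longleftrightarrow> e dvd f"
    and "supp a \<subseteq> A" "compat r (\<Phi> a)"
  shows "compat e a"
  using assms
proof (induction a arbitrary: r e rule: atom_induct)
  case one
  show ?case by (rule compatI[of e e]) auto
next
  case (atom t a)
  have t: "t \<in> A" and a: "supp a \<subseteq> A" using atom.prems by auto
  note eq = atom.prems(4)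
  have fa: "\<Phi> (atom t * a) = garside (P t) * \<Phi> a" using t by (simp add: Phi_atom)
  note st = garside(3)[OF P_bounded[OF t]]
  have co: "compat r (garside (P t))"
    using atom.prems(6) compat_multD compat_sym unfolding fa by metis
  then have K: "clique (supp r \<union> P t)"
    using clique_Un_compat[OF atom.prems(1), of "garside (P t)"] bounded_clique[OF P_bounded[OF t]]
    by (simp add: st)
  \<comment> \<open>The letters of \<open>e\<close> whose images meet the support of
    \<open>r\<close>. As \<open>r\<close> divides a power of \<open>?g\<close>, the element
    \<open>e\<close> divides a power of \<open>garside E\<close>, so in fact all letters of
    \<open>e\<close> are in \<open>E\<close>.\<close>
  define E where "E = {w \<in> supp e. P w \<inter> supp r \<noteq> {}}"
  have EA: "E \<subseteq> A" "E \<subseteq> supp e" using atom.prems(3) by (auto simp: E_def)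
  have BE: "bounded E"
    using clique_subset[OF atom.prems(2) EA(2)] finite_subset[OF EA(2)] by (intro clique_bounded) auto
  let ?J = "\<Union> (P ` E)" and ?g = "\<Phi> (garside E)"
  have sg: "supp ?g = ?J" using supp_Phi[of "garside E"] garside(3)[OF BE] EA(1) by simp
  have ug: "atom u dvd ?g" if u: "u \<in> ?J" for u
  proof -
    obtain w where w: "w \<in> E" "u \<in> P w" using u by blast
    then have wA: "w \<in> A" using EA by blast
    have "atom u dvd \<Phi> (atom w)" using garside(1)[OF P_bounded[OF wA] w(2)] wA by (simp add: Phi_atom)
    also have "\<Phi> (atom w) dvd ?g" using garside(1)[OF BE w(1)] by (rule Phi_dvd)
    finally show ?thesis .
  qed
  have "finite ?J" using BE EA(1) P_bounded by (auto simp: bounded_def)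
  then have BJ: "bounded ?J" using ug by (auto simp: bounded_def)
  have "r dvd \<Phi> e" using eq[OF atom.prems(3)] by simp
  then have "supp r \<subseteq> \<Union> (P ` supp e)" using dvd_supp supp_Phi[OF atom.prems(3)] by blast
  then have rJ: "supp r \<subseteq> ?J" unfolding E_def by blast
  have "r dvd ?g ^ len r"
    using dvd_power_of_multiple[OF BJ _ garside(2)[OF BJ ug] rJ] sg by simp
  then have "r dvd \<Phi> (garside E ^ len r)" by (simp add: Phi_power)
  moreover have sp: "supp (garside E ^ k) \<subseteq> E" for k
    by (induction k) (auto simp: garside(3)[OF BE])
  ultimately have "e dvd garside E ^ len r" using eq EA(1) by blast
  then have eE: "supp e \<subseteq> E" using dvd_supp sp by blast
  \<comment> \<open>By \<open>P_infinite\<close>, an infinite label between \<open>w\<close> and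
    \<open>t\<close> would produce one between a letter \<open>u\<close> of \<open>r\<close> in
    \<open>P w\<close> and a letter of \<open>P t\<close>, inside the clique
    \<open>supp r \<union> P t\<close>.\<close>
  have fin: "cm w t \<noteq> \<infinity>" if w: "w \<in> supp e" for w
  proof (cases "w = t")
    case False
    obtain u where u: "u \<in> P w" "u \<in> supp r" using w eE by (auto simp: E_def)
    show ?thesis
    proof
      assume "cm w t = \<infinity>"
      then obtain v where "v \<in> P t" "cm u v = \<infinity>"
        using P_infinite[of w t u] w atom.prems(3) t False u(1) by blast
      then show False using K u(2) unfolding clique_def by blast
    qed
  qed (simp add: one_enat_def)
  have Ke: "clique (supp e \<union> {t})"
    unfolding clique_Un using atom.prems(2) fin by simp
  then have "bounded (supp e \<union> {t})" by (intro clique_bounded) auto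
  then have "compat (atom t) e" by (rule compat_bounded) auto
  then obtain e1 where e1: "is_join (atom t) e (atom t * e1)" "supp (atom t * e1) \<subseteq> supp (atom t) \<union> supp e"
    using compat_join by metis
  obtain r1 where r1: "is_join (garside (P t)) r (garside (P t) * r1)"
    "supp (garside (P t) * r1) \<subseteq> supp (garside (P t)) \<union> supp r"
    using compat_join[OF compat_sym[OF co]] by metis
  have "compat e1 a"
  proof (rule atom.IH[of r1 e1])
    show "clique (supp r1)" using clique_subset[OF K] r1(2) st by auto
    show "clique (supp e1)" using clique_subset[OF Ke] e1(2) by auto
    show "supp e1 \<subseteq> A" using e1(2) atom.prems(3) t by auto
    show "compat r1 (\<Phi> a)" using compat_mult_iff[OF r1(1)] atom.prems(6) unfolding fa by blast
    show "r1 dvd \<Phi> f \<longleftrightarrow> e1 dvd f" if "supp f \<subseteq> A" for f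
    proof -
      have "r1 dvd \<Phi> f \<longleftrightarrow> r dvd \<Phi> (atom t * f)"
        using dvd_mult_iff[OF r1(1), of "\<Phi> f"] t by (simp add: Phi_atom)
      also have "\<dots> \<longleftrightarrow> e dvd atom t * f" using eq[of "atom t * f"] that t by simp
      also have "\<dots> \<longleftrightarrow> e1 dvd f" using dvd_mult_iff[OF e1(1)] .
      finally show ?thesis .
    qed
  qed (rule a)
  then show ?case using compat_mult_iff[OF e1(1)] by blast
qed

lemma compat_atom_Phi:
  assumes "t \<in> A" "u \<in> P t" "supp a \<subseteq> A" "compat (atom u) (\<Phi> a)"
  shows "compat (atom t) a"
proof (rule compat_Phi[of "atom u" "atom t"])
  fix f assume f: "supp f \<subseteq> A"
  show "atom u dvd \<Phi> f \<longleftrightarrow> atom t dvd f"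
  proof
    assume "atom u dvd \<Phi> f"
    then obtain w where w: "w \<in> A" "u \<in> P w" "atom w dvd f" using atom_dvd_Phi[OF f] by blast
    then show "atom t dvd f" using P_disjoint[OF w(1) assms(1)] assms(2) by auto
  next
    assume "atom t dvd f"
    then have "garside (P t) dvd \<Phi> f" using Phi_dvd[of "atom t" f] assms(1) by (simp add: Phi_atom)
    then show "atom u dvd \<Phi> f" using garside(1)[OF P_bounded[OF assms(1)] assms(2)] dvd_left_trans by blast
  qed
qed (use assms in auto)

end

interpretation art: ore_monoid "(*)" "1 :: 's::fc_coxeter artin" len
  by (rule ore_monoid_artin)

context lcm_map
begin

lemma compat_mult_eq: "compat (atom t) a \<Longrightarrow> \<exists>q y. atom t * q = a * y"
  by (metis compat_def dvdE)

text \<open>A reduction of the image by \<open>x\<close> yields one by a single letter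
  \<open>u\<close>, the first letter of \<open>x\<close> at odd levels and the last one at even
  levels, where \<open>flip\<close> restores left divisibility. By the reflection lemmas the letter
  \<open>t\<close> with \<open>u \<in> P t\<close> then reduces \<open>a\<close> at the same
  level.\<close>

lemma irred_Phi:
  assumes A: "\<And>i. supp (a i) \<subseteq> A" and irr: "art.irred a"
  shows "art.irred (\<lambda>i. \<Phi> (a i))"
proof (rule art.irredI)
  fix i x r q y
  assume x: "x \<noteq> 1" "\<Phi> (a (Suc i)) = art.op i x r" "art.op i x q = art.op i (\<Phi> (a i)) y"
    and i0: "i = 0 \<Longrightarrow> y = 1"
  show False
  proof (cases "odd i")
    case True
    obtain u x' where u: "x = atom u * x'" using x(1) by (cases x rule: atom_cases) auto
    have "atom u dvd \<Phi> (a (Suc i))" using x(2) True u by (simp add: art.op_def mult.assoc)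
    then obtain t where t: "t \<in> A" "u \<in> P t" "atom t dvd a (Suc i)" using atom_dvd_Phi[OF A] by blast
    have "atom u * (x' * q) = \<Phi> (a i) * y" using x(3) True u by (simp add: art.op_def mult.assoc)
    then have "compat (atom u) (\<Phi> (a i))" by (rule compat_eqI)
    then have "compat (atom t) (a i)" by (rule compat_atom_Phi[OF t(1,2) A])
    then obtain q' y' where qy: "atom t * q' = a i * y'" using compat_mult_eq by blast
    obtain r' where r': "a (Suc i) = atom t * r'" using t(3) unfolding dvd_def ..
    have "atom t = 1"
      by (rule art.irredD[OF irr, of i _ r' q' y']) (use True r' qy in \<open>auto simp: art.op_def\<close>)
    then show False by simp
  next
    case False
    have "flip x \<noteq> 1" using x(1) by (metis flip_simps(1,4))
    then obtain u x' where u': "flip x = atom u * x'" by (cases "flip x" rule: atom_cases) auto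
    have "\<Phi> (flip (a (Suc i))) = flip x * flip r" using x(2) False by (simp add: art.op_def Phi_flip)
    then have "atom u dvd \<Phi> (flip (a (Suc i)))" by (simp add: u' mult.assoc)
    then obtain t where t: "t \<in> A" "u \<in> P t" "atom t dvd flip (a (Suc i))"
      using atom_dvd_Phi[of "flip (a (Suc i))" u] A[of "Suc i"] by auto
    have e: "atom u * (x' * flip q) = \<Phi> (flip (a i)) * flip y"
    proof -
      have "flip (q * x) = flip (y * \<Phi> (a i))" using x(3) False by (simp add: art.op_def)
      then show ?thesis by (simp add: u' Phi_flip mult.assoc)
    qed
    have "\<exists>q' y'. atom t * q' = flip (a i) * y' \<and> (i = 0 \<longrightarrow> y' = 1)"
    proof (cases "i = 0")
      \<comment> \<open>At level 0 compatibility is not enough: \<open>u\<close> divides the image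
        of the entry itself, and disjointness of the sets \<open>P\<close> identifies the letter
        found there with \<open>t\<close>.\<close>
      case True
      then have "atom u dvd \<Phi> (flip (a i))" using e i0[OF True] by (metis dvd_left_mult flip_simps(1) mult_1_right)
      then obtain t' where t': "t' \<in> A" "u \<in> P t'" "atom t' dvd flip (a i)"
        using atom_dvd_Phi[of "flip (a i)" u] A[of i] by auto
      then have "t' = t" using P_disjoint[OF t'(1) t(1)] t(2) by auto
      then obtain q' where "flip (a i) = atom t * q'" using t'(3) by (auto simp: dvd_def)
      then show ?thesis by (intro exI[of _ q'] exI[of _ 1]) simp
    next
      case False
      have "compat (atom u) (\<Phi> (flip (a i)))" using e by (rule compat_eqI)
      then have "compat (atom t) (flip (a i))" using compat_atom_Phi[OF t(1,2), of "flip (a i)"] A by simp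
      then show ?thesis using compat_mult_eq False by blast
    qed
    then obtain q' y' where qy: "atom t * q' = flip (a i) * y'" "i = 0 \<longrightarrow> y' = 1" by blast
    obtain r' where r': "flip (a (Suc i)) = atom t * r'" using t(3) unfolding dvd_def ..
    have "atom t = 1"
    proof (rule art.irredD[OF irr, of i _ "flip r'" "flip q'" "flip y'"])
      show "a (Suc i) = art.op i (atom t) (flip r')"
        using False arg_cong[OF r', of flip] by (simp add: art.op_def)
      show "art.op i (atom t) (flip q') = art.op i (a i) (flip y')"
        using False arg_cong[OF qy(1), of flip] by (simp add: art.op_def)
      show "i = 0 \<Longrightarrow> flip y' = 1" using qy(2) by simp
    qed
    then show False by simp
  qed
qed

end

section \<open>All Artin-Tits systems of type FC at once\<close>

text \<open>
  A letter carries the system it belongs to, and letters of different systems (or of a system that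
  is not of type FC) are joined by \<open>\<infinity>\<close>. In this way a single type of class \<open>fc_coxeter\<close> contains
  every Artin-Tits system of type FC with generators in \<open>'a\<close>.
\<close>

datatype 'a gen = Gen (label: 'a) "'a set" "'a \<Rightarrow> 'a \<Rightarrow> enat"

definition fc_system :: "'a set \<Rightarrow> ('a \<Rightarrow> 'a \<Rightarrow> enat) \<Rightarrow> bool" where
  "fc_system S m \<longleftrightarrow> coxeter_matrix S m \<and> type_FC S m"

instantiation gen :: (type) coxeter
begin

fun cm_gen :: "'a gen \<Rightarrow> 'a gen \<Rightarrow> enat" where
  "cm_gen (Gen s S m) (Gen t S' m') =
    (if Gen s S m = Gen t S' m' then 1
     else if S = S' \<and> m = m' \<and> fc_system S m \<and> s \<in> S \<and> t \<in> S then m s t else \<infinity>)"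

instance
proof
  fix g h :: "'a gen"
  show "cm g g = 1" by (cases g) simp
  show "cm g h = cm h g" by (cases g; cases h) (auto simp: fc_system_def coxeter_matrix_def)
  assume "g \<noteq> h"
  have "2 \<le> x" if "x \<noteq> 0" "x \<noteq> 1" for x :: enat
    using that by (cases x) (auto simp: numeral_eq_enat zero_enat_def one_enat_def)
  then show "2 \<le> cm g h" using \<open>g \<noteq> h\<close>
    by (cases g; cases h) (auto simp: fc_system_def coxeter_matrix_def)
qed

end

lemma cm_Gen:
  assumes "fc_system S m" "s \<in> S" "t \<in> S"
  shows "cm (Gen s S m) (Gen t S m) = m s t"
  using assms by (auto simp: fc_system_def coxeter_matrix_def)

lemma map_alternating: "map h (alternating n s t) = alternating n (h s) (h t)"
  by (induction n arbitrary: s t) auto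

text \<open>The game represents the Coxeter group: squares and braid relations act trivially, and a
  letter and its formal inverse act alike because \<open>fire\<close> is an involution. So the
  positions lie in an image of the finite carrier.\<close>

lemma spherical_finite_positions:
  assumes fc: "fc_system S m" and T: "T \<subseteq> S" "spherical T m"
  shows "finite (pos ` lists ((\<lambda>s. Gen s S m) ` T))"
proof -
  let ?J = "\<lambda>s. Gen s S m" and ?R = "coxeter_relators T m"
  have play: "play (map (\<lambda>l. ?J (fst l)) v) f = play (map (\<lambda>l. ?J (fst l)) w) f"
    if "(v, w) \<in> word_cong T ?R" for v w f
    using that
  proof (induction arbitrary: f rule: word_cong.induct)
    case (rel u v l r)
    have "play (map (\<lambda>l. ?J (fst l)) l) f = play (map (\<lambda>l. ?J (fst l)) r) f" for f
    proof -
      consider (braid) s t n where "s \<in> T" "t \<in> T" "s \<noteq> t" "m s t = enat n"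
        "l = alternating n (s, True) (t, True)" "r = alternating n (t, True) (s, True)"
        | (square) s where "l = [(s, True), (s, True)]" "r = []"
        using rel(5) unfolding coxeter_relators_def artin_relators_def by blast
      then show ?thesis
      proof cases
        case braid
        then have "cm (?J s) (?J t) = enat n" using cm_Gen[OF fc, of s t] T(1) fc by auto
        then have "braid (alternating n (?J s) (?J t)) (alternating n (?J t) (?J s))"
          using braid_swap[of "?J s" "?J t" n "[]" "[]"] braid(3) by simp
        then show ?thesis using play_braid by (simp add: braid(5,6) map_alternating)
      qed (simp add: fire_fire)
    qed
    then show ?case by simp
  qed (auto simp: fire_fire)
  have "pos ` lists (?J ` T) \<subseteq>
      (\<lambda>U. pos (map (\<lambda>l. ?J (fst l)) (SOME w. w \<in> U))) ` carrier (coxeter_group T m)"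
  proof (rule image_subsetI)
    fix u assume "u \<in> lists (?J ` T)"
    then have "\<exists>v. u = map ?J v \<and> set v \<subseteq> T"
    proof (induction u)
      case (Cons g u)
      then obtain s v where "g = ?J s" "s \<in> T" "u = map ?J v" "set v \<subseteq> T" by blast
      then show ?case by (intro exI[of _ "s # v"]) simp
    qed simp
    then obtain v where v: "u = map ?J v" "set v \<subseteq> T" by blast
    let ?w = "map (\<lambda>s. (s, True)) v"
    let ?U = "word_cong T ?R `` {?w}"
    have w: "?w \<in> words T" using v(2) by (auto simp: in_lists_conv_set)
    have "?w \<in> ?U" using word_cong.refl[OF w] by simp
    then have "(SOME w. w \<in> ?U) \<in> ?U" by (rule someI)
    then have "(?w, SOME w. w \<in> ?U) \<in> word_cong T ?R" by (rule Image_singleton_iff[THEN iffD1])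
    then have "pos (map (\<lambda>l. ?J (fst l)) ?w) = pos (map (\<lambda>l. ?J (fst l)) (SOME w. w \<in> ?U))"
      by (rule play)
    moreover have "map (\<lambda>l. ?J (fst l)) ?w = u" by (simp add: v(1))
    ultimately have "pos u = pos (map (\<lambda>l. ?J (fst l)) (SOME w. w \<in> ?U))" by (simp only:)
    moreover have "?U \<in> carrier (coxeter_group T m)"
      unfolding coxeter_group_def by (rule class_in_presented_group[OF w])
    ultimately show "pos u \<in> (\<lambda>U. pos (map (\<lambda>l. ?J (fst l)) (SOME w. w \<in> U))) ` carrier (coxeter_group T m)"
      by blast
  qed
  then show ?thesis using T(2) by (auto simp: spherical_def intro: finite_subset)
qed

text \<open>Distinct letters with a finite label belong to the same system of type FC, so a set with
  two letters or more lies in one system and is spherical. With at most one letter there are at most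
  two positions.\<close>

instance gen :: (type) fc_coxeter
proof
  fix I :: "'a gen set"
  assume I: "finite I" "\<forall>s\<in>I. \<forall>t\<in>I. cm s t \<noteq> \<infinity>"
  show "finite (pos ` lists I)"
  proof (cases "\<exists>g\<in>I. \<exists>h\<in>I. g \<noteq> h")
    case True
    then obtain g h where gh: "g \<in> I" "h \<in> I" "g \<noteq> h" by blast
    obtain s S m where g: "g = Gen s S m" by (cases g)
    obtain t S' m' where h: "h = Gen t S' m'" by (cases h)
    have "cm g h \<noteq> \<infinity>" using I(2) gh by blast
    then have fc: "fc_system S m" "s \<in> S" using gh(3) by (auto simp: g h split: if_splits)
    have "\<exists>x\<in>S. k = Gen x S m" if k: "k \<in> I" for k
    proof (cases "k = g")
      case False
      obtain x S2 m2 where x: "k = Gen x S2 m2" by (cases k)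
      have "cm g k \<noteq> \<infinity>" using I(2) gh(1) k by blast
      then show ?thesis using False by (auto simp: g x split: if_splits)
    qed (use fc(2) g in auto)
    then have J: "I = (\<lambda>x. Gen x S m) ` {x \<in> S. Gen x S m \<in> I}" by auto
    have "m x y \<noteq> \<infinity>" if "x \<in> S" "Gen x S m \<in> I" "y \<in> S" "Gen y S m \<in> I" for x y
      using cm_Gen[OF fc(1) that(1,3)] I(2) that(2,4) by metis
    then have "spherical {x \<in> S. Gen x S m \<in> I} m"
      using fc(1) unfolding fc_system_def type_FC_def by auto
    then show ?thesis using spherical_finite_positions[OF fc(1), of "{x \<in> S. Gen x S m \<in> I}"] J by auto
  next
    case False
    have pw: "pos w \<in> {\<lambda>_. 1, pos [g]}" if "set w \<subseteq> {g}" for w and g :: "'a gen"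
      using that
    proof (induction w)
      case (Cons h w)
      then have "pos w = (\<lambda>_. 1) \<or> pos w = fire g (\<lambda>_. 1)" "h = g" by auto
      then show ?case by (elim disjE) (simp_all add: fire_fire)
    qed simp
    have *: "finite (pos ` lists {g})" for g :: "'a gen"
    proof (rule finite_subset)
      show "pos ` lists {g} \<subseteq> {\<lambda>_. 1, pos [g]}"
        by (rule image_subsetI) (rule pw, auto)
    qed simp
    obtain g where "I \<subseteq> {g}" using False by blast
    then have "pos ` lists I \<subseteq> pos ` lists {g}" by (intro image_mono lists_mono)
    then show ?thesis using * finite_subset by blast
  qed
qed

section \<open>The Artin monoid inside the Artin group\<close>

definition letters :: "'a set \<Rightarrow> ('a \<Rightarrow> 'a \<Rightarrow> enat) \<Rightarrow> 'a set \<Rightarrow> 'a gen set" where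
  "letters S m T = (\<lambda>s. Gen s S m) ` T"

abbreviation artin_cong :: "'a set \<Rightarrow> ('a \<Rightarrow> 'a \<Rightarrow> enat) \<Rightarrow> ('a letters \<times> 'a letters) set" where
  "artin_cong S m \<equiv> word_cong S (artin_relators S m)"

text \<open>Sending the letters of other systems to the neutral element makes this a homomorphism on the whole
  type.\<close>

definition to_word :: "'a set \<Rightarrow> ('a \<Rightarrow> 'a \<Rightarrow> enat) \<Rightarrow> 'a gen list \<Rightarrow> 'a letters" where
  "to_word S m w = map (\<lambda>g. (label g, True)) (filter (\<lambda>g. g \<in> letters S m S) w)"

definition to_group :: "'a set \<Rightarrow> ('a \<Rightarrow> 'a \<Rightarrow> enat) \<Rightarrow> 'a gen artin \<Rightarrow> 'a letters set" where
  "to_group S m x = artin_cong S m `` {to_word S m (SOME w. el w = x)}"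

lemma letters_isolated: "g \<in> letters S m S \<Longrightarrow> h \<notin> letters S m S \<Longrightarrow> cm g h = \<infinity>"
  by (cases g; cases h) (auto simp: letters_def)

lemma to_word_append: "to_word S m (u @ v) = to_word S m u @ to_word S m v"
  by (simp add: to_word_def)

lemma to_word_in_words: "to_word S m w \<in> words S"
  by (induction w) (auto simp: to_word_def letters_def)

lemma to_word_braid:
  assumes "fc_system S m"
  shows "braid u v \<Longrightarrow> (to_word S m u, to_word S m v) \<in> artin_cong S m"
proof (induction rule: braid.induct)
  case (braid_swap g h n u v)
  show ?case
  proof (cases "g \<in> letters S m S"; cases "h \<in> letters S m S")
    assume gh: "g \<in> letters S m S" "h \<in> letters S m S"
    then obtain s t where s: "s \<in> S" "g = Gen s S m" and t: "t \<in> S" "h = Gen t S m"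
      by (auto simp: letters_def)
    have n: "m s t = enat n" using cm_Gen[OF assms s(1) t(1)] braid_swap(2) s(2) t(2) by simp
    have w: "to_word S m (alternating n a b) = alternating n (label a, True) (label b, True)"
      if "a \<in> letters S m S" "b \<in> letters S m S" for a b
      using that by (induction n arbitrary: a b) (auto simp: to_word_def)
    have "(to_word S m u @ alternating n (s, True) (t, True) @ to_word S m v,
        to_word S m u @ alternating n (t, True) (s, True) @ to_word S m v) \<in> artin_cong S m"
    proof (rule word_cong.rel)
      show "alternating n (s, True) (t, True) \<in> words S" "alternating n (t, True) (s, True) \<in> words S"
        using set_alternating[of n "(s, True)" "(t, True)"] set_alternating[of n "(t, True)" "(s, True)"] s t
        by (auto simp: in_lists_conv_set)
      show "(alternating n (s, True) (t, True), alternating n (t, True) (s, True)) \<in> artin_relators S m"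
        using s t n braid_swap(1) unfolding artin_relators_def by blast
    qed (rule to_word_in_words)+
    then show ?thesis using w gh by (simp add: to_word_append s t)
  next
    assume gh: "g \<notin> letters S m S" "h \<notin> letters S m S"
    have "to_word S m (alternating n a b) = []"
      if "a \<notin> letters S m S" "b \<notin> letters S m S" for a b
      using that by (induction n arbitrary: a b) (auto simp: to_word_def)
    then show ?thesis using gh
      using word_cong.refl[OF to_word_in_words, of S m "u @ v"] by (simp add: to_word_append)
  qed (use letters_isolated braid_swap(2) cm_sym in \<open>metis enat.distinct(1)\<close>)+
qed (use word_cong.refl[OF to_word_in_words] word_cong.sym word_cong.trans in blast)+

lemma to_group_el:
  assumes "fc_system S m"
  shows "to_group S m (el w) = artin_cong S m `` {to_word S m w}"
proof -
  have "el (SOME v. el v = el w) = el w" by (rule someI[of _ w]) simp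
  then have "braid (SOME v. el v = el w) w" by (simp only: el_eq_iff)
  from to_word_braid[OF assms this] show ?thesis
    unfolding to_group_def by (rule equiv_class_eq[OF equiv_word_cong])
qed

lemma to_group_closed: "to_group S m x \<in> carrier (artin_group S m)"
  unfolding to_group_def artin_group_def by (rule class_in_presented_group[OF to_word_in_words])

lemma to_group_mult:
  assumes "fc_system S m"
  shows "to_group S m (x * y) = to_group S m x \<otimes>\<^bsub>artin_group S m\<^esub> to_group S m y"
proof -
  obtain u v where x: "x = el u" "y = el v" using el_surj by metis
  have "to_group S m (el (u @ v)) = to_group S m (el u) \<otimes>\<^bsub>artin_group S m\<^esub> to_group S m (el v)"
    unfolding to_group_el[OF assms] artin_group_def to_word_append
    by (rule mult_presented_group[OF to_word_in_words to_word_in_words, symmetric])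
  then show ?thesis by (simp add: x)
qed

lemma to_group_one: "fc_system S m \<Longrightarrow> to_group S m 1 = \<one>\<^bsub>artin_group S m\<^esub>"
  using to_group_el[of S m "[]"] by (simp add: artin_group_def one_presented_group to_word_def)

lemma to_group_atom: "fc_system S m \<Longrightarrow> s \<in> S \<Longrightarrow> to_group S m (atom (Gen s S m)) = artin_gen S m s"
  using to_group_el[of S m "[Gen s S m]"] by (simp add: to_word_def artin_gen_def letters_def)

subsection \<open>The action on irreducible multifractions\<close>

abbreviation normal_mf :: "(nat \<Rightarrow> 's::fc_coxeter artin) \<Rightarrow> bool" where
  "normal_mf c \<equiv> art.irred c \<and> (\<exists>n. art.supp_below n c)"

lemma normal_mf_act: "normal_mf c \<Longrightarrow> normal_mf (art.act p x c)"
  using art.act_closed by blast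

text \<open>Multiplication on the right, hence letters are read from left to right, unlike in the
  numbers game.\<close>

fun act_word :: "'a set \<Rightarrow> ('a \<Rightarrow> 'a \<Rightarrow> enat) \<Rightarrow> 'a letters \<Rightarrow> (nat \<Rightarrow> 'a gen artin) \<Rightarrow> nat \<Rightarrow> 'a gen artin"
  where
  "act_word S m [] c = c"
| "act_word S m (l # w) c = act_word S m w (art.act (snd l) (atom (Gen (fst l) S m)) c)"

lemma act_word_append: "act_word S m (u @ v) c = act_word S m v (act_word S m u c)"
  by (induction u arbitrary: c) auto

lemma normal_mf_act_word: "normal_mf c \<Longrightarrow> normal_mf (act_word S m w c)"
proof (induction w arbitrary: c)
  case (Cons l w)
  show ?case using Cons.IH[OF normal_mf_act[OF Cons.prems]] by simp
qed simp

lemma act_word_positive: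
  "normal_mf c \<Longrightarrow> act_word S m (map (\<lambda>s. (s, True)) w) c = art.act True (el (map (\<lambda>s. Gen s S m) w)) c"
proof (induction w arbitrary: c)
  case Nil
  then obtain n where "art.supp_below n c" "art.irred c" by blast
  then show ?case by (simp add: art.act_one[of n])
next
  case (Cons s w)
  obtain n where n: "art.supp_below n c" using Cons.prems by blast
  show ?case using Cons.IH[OF normal_mf_act[OF Cons.prems]] art.act_act[OF n, of True] by simp
qed

lemma act_word_cong:
  assumes "fc_system S m"
  shows "(v, w) \<in> artin_cong S m \<Longrightarrow> normal_mf c \<Longrightarrow> act_word S m v c = act_word S m w c"
proof (induction arbitrary: c rule: word_cong.induct)
  case (cancel u v s b)
  obtain n where "art.supp_below n (act_word S m u c)" "art.irred (act_word S m u c)"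
    using normal_mf_act_word[OF cancel.prems] by blast
  then show ?case using art.act_cancel[of n "act_word S m u c" b] by (simp add: act_word_append)
next
  case (rel u v l r)
  obtain s t n where st: "s \<in> S" "t \<in> S" "s \<noteq> t" "m s t = enat n"
    "l = alternating n (s, True) (t, True)" "r = alternating n (t, True) (s, True)"
    using rel(5) unfolding artin_relators_def by blast
  let ?J = "\<lambda>s. Gen s S m"
  have "el (alternating n (?J s) (?J t)) = el (alternating n (?J t) (?J s))"
    using braid_relation[of "?J s" "?J t" n] cm_Gen[OF assms st(1,2)] st(3,4) by (simp add: el_alternating)
  then have "act_word S m l c = act_word S m r c" if "normal_mf c" for c
    using act_word_positive[OF that, of S m "alternating n s t"]
      act_word_positive[OF that, of S m "alternating n t s"]
    by (simp add: st(5,6) map_alternating)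
  then show ?case using normal_mf_act_word[OF rel.prems] by (simp add: act_word_append)
qed auto

definition act_group :: "'a set \<Rightarrow> ('a \<Rightarrow> 'a \<Rightarrow> enat) \<Rightarrow> 'a letters set \<Rightarrow> (nat \<Rightarrow> 'a gen artin) \<Rightarrow> nat \<Rightarrow> 'a gen artin"
  where "act_group S m U = act_word S m (SOME w. w \<in> U)"

lemma act_group_class:
  assumes "fc_system S m" "w \<in> words S" "normal_mf c"
  shows "act_group S m (artin_cong S m `` {w}) c = act_word S m w c"
proof -
  let ?U = "artin_cong S m `` {w}"
  have "w \<in> ?U" using word_cong.refl[OF assms(2)] by simp
  then have "(SOME w. w \<in> ?U) \<in> ?U" by (rule someI)
  then show ?thesis unfolding act_group_def using act_word_cong[OF assms(1) _ assms(3)] by simp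
qed

lemma act_group_mult:
  assumes "fc_system S m" "U \<in> carrier (artin_group S m)" "V \<in> carrier (artin_group S m)" "normal_mf c"
  shows "act_group S m (U \<otimes>\<^bsub>artin_group S m\<^esub> V) c = act_group S m V (act_group S m U c)"
proof -
  obtain u where u: "u \<in> words S" "U = artin_cong S m `` {u}"
    using assms(2) unfolding artin_group_def by (rule presented_group_cases)
  obtain v where v: "v \<in> words S" "V = artin_cong S m `` {v}"
    using assms(3) unfolding artin_group_def by (rule presented_group_cases)
  have uv: "u @ v \<in> words S" using u(1) v(1) by simp
  show ?thesis
    unfolding u(2) v(2) artin_group_def mult_presented_group[OF u(1) v(1)]
      act_group_class[OF assms(1) uv assms(4)] act_group_class[OF assms(1) u(1) assms(4)]
      act_group_class[OF assms(1) v(1) normal_mf_act_word[OF assms(4)]]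
    by (rule act_word_append)
qed

lemma act_group_one: "fc_system S m \<Longrightarrow> normal_mf c \<Longrightarrow> act_group S m \<one>\<^bsub>artin_group S m\<^esub> c = c"
  using act_group_class[of S m "[]" c] by (simp add: artin_group_def one_presented_group)

lemma act_group_to_group:
  assumes "fc_system S m" "supp x \<subseteq> letters S m S" "normal_mf c"
  shows "act_group S m (to_group S m x) c = art.act True x c"
proof -
  obtain w where w: "x = el w" using el_surj by blast
  have "set w \<subseteq> letters S m S" using assms(2) w by simp
  then have "to_word S m w = map (\<lambda>s. (s, True)) (map label w)" "map (\<lambda>s. Gen s S m) (map label w) = w"
    by (induction w) (auto simp: to_word_def letters_def)
  then show ?thesis
    using act_group_class[OF assms(1) to_word_in_words[of S m w] assms(3)]
      act_word_positive[OF assms(3), of S m "map label w"]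
    by (simp add: w to_group_el[OF assms(1)])
qed

lemma act_group_inv_to_group:
  assumes "fc_system S m" "supp x \<subseteq> letters S m S" "normal_mf c"
  shows "act_group S m (inv\<^bsub>artin_group S m\<^esub> to_group S m x) c = art.act False x c"
proof -
  interpret group "artin_group S m" by (rule group_artin_group)
  let ?g = "to_group S m x" and ?d = "art.act False x c"
  obtain n where n: "art.supp_below n c" using assms(3) by blast
  have d: "normal_mf ?d" by (rule normal_mf_act[OF assms(3)])
  have "act_group S m ?g ?d = c"
    using act_group_to_group[OF assms(1,2) d] art.act_cancel[OF n, of False x] assms(3) by simp
  then have "act_group S m (inv\<^bsub>artin_group S m\<^esub> ?g) c = act_group S m (?g \<otimes>\<^bsub>artin_group S m\<^esub> inv\<^bsub>artin_group S m\<^esub> ?g) ?d"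
    using act_group_mult[OF assms(1) to_group_closed[of S m x] inv_closed[OF to_group_closed[of S m x]] d] by simp
  then show ?thesis using act_group_one[OF assms(1) d] r_inv[OF to_group_closed[of S m x]] by simp
qed

primrec mf_value :: "'a set \<Rightarrow> ('a \<Rightarrow> 'a \<Rightarrow> enat) \<Rightarrow> (nat \<Rightarrow> 'a gen artin) \<Rightarrow> nat \<Rightarrow> 'a letters set" where
  "mf_value S m c 0 = \<one>\<^bsub>artin_group S m\<^esub>"
| "mf_value S m c (Suc k) = mf_value S m c k \<otimes>\<^bsub>artin_group S m\<^esub>
    (if even k then to_group S m (c k) else inv\<^bsub>artin_group S m\<^esub> to_group S m (c k))"

lemma mf_value_closed: "mf_value S m c k \<in> carrier (artin_group S m)"
proof -
  interpret group "artin_group S m" by (rule group_artin_group)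
  show ?thesis by (induction k) (auto simp: to_group_closed)
qed

lemma trivial_normal_mf: "normal_mf (\<lambda>_. 1)"
proof
  show "art.irred (\<lambda>_. 1)"
    by (rule art.irredI) (metis art.op_def mult_eq_one)
qed (auto simp: art.supp_below_def)

lemma act_group_mf_value:
  assumes "fc_system S m" "\<And>k. supp (c k) \<subseteq> letters S m S"
  shows "act_group S m (mf_value S m c n) (\<lambda>_. 1) = fold (\<lambda>k. art.act (even k) (c k)) [0..<n] (\<lambda>_. 1)
    \<and> normal_mf (act_group S m (mf_value S m c n) (\<lambda>_. 1))"
proof (induction n)
  case 0
  then show ?case using act_group_one[OF assms(1) trivial_normal_mf] trivial_normal_mf by simp
next
  case (Suc n)
  interpret group "artin_group S m" by (rule group_artin_group)
  let ?d = "act_group S m (mf_value S m c n) (\<lambda>_. 1)"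
  have d: "normal_mf ?d" using Suc by (rule conjunct2)
  have "act_group S m (mf_value S m c (Suc n)) (\<lambda>_. 1) = art.act (even n) (c n) ?d"
    using act_group_mult[OF assms(1) mf_value_closed[of S m c n] _ trivial_normal_mf]
      act_group_to_group[OF assms d] act_group_inv_to_group[OF assms d] to_group_closed[of S m "c n"]
    by simp
  moreover have "fold (\<lambda>k. art.act (even k) (c k)) [0..<Suc n] (\<lambda>_. 1) = art.act (even n) (c n) ?d"
    using Suc by simp
  ultimately show ?case using normal_mf_act[OF d] by metis
qed

text \<open>The value of \<open>c\<close> acts on the trivial multifraction by producing
  \<open>c\<close>, the neutral element by fixing it.\<close>

theorem irreducible_value_one:
  assumes "fc_system S m" "\<And>k. supp (c k) \<subseteq> letters S m S" "art.irred c" "art.supp_below n c"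
    and "mf_value S m c n = \<one>\<^bsub>artin_group S m\<^esub>"
  shows "c = (\<lambda>_. 1)"
  using act_group_mf_value[where c = c and n = n, OF assms(1,2)] art.fold_act_irred[OF assms(3,4)]
    act_group_one[OF assms(1) trivial_normal_mf] assms(5) by simp

text \<open>Acting on the trivial multifraction, \<open>x\<close> yields the one with the single
  entry \<open>x\<close> at 0, which is irreducible because a reduction takes a divisor out of an
  entry of positive index.\<close>

lemma to_group_inj:
  assumes "fc_system S m" "supp x \<subseteq> letters S m S" "supp y \<subseteq> letters S m S"
    and "to_group S m x = to_group S m y"
  shows "x = y"
proof -
  have act: "art.act True z (\<lambda>_. 1) = (\<lambda>_. 1)(0 := z)" for z :: "'a gen artin"
  proof -
    have sb: "art.supp_below 0 (\<lambda>_. 1 :: 'a gen artin)" by (simp add: art.supp_below_def)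
    have "art.act True z (\<lambda>_. 1) = art.nf ((\<lambda>_. 1)(0 := z))"
      using art.act_nf[OF sb order_refl, of z] by simp
    moreover have "art.irred ((\<lambda>_. 1)(0 := z))"
      by (rule art.irredI) (metis art.op_def mult_eq_one fun_upd_other nat.distinct(1))
    moreover have "art.supp_below 1 ((\<lambda>_. 1)(0 := z))" by (simp add: art.supp_below_def)
    ultimately show ?thesis using art.nf_irred by simp
  qed
  have "art.act True x (\<lambda>_. 1) = art.act True y (\<lambda>_. 1)"
    using act_group_to_group[OF assms(1,2) trivial_normal_mf]
      act_group_to_group[OF assms(1,3) trivial_normal_mf] assms(4) by metis
  then show ?thesis unfolding act by (metis fun_upd_same)
qed

subsection \<open>Reduction preserves values\<close>

text \<open>The identity behind one reduction: \<open>a\<^sub>i x' = x q\<close> lets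
  \<open>x\<close> cross \<open>a\<^sub>i\<inverse>\<close> from right to left and become
  \<open>x'\<close>.\<close>

lemma (in group) cross_mult:
  assumes "a \<in> carrier G" "b \<in> carrier G" "c \<in> carrier G" "d \<in> carrier G" "a \<otimes> b = c \<otimes> d"
  shows "inv a \<otimes> c = b \<otimes> inv d"
proof -
  have "inv a \<otimes> c = inv a \<otimes> (c \<otimes> d) \<otimes> inv d" using assms(1-4) by (simp add: m_assoc)
  also have "\<dots> = inv a \<otimes> (a \<otimes> b) \<otimes> inv d" by (simp only: assms(5))
  also have "\<dots> = b \<otimes> inv d" using assms(1-4) by (simp add: inv_solve_left' flip: m_assoc)
  finally show ?thesis .
qed

lemma mf_value_cong: "(\<And>j. j < k \<Longrightarrow> c j = d j) \<Longrightarrow> mf_value S m c k = mf_value S m d k"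
  by (induction k) auto

lemma mf_value_extend:
  assumes "k \<le> n" "mf_value S m c k = mf_value S m d k" "\<And>j. k \<le> j \<Longrightarrow> c j = d j"
  shows "mf_value S m c n = mf_value S m d n"
  using assms(1)
proof (induction n rule: dec_induct)
  case (step n)
  then show ?case using assms(3)[of n] by simp
qed (rule assms(2))

lemma mf_value_red:
  assumes fc: "fc_system S m" and red: "art.red i x c d" and n: "Suc (Suc i) \<le> n"
  shows "mf_value S m d n = mf_value S m c n"
proof (rule mf_value_extend[OF n])
  interpret group "artin_group S m" by (rule group_artin_group)
  let ?G = "artin_group S m" and ?g = "to_group S m"
  note g = to_group_mult[OF fc]
  note [simp] = to_group_closed mf_value_closed
  obtain r q x' where r: "c (Suc i) = art.op i x r" "ljoin (art.op i) x (c i) q x'"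
    "i = 0 \<longrightarrow> x' = 1" "d = art.upd i c x' q r"
    using red unfolding art.red_def by blast
  have q: "art.op i x q = art.op i (c i) x'" using r(2) by (simp add: ljoin_def)
  show "d j = c j" if "Suc (Suc i) \<le> j" for j using that by (simp add: r(4) art.upd_def)
  have d: "d (Suc i) = r" "d i = q" by (simp_all add: r(4) art.upd_def)
  show "mf_value S m d (Suc (Suc i)) = mf_value S m c (Suc (Suc i))"
  proof (cases i)
    case 0
    have "c 1 = r * x" "c 0 = q * x" using r(1,3) q 0 by (simp_all add: art.op_def)
    then show ?thesis using d 0
      by (simp add: g inv_mult_group m_assoc) (simp add: inv_solve_right' flip: m_assoc)
  next
    case (Suc j)
    have V: "mf_value S m d j = mf_value S m c j"
      by (rule mf_value_cong) (simp add: r(4) art.upd_def Suc)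
    have dj: "d j = art.op i (c j) x'" by (simp add: r(4) art.upd_def Suc)
    let ?V = "mf_value S m c j"
    show ?thesis
    proof (cases "even j")
      case True
      have e: "c (Suc i) = x * r" "c i * x' = x * q" "d j = c j * x'"
        using r(1) q dj True by (simp_all add: art.op_def Suc)
      have "inv\<^bsub>?G\<^esub> ?g (c i) \<otimes>\<^bsub>?G\<^esub> ?g x = ?g x' \<otimes>\<^bsub>?G\<^esub> inv\<^bsub>?G\<^esub> ?g q"
        using arg_cong[OF e(2), of ?g] by (intro cross_mult) (simp_all add: g)
      then have "?V \<otimes>\<^bsub>?G\<^esub> ?g (c j) \<otimes>\<^bsub>?G\<^esub> (inv\<^bsub>?G\<^esub> ?g (c i) \<otimes>\<^bsub>?G\<^esub> ?g x) \<otimes>\<^bsub>?G\<^esub> ?g r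
          = ?V \<otimes>\<^bsub>?G\<^esub> ?g (c j) \<otimes>\<^bsub>?G\<^esub> (?g x' \<otimes>\<^bsub>?G\<^esub> inv\<^bsub>?G\<^esub> ?g q) \<otimes>\<^bsub>?G\<^esub> ?g r" by simp
      then show ?thesis using True d V e by (simp add: Suc g m_assoc)
    next
      case False
      have e: "c (Suc i) = r * x" "q * x = x' * c i" "d j = x' * c j"
        using r(1) q dj False by (simp_all add: art.op_def Suc)
      have "inv\<^bsub>?G\<^esub> ?g x' \<otimes>\<^bsub>?G\<^esub> ?g q = ?g (c i) \<otimes>\<^bsub>?G\<^esub> inv\<^bsub>?G\<^esub> ?g x"
        using arg_cong[OF e(2), of ?g] by (intro cross_mult) (simp_all add: g)
      then have "?V \<otimes>\<^bsub>?G\<^esub> inv\<^bsub>?G\<^esub> ?g (c j) \<otimes>\<^bsub>?G\<^esub> (inv\<^bsub>?G\<^esub> ?g x' \<otimes>\<^bsub>?G\<^esub> ?g q) \<otimes>\<^bsub>?G\<^esub> inv\<^bsub>?G\<^esub> ?g r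
          = ?V \<otimes>\<^bsub>?G\<^esub> inv\<^bsub>?G\<^esub> ?g (c j) \<otimes>\<^bsub>?G\<^esub> (?g (c i) \<otimes>\<^bsub>?G\<^esub> inv\<^bsub>?G\<^esub> ?g x) \<otimes>\<^bsub>?G\<^esub> inv\<^bsub>?G\<^esub> ?g r" by simp
      then show ?thesis using False d V e by (simp add: Suc g m_assoc inv_mult_group)
    qed
  qed
qed

text \<open>The cofactors of a join divide those supplied by \<open>compat_join\<close>, whose
  support is controlled. So reduction never leaves the system.\<close>

lemma ljoin_supp:
  fixes x y :: "'s::fc_coxeter artin"
  assumes "ljoin (art.op i) x y q z"
  shows "supp q \<subseteq> supp x \<union> supp y \<and> supp z \<subseteq> supp x \<union> supp y"
proof (cases "odd i")
  case True
  then have j: "ljoin (*) x y q z" using assms by (simp add: art.op_def)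
  then have "compat x y" using compat_eqI unfolding ljoin_def by blast
  then obtain a b where ab: "x * a = y * b" "supp (x * a) \<subseteq> supp x \<union> supp y"
    by (rule compat_join)
  obtain k where k: "a = q * k" "b = z * k" using j ab(1) unfolding ljoin_def by blast
  have "supp q \<subseteq> supp a" "supp z \<subseteq> supp b" unfolding k by simp_all
  moreover have "supp a \<subseteq> supp x \<union> supp y" using ab(2) by simp
  moreover have "supp b \<subseteq> supp x \<union> supp y" using ab(2) unfolding ab(1) by simp
  ultimately show ?thesis by blast
next
  case False
  then have j: "ljoin (\<lambda>x y. y * x) x y q z" using assms by (simp add: art.op_def)
  then have "flip x * flip q = flip y * flip z" unfolding ljoin_def by (metis flip_simps(2))
  then have "compat (flip x) (flip y)" by (rule compat_eqI)
  then obtain a b where ab: "flip x * a = flip y * b"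
    "supp (flip x * a) \<subseteq> supp (flip x) \<union> supp (flip y)"
    by (rule compat_join)
  have "flip a * x = flip b * y" using ab(1) by (metis flip_simps(2,4))
  then obtain k where k: "flip a = k * q" "flip b = k * z" using j unfolding ljoin_def by blast
  have "supp q \<subseteq> supp a" "supp z \<subseteq> supp b"
    using arg_cong[OF k(1), of supp] arg_cong[OF k(2), of supp] by auto
  moreover have "supp a \<subseteq> supp x \<union> supp y" using ab(2) by simp
  moreover have "supp b \<subseteq> supp x \<union> supp y" using ab(2) unfolding ab(1) by simp
  ultimately show ?thesis by blast
qed

lemma step_mf_value:
  assumes fc: "fc_system S m" and "art.step c d" "art.supp_below n c" "\<And>k. supp (c k) \<subseteq> letters S m S"
  shows "mf_value S m d n = mf_value S m c n \<and> (\<forall>k. supp (d k) \<subseteq> letters S m S)"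
proof -
  obtain i x where red: "x \<noteq> 1" "art.red i x c d" using assms(2) by (auto simp: art.step_def)
  have "Suc (Suc i) \<le> n" using art.step_level(1)[OF red(2,1) assms(3)] by simp
  moreover obtain r q x' where r: "c (Suc i) = art.op i x r" "ljoin (art.op i) x (c i) q x'"
    "d = art.upd i c x' q r"
    using red unfolding art.red_def by blast
  have xr: "supp x \<subseteq> letters S m S" "supp r \<subseteq> letters S m S"
    using arg_cong[OF r(1), of supp] assms(4)[of "Suc i"] by (auto simp: art.op_def split: if_splits)
  then have "supp q \<subseteq> letters S m S" "supp x' \<subseteq> letters S m S"
    using ljoin_supp[OF r(2)] assms(4)[of i] by blast+
  then have "\<forall>k. supp (d k) \<subseteq> letters S m S"
    using assms(4) xr by (auto simp: r(3) art.upd_def art.op_def)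
  ultimately show ?thesis using mf_value_red[OF fc red(2)] by blast
qed

lemma steps_mf_value:
  assumes fc: "fc_system S m" and "art.step\<^sup>*\<^sup>* c d" "art.supp_below n c" "\<forall>k. supp (c k) \<subseteq> letters S m S"
  shows "mf_value S m d n = mf_value S m c n \<and> (\<forall>k. supp (d k) \<subseteq> letters S m S)"
  using assms(2)
proof (induction rule: rtranclp_induct)
  case (step d e)
  then show ?case
    using step_mf_value[OF fc step(2) art.steps_supp_below[OF step(1) assms(3)]] by metis
qed (use assms in simp)

lemma irreducible_exists:
  assumes fc: "fc_system S m" and U: "U \<in> carrier (artin_group S m)"
  shows "\<exists>c n. art.irred c \<and> art.supp_below n c \<and> (\<forall>k. supp (c k) \<subseteq> letters S m S) \<and> mf_value S m c n = U"
proof -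
  interpret group "artin_group S m" by (rule group_artin_group)
  let ?G = "artin_group S m" and ?cls = "\<lambda>w. artin_cong S m `` {w}"
  have ex: "\<exists>c n. art.supp_below n c \<and> (\<forall>k. supp (c k) \<subseteq> letters S m S) \<and> mf_value S m c n = ?cls w"
    if "w \<in> words S" for w
    using that
  proof (induction w rule: rev_induct)
    case Nil
    show ?case
      by (intro exI[of _ "\<lambda>_. 1"] exI[of _ 0]) (simp add: art.supp_below_def artin_group_def one_presented_group)
  next
    case (snoc l w)
    then obtain c n where c: "art.supp_below n c" "\<And>k. supp (c k) \<subseteq> letters S m S" "mf_value S m c n = ?cls w"
      by auto
    obtain s b where l: "l = (s, b)" by (cases l)
    have s: "s \<in> S" and w: "w \<in> words S" using snoc.prems l by auto
    let ?a = "atom (Gen s S m)"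
    \<comment> \<open>A free place of the right parity: even entries count positively, odd ones as
      inverses.\<close>
    define k where "k = (if b then 2 * n else Suc (2 * n))"
    have k: "n \<le> k" "even k = b" by (auto simp: k_def)
    let ?c = "c(k := ?a)"
    have "mf_value S m ?c k = mf_value S m c k" by (rule mf_value_cong) simp
    also have "\<dots> = mf_value S m c n"
      using k(1)
    proof (induction k rule: dec_induct)
      case (step j)
      then have "c j = 1" using c(1) by (auto simp: art.supp_below_def)
      then show ?case using step by (simp add: to_group_one[OF fc] mf_value_closed)
    qed simp
    finally have "mf_value S m ?c k = ?cls w" using c(3) by simp
    moreover have "(if b then to_group S m ?a else inv\<^bsub>?G\<^esub> to_group S m ?a) = ?cls [l]"
    proof (cases b)
      case True
      then show ?thesis using to_group_atom[OF fc s] by (simp add: l artin_gen_def)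
    next
      case False
      have ws: "[(s, False)] \<in> words S" "[(s, True)] \<in> words S" using s by auto
      have "?cls [(s, False)] \<otimes>\<^bsub>?G\<^esub> ?cls [(s, True)] = ?cls ([(s, False)] @ [(s, True)])"
        unfolding artin_group_def by (rule mult_presented_group[OF ws])
      also have "\<dots> = ?cls []"
        using word_cong.cancel[of "[]" S "[]" s False] s by (intro equiv_class_eq[OF equiv_word_cong]) simp
      finally have "inv\<^bsub>?G\<^esub> (?cls [(s, True)]) = ?cls [(s, False)]"
        using class_in_presented_group[OF ws(1)] class_in_presented_group[OF ws(2)]
        by (intro inv_equality) (simp_all add: artin_group_def one_presented_group)
      then show ?thesis using False to_group_atom[OF fc s] by (simp add: l artin_gen_def)
    qed
    moreover have "?cls (w @ [l]) = ?cls w \<otimes>\<^bsub>?G\<^esub> ?cls [l]"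
      unfolding artin_group_def by (rule mult_presented_group[symmetric]) (use w s l in auto)
    ultimately have "mf_value S m ?c (Suc k) = ?cls (w @ [l])" using k(2) by (cases b) simp_all
    moreover have "art.supp_below (Suc k) ?c" by (rule art.supp_below_upd[OF c(1) k(1)])
    moreover have "\<forall>j. supp (?c j) \<subseteq> letters S m S" using c(2) s by (auto simp: letters_def)
    ultimately show ?case by blast
  qed
  obtain w where "w \<in> words S" "U = ?cls w"
    using U unfolding artin_group_def by (rule presented_group_cases)
  then obtain c n where c: "art.supp_below n c" "\<forall>k. supp (c k) \<subseteq> letters S m S" "mf_value S m c n = U"
    using ex by blast
  then show ?thesis
    using art.nf[OF c(1)] art.supp_below_nf[OF c(1)] steps_mf_value[OF fc _ c(1,2), of "art.nf c"]
    by (intro exI[of _ "art.nf c"] exI[of _ n]) auto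
qed

subsection \<open>Divisibility and least common multiples in the Artin monoid\<close>

lemma mult_artin_monoid [simp]: "x \<otimes>\<^bsub>artin_monoid S m\<^esub> y = x \<otimes>\<^bsub>artin_group S m\<^esub> y"
  and one_artin_monoid [simp]: "\<one>\<^bsub>artin_monoid S m\<^esub> = \<one>\<^bsub>artin_group S m\<^esub>"
  by (simp_all add: artin_monoid_def)

lemma carrier_artin_monoid:
  assumes fc: "fc_system S m"
  shows "carrier (artin_monoid S m) = to_group S m ` {x. supp x \<subseteq> letters S m S}"
proof
  let ?H = "to_group S m ` {x. supp x \<subseteq> letters S m S}"
  interpret submonoid "carrier (artin_monoid S m)" "artin_group S m" by (rule submonoid_artin_monoid)
  have gens: "artin_gen S m s \<in> carrier (artin_monoid S m)" if "s \<in> S" for s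
    using that by (auto simp: artin_monoid_def hull_def)
  show "?H \<subseteq> carrier (artin_monoid S m)"
  proof clarify
    fix x assume "supp x \<subseteq> letters S m S"
    then show "to_group S m x \<in> carrier (artin_monoid S m)"
    proof (induction x rule: atom_induct)
      case (atom g x)
      then obtain s where "s \<in> S" "g = Gen s S m" by (auto simp: letters_def)
      then show ?case using atom gens by (simp add: to_group_mult[OF fc] to_group_atom[OF fc])
    qed (simp add: to_group_one[OF fc])
  qed
  have "submonoid ?H (artin_group S m)"
  proof
    show "?H \<subseteq> carrier (artin_group S m)" using to_group_closed by blast
    show "u \<otimes>\<^bsub>artin_group S m\<^esub> v \<in> ?H" if uv: "u \<in> ?H" "v \<in> ?H" for u v
    proof -
      obtain x y where "supp x \<subseteq> letters S m S" "supp y \<subseteq> letters S m S"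
        "u = to_group S m x" "v = to_group S m y" using uv by blast
      then show ?thesis by (intro image_eqI[of _ _ "x * y"]) (simp_all add: to_group_mult[OF fc])
    qed
    show "\<one>\<^bsub>artin_group S m\<^esub> \<in> ?H"
      by (intro image_eqI[of _ _ 1]) (simp_all add: to_group_one[OF fc])
  qed
  moreover have "artin_gen S m ` S \<subseteq> ?H"
  proof clarify
    fix s assume "s \<in> S"
    then show "artin_gen S m s \<in> ?H"
      by (intro image_eqI[of _ _ "atom (Gen s S m)"]) (auto simp: to_group_atom[OF fc] letters_def)
  qed
  ultimately show "carrier (artin_monoid S m) \<subseteq> ?H" by (rule artin_monoid_least)
qed

lemma divides_to_group:
  assumes fc: "fc_system S m" and x: "supp x \<subseteq> letters S m S" and y: "supp y \<subseteq> letters S m S"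
  shows "to_group S m x divides\<^bsub>artin_monoid S m\<^esub> to_group S m y \<longleftrightarrow> x dvd y"
proof
  assume "to_group S m x divides\<^bsub>artin_monoid S m\<^esub> to_group S m y"
  then obtain z where z: "supp z \<subseteq> letters S m S"
    "to_group S m y = to_group S m x \<otimes>\<^bsub>artin_group S m\<^esub> to_group S m z"
    unfolding factor_def carrier_artin_monoid[OF fc] by auto
  then have "to_group S m y = to_group S m (x * z)" by (simp add: to_group_mult[OF fc])
  then have "y = x * z" by (rule to_group_inj[OF fc y, rotated]) (use x z in simp)
  then show "x dvd y" by simp
next
  assume "x dvd y"
  then obtain z where z: "y = x * z" unfolding dvd_def ..
  then have "supp z \<subseteq> letters S m S" using y by simp
  then show "to_group S m x divides\<^bsub>artin_monoid S m\<^esub> to_group S m y"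
    unfolding factor_def carrier_artin_monoid[OF fc] z
    by (intro bexI[of _ "to_group S m z"]) (auto simp: to_group_mult[OF fc])
qed

lemma is_lcm_to_group:
  assumes fc: "fc_system S m" and X: "\<And>x. x \<in> X \<Longrightarrow> supp x \<subseteq> letters S m S" and d: "supp d \<subseteq> letters S m S"
  shows "is_lcm (artin_monoid S m) (to_group S m ` X) (to_group S m d) \<longleftrightarrow>
    (\<forall>x\<in>X. x dvd d) \<and> (\<forall>y. supp y \<subseteq> letters S m S \<longrightarrow> (\<forall>x\<in>X. x dvd y) \<longrightarrow> d dvd y)"
  unfolding is_lcm_def carrier_artin_monoid[OF fc]
  using X d by (auto simp: divides_to_group[OF fc])

lemma bounded_spherical:
  assumes "fc_system S m" "T \<subseteq> S" "spherical T m"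
  shows "bounded (letters S m T)"
proof (rule finite_positions_bounded)
  show "finite (letters S m T)"
    using assms(1,2) by (auto simp: letters_def fc_system_def coxeter_matrix_def intro: finite_subset)
  show "finite (pos ` lists (letters S m T))"
    unfolding letters_def by (rule spherical_finite_positions[OF assms])
qed

lemma letters_mono: "T \<subseteq> S \<Longrightarrow> letters S m T \<subseteq> letters S m S"
  by (auto simp: letters_def)

lemma Delta_to_group:
  assumes fc: "fc_system S m" and T: "T \<subseteq> S" "spherical T m"
  shows "Delta S m T = to_group S m (garside (letters S m T))"
proof (rule Delta_eq)
  have B: "bounded (letters S m T)" by (rule bounded_spherical[OF assms])
  have gen: "artin_gen S m ` T = to_group S m ` atom ` letters S m T"
    using to_group_atom[OF fc] T(1) by (force simp: letters_def image_image)
  have sg: "supp (garside (letters S m T)) \<subseteq> letters S m S"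
    using garside(3)[OF B] letters_mono[OF T(1)] by simp
  have "supp x \<subseteq> letters S m S" if "x \<in> atom ` letters S m T" for x
    using that letters_mono[OF T(1), of m] by auto
  then show "is_lcm (artin_monoid S m) (artin_gen S m ` T) (to_group S m (garside (letters S m T)))"
    unfolding gen using garside(1,2)[OF B] by (subst is_lcm_to_group[OF fc _ sg]) auto
qed

lemma alt_prod_to_group:
  assumes "fc_system S m"
  shows "alt_prod (artin_monoid S m) n (to_group S m x) (to_group S m y) = to_group S m (altp n x y)"
  unfolding alt_prod_def
  by (induction n arbitrary: x y) (auto simp: to_group_one[OF assms] to_group_mult[OF assms])

section \<open>Injectivity\<close>

lemma lcm_map_lcm_datum:
  assumes fc: "fc_system S m" "fc_system S' m'" and p: "lcm_datum S m S' m' p"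
  shows "lcm_map (letters S m S) (\<lambda>g. letters S' m' (p (label g)))"
proof
  let ?L = "letters S m S" and ?P = "\<lambda>g. letters S' m' (p (label g))"
  have pS: "p s \<subseteq> S'" "p s \<noteq> {}" "spherical (p s) m'" if "s \<in> S" for s
    using p that unfolding lcm_datum_def by auto
  have B: "bounded (letters S' m' (p s))" if "s \<in> S" for s
    using bounded_spherical[OF fc(2) pS(1,3)] that by blast
  show "cm g h = \<infinity>" if "g \<in> ?L" "h \<notin> ?L" for g h
    using that by (rule letters_isolated)
  show "bounded (?P g)" "?P g \<noteq> {}" if "g \<in> ?L" for g
    using that B pS(2) by (auto simp: letters_def)
  show "?P g \<inter> ?P h = {}" if gh: "g \<in> ?L" "h \<in> ?L" "g \<noteq> h" for g h
  proof -
    obtain s t where st: "s \<in> S" "g = Gen s S m" "t \<in> S" "h = Gen t S m"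
      using gh(1,2) by (auto simp: letters_def)
    then have "p s \<inter> p t = {}" using p gh(3) unfolding lcm_datum_def by blast
    then show ?thesis by (auto simp: letters_def st(2,4))
  qed
  show "altp n (garside (?P g)) (garside (?P h)) = altp n (garside (?P h)) (garside (?P g)) \<and>
      is_join (garside (?P g)) (garside (?P h)) (altp n (garside (?P h)) (garside (?P g)))"
    if gh: "g \<in> ?L" "h \<in> ?L" "g \<noteq> h" "cm g h = enat n" for g h n
  proof -
    obtain s t where s: "s \<in> S" "g = Gen s S m" and t: "t \<in> S" "h = Gen t S m"
      using gh(1,2) by (auto simp: letters_def)
    have n: "m s t = enat n" "s \<noteq> t" using gh(3,4) cm_Gen[OF fc(1) s(1) t(1)] s(2) t(2) by auto
    let ?X = "garside (letters S' m' (p s))" and ?Y = "garside (letters S' m' (p t))"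
    let ?D = "altp n ?Y ?X" and ?D' = "altp n ?X ?Y"
    have supp: "supp ?X \<subseteq> letters S' m' S'" "supp ?Y \<subseteq> letters S' m' S'"
      using garside(3)[OF B[OF s(1)]] garside(3)[OF B[OF t(1)]]
        letters_mono[OF pS(1)[OF s(1)]] letters_mono[OF pS(1)[OF t(1)]] by auto
    have suppD: "supp ?D \<subseteq> letters S' m' S'" "supp ?D' \<subseteq> letters S' m' S'"
      using supp_altp[of n ?Y ?X] supp_altp[of n ?X ?Y] supp by blast+
    have Delta: "Delta S' m' (p s) = to_group S' m' ?X" "Delta S' m' (p t) = to_group S' m' ?Y"
      using Delta_to_group[OF fc(2)] pS(1,3) s(1) t(1) by auto
    let ?M = "artin_monoid S' m'" and ?ds = "Delta S' m' (p s)" and ?dt = "Delta S' m' (p t)"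
    have "alt_prod ?M n ?ds ?dt = alt_prod ?M n ?dt ?ds \<and> is_lcm ?M {?ds, ?dt} (alt_prod ?M n ?dt ?ds)"
      using p s(1) t(1) n unfolding lcm_datum_def Let_def by blast
    then have L2: "to_group S' m' ?D' = to_group S' m' ?D"
      "is_lcm ?M {to_group S' m' ?X, to_group S' m' ?Y} (to_group S' m' ?D)"
      unfolding Delta alt_prod_to_group[OF fc(2)] by blast+
    have "?D' = ?D" by (rule to_group_inj[OF fc(2) suppD(2,1) L2(1)])
    moreover have D: "?X dvd ?D" "?Y dvd ?D"
      "\<And>y. supp y \<subseteq> letters S' m' S' \<Longrightarrow> ?X dvd y \<Longrightarrow> ?Y dvd y \<Longrightarrow> ?D dvd y"
      using L2(2) is_lcm_to_group[OF fc(2), of "{?X, ?Y}" ?D] supp suppD(1) by auto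
    \<comment> \<open>The datum gives a least common multiple only among elements of the system. The
      join \<open>l\<close> in the whole type is supported in the system, so \<open>?D\<close>
      divides it and equals it.\<close>
    obtain l where l: "is_join ?X ?Y l" "supp l \<subseteq> supp ?X \<union> supp ?Y"
      using join_exists[OF D(1,2)] by blast
    have "?D dvd l" using l supp by (intro D(3) is_joinD(1,2)[OF l(1)]) blast
    then have "?D = l" using is_joinD(3)[OF l(1) D(1,2)] by (rule dvd_left_antisym)
    ultimately show ?thesis using l(1) by (simp add: s(2) t(2))
  qed
  show "\<exists>v\<in>?P h. cm u v = \<infinity>"
    if gh: "g \<in> ?L" "h \<in> ?L" "g \<noteq> h" "cm g h = \<infinity>" "u \<in> ?P g" for g h u
  proof (rule ccontr)
    assume "\<not> (\<exists>v\<in>?P h. cm u v = \<infinity>)"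
    then have fin: "\<forall>v\<in>?P h. cm u v \<noteq> \<infinity>" by simp
    obtain s t where s: "s \<in> S" "g = Gen s S m" and t: "t \<in> S" "h = Gen t S m"
      using gh(1,2) by (auto simp: letters_def)
    have st: "m s t = \<infinity>" "s \<noteq> t" using gh(3,4) cm_Gen[OF fc(1) s(1) t(1)] s(2) t(2) by auto
    obtain x where x: "x \<in> p s" "u = Gen x S' m'" using gh(5) s(2) by (auto simp: letters_def)
    have sub: "{x} \<union> p t \<subseteq> S'" using x(1) pS(1)[OF s(1)] pS(1)[OF t(1)] by blast
    \<comment> \<open>The letters of \<open>p t\<close> already form a clique, so without an
      infinite label at \<open>u\<close> type FC would make \<open>{x} \<union> p t\<close>
      spherical, against the last clause of \<open>lcm_datum\<close>.\<close>
    have "clique (?P h)" using bounded_clique[OF B[OF t(1)]] t(2) by simp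
    then have K: "clique ({u} \<union> ?P h)" unfolding clique_Un using fin by simp
    have "m' a b \<noteq> \<infinity>" if "a \<in> {x} \<union> p t" "b \<in> {x} \<union> p t" for a b
    proof -
      have "Gen a S' m' \<in> {u} \<union> ?P h" "Gen b S' m' \<in> {u} \<union> ?P h"
        using that x(2) t(2) by (auto simp: letters_def)
      then have "cm (Gen a S' m') (Gen b S' m') \<noteq> \<infinity>" using K unfolding clique_def by blast
      then show ?thesis using cm_Gen[OF fc(2)] that sub by (metis subsetD)
    qed
    then have "spherical ({x} \<union> p t) m'"
      using fc(2) sub unfolding fc_system_def type_FC_def by blast
    moreover have "\<not> spherical ({x} \<union> p t) m'"
      using p s(1) t(1) st x(1) unfolding lcm_datum_def by blast
    ultimately show False by blast
  qed
qed

theorem mainTheorem1: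
  fixes S :: "'a set" and m :: "'a \<Rightarrow> 'a \<Rightarrow> enat"
    and S' :: "'b set" and m' :: "'b \<Rightarrow> 'b \<Rightarrow> enat"
    and p :: "'a \<Rightarrow> 'b set" and \<phi> :: "'a letters set \<Rightarrow> 'b letters set"
  assumes "coxeter_matrix S m" and "type_FC S m"
    and "coxeter_matrix S' m'" and "type_FC S' m'"
    and "lcm_homomorphism S m S' m' p \<phi>"
  shows "inj_on \<phi> (carrier (artin_group S m))"
proof -
  have fc: "fc_system S m" "fc_system S' m'" using assms(1-4) by (auto simp: fc_system_def)
  have p: "lcm_datum S m S' m' p" and hom: "\<phi> \<in> hom (artin_group S m) (artin_group S' m')"
    and gen: "\<And>s. s \<in> S \<Longrightarrow> \<phi> (artin_gen S m s) = Delta S' m' (p s)"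
    using assms(5) by (auto simp: lcm_homomorphism_def)
  interpret lcm_map "letters S m S" "\<lambda>g. letters S' m' (p (label g))"
    by (rule lcm_map_lcm_datum[OF fc p])
  interpret group_hom "artin_group S m" "artin_group S' m'" \<phi>
    using hom by (intro group_hom.intro group_hom_axioms.intro group_artin_group)
  have pS: "p s \<subseteq> S'" "spherical (p s) m'" if "s \<in> S" for s
    using p that unfolding lcm_datum_def by auto
  have Phi: "\<phi> (to_group S m x) = to_group S' m' (\<Phi> x)" if "supp x \<subseteq> letters S m S" for x
    using that
  proof (induction x rule: atom_induct)
    case (atom g x)
    then obtain s where s: "s \<in> S" "g = Gen s S m" "g \<in> letters S m S" by (auto simp: letters_def)
    have "\<phi> (to_group S m (atom g)) = to_group S' m' (\<Phi> (atom g))"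
      using gen[OF s(1)] Delta_to_group[OF fc(2) pS[OF s(1)]] Phi_atom[OF s(3)]
      by (simp add: s(2) to_group_atom[OF fc(1) s(1)])
    then show ?case using atom by (simp add: to_group_mult fc to_group_closed)
  qed (simp add: to_group_one fc)
  have supp: "supp (\<Phi> x) \<subseteq> letters S' m' S'" if "supp x \<subseteq> letters S m S" for x
    unfolding supp_Phi[OF that] using that pS(1) by (fastforce simp: letters_def)
  have "U = \<one>\<^bsub>artin_group S m\<^esub>" if U: "U \<in> carrier (artin_group S m)" "\<phi> U = \<one>\<^bsub>artin_group S' m'\<^esub>" for U
  proof -
    obtain c n where c: "art.irred c" "art.supp_below n c" "\<And>k. supp (c k) \<subseteq> letters S m S"
      "mf_value S m c n = U"
      using irreducible_exists[OF fc(1) U(1)] by blast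
    let ?d = "\<lambda>k. \<Phi> (c k)"
    have "\<phi> (mf_value S m c k) = mf_value S' m' ?d k" for k
      by (induction k) (simp_all add: mf_value_closed to_group_closed Phi c(3))
    then have "mf_value S' m' ?d n = \<one>\<^bsub>artin_group S' m'\<^esub>" using c(4) U(2) by metis
    moreover have "art.irred ?d" by (rule irred_Phi[OF c(3,1)])
    moreover have "art.supp_below n ?d" using c(2) by (simp add: art.supp_below_def)
    ultimately have "?d = (\<lambda>_. 1)" using supp[OF c(3)] by (intro irreducible_value_one[OF fc(2)])
    then have "c k = 1" for k using Phi_eq_one[OF c(3)] by metis
    then have "c = (\<lambda>_. 1)" by blast
    moreover have "mf_value S m (\<lambda>_. 1) k = \<one>\<^bsub>artin_group S m\<^esub>" for k
      by (induction k) (simp_all add: to_group_one fc)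
    ultimately show ?thesis using c(4) by simp
  qed
  then show ?thesis
    unfolding inj_iff_trivial_ker kernel_def by auto
qed

end
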